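(* Let $\mathcal M$ be a quasianalytic regular weight sequence, let $U\subseteq\mathbb R^n$ be an open neighbourhood of $p_0$, and let $\mathfrak g$ be a Lie subalgebra of $\mathfrak X_{\mathcal M}(U)$ which is also an $\mathcal E_{\mathcal M}(U)$-module (i.e. $X\in\mathfrak g$, $f\in\mathcal E_{\mathcal M}(U)$ imply $fX\in\mathfrak g$). Then there exists an ultradifferentiable submanifold $W\subseteq U$ of class $\{\mathcal M\}$ with $p_0\in W$ such that $$T_pW=\mathfrak g(p):=\{X(p):X\in\mathfrak g\}\qquad\text{for all }p\in W.$$ Moreover, the germ of $W$ at $p_0$ is uniquely determined by this property.
   Context: A weight sequence is a sequence $(M_j)_{j\ge0}$ of positive reals with $M_0=1$ and $M_j^2\le M_{j-1}M_{j+1}$. Put $m_k=M_k/k!$. $\mathcal M$ is regular if $m_0=m_1=1$, $\sup_k (m_{k+1}/m_k)^{1/k}<\infty$, $m_k^2\le m_{k-1}m_{k+1}$ for $k\ge1$, and $m_k^{1/k}\to\infty$. $\mathcal M$ is quasianalytic if $\sum_{k\ge1}M_{k-1}/M_k=\infty$. For open $\Omega\subseteq\mathbb R^n$, $\mathcal E_{\mathcal M}(\Omega)$ is the space of smooth $f$ such that for every compact $K\subset\Omega$ there are $C,h>0$ with $|D^\alpha f(x)|\le Ch^{|\alpha|}M_{|\alpha|}$ for all $x\in K$, $\alpha\in\mathbb N_0^n$. $\mathfrak X_{\mathcal M}(U)$ denotes the vector fields on $U$ with coefficients in $\mathcal E_{\mathcal M}(U)$; a submanifold of class $\{\mathcal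 M\}$ is one locally given by charts whose transition maps and embedding are of class $\mathcal E_{\mathcal M}$. *)

theory Defs
  imports "HOL-Analysis.Analysis"
begin

definition weight_seq :: "(nat \<Rightarrow> real) \<Rightarrow> bool" where
  "weight_seq M \<longleftrightarrow> M 0 = 1 \<and> (\<forall>j. M j > 0) \<and>
     (\<forall>j\<ge>1. (M j)\<^sup>2 \<le> M (j - 1) * M (j + 1))"

definition small_m :: "(nat \<Rightarrow> real) \<Rightarrow> nat \<Rightarrow> real" where
  "small_m M k = M k / fact k"

definition regular_ws :: "(nat \<Rightarrow> real) \<Rightarrow> bool" where
  "regular_ws M \<longleftrightarrow>
     small_m M 0 = 1 \<and> small_m M 1 = 1 \<and>
     (\<exists>B. \<forall>k\<ge>1. root k (small_m M (Suc k) / small_m M k) \<le> B) \<and>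
     (\<forall>k\<ge>1. (small_m M k)\<^sup>2 \<le> small_m M (k - 1) * small_m M (k + 1)) \<and>
     filterlim (\<lambda>k. root k (small_m M k)) at_top sequentially"

text \<open>Quasianalytic: the series of M (k-1) / M k over k >= 1 diverges
  (positive terms, so divergence is non-summability).\<close>
definition quasianalytic :: "(nat \<Rightarrow> real) \<Rightarrow> bool" where
  "quasianalytic M \<longleftrightarrow> \<not> summable (\<lambda>k. M k / M (Suc k))"

fun pd :: "'n::finite list \<Rightarrow> (real^'n \<Rightarrow> real) \<Rightarrow> real^'n \<Rightarrow> real" where
  "pd [] f = f"
| "pd (i # is) f = (\<lambda>x. deriv (\<lambda>t. pd is f (x + t *\<^sub>R axis i 1)) 0)"

definition smooth_on :: "(real^'n::finite) set \<Rightarrow> (real^'n \<Rightarrow> real) \<Rightarrow> bool" where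
  "smooth_on \<Omega> f \<longleftrightarrow>
     (\<forall>ks. continuous_on \<Omega> (pd ks f) \<and>
       (\<forall>x\<in>\<Omega>. \<forall>i. (\<lambda>t. pd ks f (x + t *\<^sub>R axis i 1)) differentiable (at 0)))"

definition E_M :: "(nat \<Rightarrow> real) \<Rightarrow> (real^'n::finite) set \<Rightarrow> (real^'n \<Rightarrow> real) \<Rightarrow> bool" where
  "E_M M \<Omega> f \<longleftrightarrow> smooth_on \<Omega> f \<and>
     (\<forall>K. compact K \<and> K \<subseteq> \<Omega> \<longrightarrow>
        (\<exists>C h. C > 0 \<and> h > 0 \<and>
           (\<forall>ks. \<forall>x\<in>K. \<bar>pd ks f x\<bar> \<le> C * h ^ length ks * M (length ks))))"

definition map_M :: "(nat \<Rightarrow> real) \<Rightarrow> (real^'n::finite) set \<Rightarrow> (real^'n \<Rightarrow> real^'n) \<Rightarrow> bool" where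
  "map_M M \<Omega> F \<longleftrightarrow> (\<forall>j. E_M M \<Omega> (\<lambda>x. F x $ j))"

text \<open>A vector field on U is represented by its coefficient map, normalised to 0 outside U.\<close>
definition VF_M :: "(nat \<Rightarrow> real) \<Rightarrow> (real^'n::finite) set \<Rightarrow> (real^'n \<Rightarrow> real^'n) set" where
  "VF_M M U = {X. map_M M U X \<and> (\<forall>x. x \<notin> U \<longrightarrow> X x = 0)}"

definition lie_bracket ::
  "(real^'n::finite) set \<Rightarrow> (real^'n \<Rightarrow> real^'n) \<Rightarrow> (real^'n \<Rightarrow> real^'n) \<Rightarrow> (real^'n \<Rightarrow> real^'n)" where
  "lie_bracket U X Y = (\<lambda>x. if x \<in> U then
      (\<chi> j. \<Sum>i\<in>UNIV. X x $ i * pd [i] (\<lambda>y. Y y $ j) x - Y x $ i * pd [i] (\<lambda>y. X y $ j) x)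
    else 0)"

definition lie_subalgebra ::
  "(nat \<Rightarrow> real) \<Rightarrow> (real^'n::finite) set \<Rightarrow> (real^'n \<Rightarrow> real^'n) set \<Rightarrow> bool" where
  "lie_subalgebra M U g \<longleftrightarrow> g \<subseteq> VF_M M U \<and> (\<lambda>x. 0) \<in> g \<and>
     (\<forall>X\<in>g. \<forall>Y\<in>g. (\<lambda>x. X x + Y x) \<in> g) \<and>
     (\<forall>X\<in>g. \<forall>c::real. (\<lambda>x. c *\<^sub>R X x) \<in> g) \<and>
     (\<forall>X\<in>g. \<forall>Y\<in>g. lie_bracket U X Y \<in> g)"

definition EM_module ::
  "(nat \<Rightarrow> real) \<Rightarrow> (real^'n::finite) set \<Rightarrow> (real^'n \<Rightarrow> real^'n) set \<Rightarrow> bool" where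
  "EM_module M U g \<longleftrightarrow> (\<forall>X\<in>g. \<forall>f. E_M M U f \<longrightarrow> (\<lambda>x. f x *\<^sub>R X x) \<in> g)"

definition coord_subspace :: "'n::finite set \<Rightarrow> (real^'n) set" where
  "coord_subspace S = {y. \<forall>i. i \<notin> S \<longrightarrow> y $ i = 0}"

definition slice_chart ::
  "(nat \<Rightarrow> real) \<Rightarrow> (real^'n::finite) set \<Rightarrow> (real^'n) set \<Rightarrow> (real^'n \<Rightarrow> real^'n)
     \<Rightarrow> (real^'n \<Rightarrow> real^'n) \<Rightarrow> 'n set \<Rightarrow> bool" where
  "slice_chart M W V \<Phi> \<Psi> S \<longleftrightarrow> open V \<and> open (\<Phi> ` V) \<and>
     (\<forall>x\<in>V. \<Psi> (\<Phi> x) = x) \<and> (\<forall>y\<in>\<Phi> ` V. \<Phi> (\<Psi> y) = y) \<and>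
     map_M M V \<Phi> \<and> map_M M (\<Phi> ` V) \<Psi> \<and>
     \<Phi> ` (W \<inter> V) = \<Phi> ` V \<inter> coord_subspace S"

definition submanifold_M :: "(nat \<Rightarrow> real) \<Rightarrow> (real^'n::finite) set \<Rightarrow> (real^'n) set \<Rightarrow> bool" where
  "submanifold_M M U W \<longleftrightarrow> W \<subseteq> U \<and>
     (\<forall>p\<in>W. \<exists>V \<Phi> \<Psi> S. p \<in> V \<and> V \<subseteq> U \<and> slice_chart M W V \<Phi> \<Psi> S)"

text \<open>Tangent space at p: image of the coordinate subspace under the derivative of the
  inverse of a slice chart at the image of p (independent of the chart).\<close>
definition tangent_space :: "(nat \<Rightarrow> real) \<Rightarrow> (real^'n::finite) set \<Rightarrow> real^'n \<Rightarrow> (real^'n) set" where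
  "tangent_space M W p = {v. \<exists>V \<Phi> \<Psi> S D. p \<in> V \<and> slice_chart M W V \<Phi> \<Psi> S \<and>
       (\<Psi> has_derivative D) (at (\<Phi> p)) \<and> v \<in> D ` coord_subspace S}"

end

(* Choose a maximal set S of coordinates over which some fields X i of g (divided by a nowhere vanishing
   function) have the form e_i + (components outside S). By maximality every field of g without S-components
   vanishes at p0; the coefficients of these fields generate an ideal J stable under the X i, so members of J
   are flat at p0 along the integral curves of the combinations of the X i. Derivatives along such curves are
   iterated Lie derivatives, whose M-bounds follow from m j * m k <= m (j + k), so by Denjoy-Carleman J vanishes
   along the curves. Hence the X i commute there, and the end points of the curves form a graph G over the S
   coordinates with partial derivatives X i o G; the partial derivatives of G of any order are again iterated
   Lie derivatives, so G is of class M, and its graph is the leaf. *)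
theory Submission
  imports Defs
begin

section \<open>Partial derivatives and smoothness\<close>

text \<open>The class is never shown to be closed under composition, inversion of maps or solution
  of differential equations. Sums, products, reciprocals, partial derivatives and words of Lie
  derivatives suffice: \<open>G\<close> depends only on the coordinates in \<open>S\<close> and
  preserves them, so subtracting the graph is a chart whose inverse adds it back. The obstacle is
  that the \<open>X i\<close> are known to commute only on the zero set of \<open>J\<close>, not on
  an open set, so the classical Frobenius theorem does not apply. The derivative of the end point in
  the parameter is computed by hand, using commutation along one curve only. The parameter is kept
  so small that over unit time every Lipschitz constant is at most 1/2; a supremum argument then
  replaces exponential Gronwall bounds. For uniqueness, a rival manifold is not known to lie in the
  zero set. Equality of dimensions identifies its tangent spaces with the span of the
  \<open>X i\<close>, a comparison of curves places it inside the graph, and invariance of domain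
  makes it cover a neighbourhood there.\<close>

declare pd.simps(2) [simp del]

text \<open>\<open>deriv\<close> has an arbitrary value where no derivative exists; this relation
  also asserts existence, so the calculus rules apply before values of \<open>pd\<close> are read
  off.\<close>

definition has_pd :: "'n::finite \<Rightarrow> (real^'n \<Rightarrow> real) \<Rightarrow> real^'n \<Rightarrow> real \<Rightarrow> bool" where
  "has_pd i f x d \<longleftrightarrow> ((\<lambda>t. f (x + t *\<^sub>R axis i 1)) has_real_derivative d) (at 0)"

lemma has_pd_imp_pd: "has_pd i f x d \<Longrightarrow> pd [i] f x = d"
  unfolding has_pd_def by (simp add: pd.simps(2) DERIV_imp_deriv)

text \<open>The head of the list is the outermost derivative, so the last entry is taken first.
  Inductions that differentiate a product or a reciprocal once split the list at its end.\<close>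

lemma pd_append: "pd (ks @ ls) f = pd ks (pd ls f)"
  by (induction ks) (simp_all add: pd.simps(2))

lemma smooth_on_has_pd:
  assumes "smooth_on \<Omega> f" "x \<in> \<Omega>"
  shows "has_pd i (pd ks f) x (pd (i # ks) f x)"
  using assms unfolding smooth_on_def has_pd_def
  by (simp add: pd.simps(2) DERIV_deriv_iff_real_differentiable)

lemma has_pd_transform:
  assumes "open \<Omega>" "x \<in> \<Omega>" "\<And>y. y \<in> \<Omega> \<Longrightarrow> f y = g y" "has_pd i f x d"
  shows "has_pd i g x d"
proof -
  have "isCont (\<lambda>t::real. x + t *\<^sub>R axis i (1::real)) 0" by simp
  then have "\<forall>\<^sub>F t in nhds (0::real). x + t *\<^sub>R axis i (1::real) \<in> \<Omega>"
    using assms(1,2) by (auto simp: isCont_def tendsto_def eventually_at_filter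
      elim!: allE[of _ \<Omega>] eventually_mono)
  then have "\<forall>\<^sub>F t in nhds (0::real). f (x + t *\<^sub>R axis i 1) = g (x + t *\<^sub>R axis i 1)"
    by (rule eventually_mono) (simp add: assms(3))
  then show ?thesis
    using assms(4) unfolding has_pd_def by (subst (asm) DERIV_cong_ev[OF refl _ refl]) auto
qed

lemma pd_cong:
  assumes "open \<Omega>" "\<And>y. y \<in> \<Omega> \<Longrightarrow> f y = g y" "x \<in> \<Omega>"
  shows "pd ks f x = pd ks g x"
  using assms(3)
proof (induction ks arbitrary: x)
  case Nil
  then show ?case using assms by simp
next
  case (Cons i ks)
  have "has_pd i (pd ks f) x d = has_pd i (pd ks g) x d" for d
    using has_pd_transform[OF assms(1) Cons.prems, of "pd ks f" "pd ks g" i d]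
      has_pd_transform[OF assms(1) Cons.prems, of "pd ks g" "pd ks f" i d] Cons.IH
    by auto
  then show ?case by (simp add: has_pd_def deriv_def pd.simps(2))
qed

text \<open>Smoothness as a greatest fixed point: the family \<open>P\<close> only has to be closed
  under partial derivatives up to equality on \<open>\<Omega>\<close>. This replaces formulas for
  higher derivatives.\<close>

lemma smooth_on_coinduct:
  assumes op: "open \<Omega>" and P: "P f"
    and cont: "\<And>f. P f \<Longrightarrow> continuous_on \<Omega> f"
    and der: "\<And>f i. P f \<Longrightarrow> \<exists>d. P d \<and> (\<forall>x\<in>\<Omega>. has_pd i f x (d x))"
  shows "smooth_on \<Omega> f"
proof -
  have *: "\<exists>d. P d \<and> (\<forall>x\<in>\<Omega>. pd ks f x = d x)" for ks
  proof (induction ks)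
    case Nil
    then show ?case using P by auto
  next
    case (Cons i ks)
    then obtain d where d: "P d" "\<And>x. x \<in> \<Omega> \<Longrightarrow> d x = pd ks f x" by fastforce
    then obtain e where e: "P e" "\<And>x. x\<in>\<Omega> \<Longrightarrow> has_pd i d x (e x)" using der by meson
    then show ?case
      using has_pd_transform[OF op _ d(2) e(2)] has_pd_imp_pd
      by (metis append_Cons append_Nil pd_append)
  qed
  show ?thesis
    unfolding smooth_on_def
  proof (intro allI conjI ballI)
    fix ks
    obtain d where d: "P d" "\<And>x. x\<in>\<Omega> \<Longrightarrow> d x = pd ks f x" using *[of ks] by fastforce
    show "continuous_on \<Omega> (pd ks f)"
      using cont[OF d(1)] d(2) continuous_on_cong by metis
    fix x i assume x: "x \<in> \<Omega>"
    obtain e where e: "P e" "\<And>x. x\<in>\<Omega> \<Longrightarrow> has_pd i d x (e x)" using der[OF d(1)] by meson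
    show "(\<lambda>t. pd ks f (x + t *\<^sub>R axis i 1)) differentiable at 0"
      using has_pd_transform[OF op x d(2) e(2)[OF x]] unfolding has_pd_def
      using real_differentiable_def by auto
  qed
qed

lemma smooth_on_continuous: "smooth_on \<Omega> f \<Longrightarrow> continuous_on \<Omega> (pd ks f)"
  unfolding smooth_on_def by blast

lemma smooth_on_continuous0: "smooth_on \<Omega> f \<Longrightarrow> continuous_on \<Omega> f"
  using smooth_on_continuous[of \<Omega> f "[]"] by simp

lemma smooth_on_pd: "smooth_on \<Omega> f \<Longrightarrow> smooth_on \<Omega> (pd ks f)"
  unfolding smooth_on_def pd_append[symmetric] by blast

lemma smooth_on_subset: "smooth_on \<Omega> f \<Longrightarrow> \<Omega>' \<subseteq> \<Omega> \<Longrightarrow> smooth_on \<Omega>' f"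
  unfolding smooth_on_def using continuous_on_subset by blast

lemma smooth_on_has_pd1:
  assumes "smooth_on \<Omega> f" "x \<in> \<Omega>"
  shows "has_pd i f x (pd [i] f x)"
  using smooth_on_has_pd[OF assms, of i "[]"] by simp

lemma smooth_on_cong:
  assumes "open \<Omega>" "\<And>y. y \<in> \<Omega> \<Longrightarrow> f y = g y" "smooth_on \<Omega> f"
  shows "smooth_on \<Omega> g"
proof (rule smooth_on_coinduct[OF assms(1), where P = "\<lambda>h. \<exists>f. smooth_on \<Omega> f \<and> (\<forall>y\<in>\<Omega>. f y = h y)"])
  show "\<exists>f. smooth_on \<Omega> f \<and> (\<forall>y\<in>\<Omega>. f y = g y)" using assms by blast
next
  fix h assume "\<exists>f. smooth_on \<Omega> f \<and> (\<forall>y\<in>\<Omega>. f y = h y)"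
  then obtain f where f: "smooth_on \<Omega> f" "\<And>y. y\<in>\<Omega> \<Longrightarrow> f y = h y" by blast
  show "continuous_on \<Omega> h" using smooth_on_continuous0[OF f(1)] f(2) continuous_on_cong by metis
  fix i
  show "\<exists>d. (\<exists>f. smooth_on \<Omega> f \<and> (\<forall>y\<in>\<Omega>. f y = d y)) \<and> (\<forall>x\<in>\<Omega>. has_pd i h x (d x))"
    by (intro exI[of _ "pd [i] f"] conjI ballI smooth_on_pd f refl
      has_pd_transform[OF assms(1) _ f(2)] smooth_on_has_pd1[OF f(1)])
qed

section \<open>Smoothness of constants, sums, products and reciprocals\<close>

lemma has_pd_const: "has_pd i (\<lambda>x. c) x 0"
  unfolding has_pd_def by simp

lemma has_pd_coord: "has_pd i (\<lambda>x. x $ j) x (if i = j then 1 else 0)"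
  unfolding has_pd_def
  by (auto simp: axis_def intro!: derivative_eq_intros)

lemma has_pd_add: "has_pd i f x a \<Longrightarrow> has_pd i g x b \<Longrightarrow> has_pd i (\<lambda>x. f x + g x) x (a + b)"
  unfolding has_pd_def by (rule DERIV_add)

lemma has_pd_mult:
  "has_pd i f x a \<Longrightarrow> has_pd i g x b \<Longrightarrow> has_pd i (\<lambda>x. f x * g x) x (a * g x + f x * b)"
  unfolding has_pd_def by (drule (1) DERIV_mult) (simp add: mult.commute)

lemma smooth_on_const [simp]:
  assumes "open \<Omega>" shows "smooth_on \<Omega> (\<lambda>x. c)"
  by (rule smooth_on_coinduct[OF assms, where P = "\<lambda>f. \<exists>c. f = (\<lambda>x. c)"])
    (use has_pd_const in fastforce)+

lemma smooth_on_coord: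
  assumes "open \<Omega>" shows "smooth_on \<Omega> (\<lambda>x. x $ j)"
proof (rule smooth_on_coinduct[OF assms, where P = "\<lambda>f. (\<exists>c. f = (\<lambda>x. c)) \<or> f = (\<lambda>x. x $ j)"])
  fix f :: "real^'a \<Rightarrow> real" and i
  assume f: "(\<exists>c. f = (\<lambda>x. c)) \<or> f = (\<lambda>x. x $ j)"
  then show "continuous_on \<Omega> f" by (auto intro!: continuous_intros)
  have "\<exists>c. \<forall>x\<in>\<Omega>. has_pd i f x c"
    using f has_pd_const[of i _] has_pd_coord[of i j] by blast
  then show "\<exists>d. ((\<exists>c. d = (\<lambda>x. c)) \<or> d = (\<lambda>x. x $ j)) \<and> (\<forall>x\<in>\<Omega>. has_pd i f x (d x))"
    by metis
qed simp

text \<open>If the partial derivatives of the members of \<open>H\<close> stay in this algebra, the coinduction principle applies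
  to all of it.\<close>

inductive_set smooth_gen :: "(real^'n::finite) set \<Rightarrow> (real^'n \<Rightarrow> real) set \<Rightarrow> (real^'n \<Rightarrow> real) set"
  for \<Omega> H where
  base: "smooth_on \<Omega> f \<Longrightarrow> f \<in> smooth_gen \<Omega> H"
| gen: "f \<in> H \<Longrightarrow> f \<in> smooth_gen \<Omega> H"
| add: "f \<in> smooth_gen \<Omega> H \<Longrightarrow> g \<in> smooth_gen \<Omega> H \<Longrightarrow> (\<lambda>x. f x + g x) \<in> smooth_gen \<Omega> H"
| mult: "f \<in> smooth_gen \<Omega> H \<Longrightarrow> g \<in> smooth_gen \<Omega> H \<Longrightarrow> (\<lambda>x. f x * g x) \<in> smooth_gen \<Omega> H"

lemma smooth_gen_smooth:
  assumes op: "open \<Omega>"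
    and cont: "\<And>h. h \<in> H \<Longrightarrow> continuous_on \<Omega> h"
    and der: "\<And>h i. h \<in> H \<Longrightarrow> \<exists>d\<in>smooth_gen \<Omega> H. \<forall>x\<in>\<Omega>. has_pd i h x (d x)"
    and f: "f \<in> smooth_gen \<Omega> H"
  shows "smooth_on \<Omega> f"
proof (rule smooth_on_coinduct[OF op, where P = "\<lambda>f. f \<in> smooth_gen \<Omega> H"])
  show "f \<in> smooth_gen \<Omega> H" by fact
next
  fix f assume "f \<in> smooth_gen \<Omega> H"
  then show "continuous_on \<Omega> f"
    by induction (auto intro: cont smooth_on_continuous0 continuous_intros)
next
  fix f i assume "f \<in> smooth_gen \<Omega> H"
  then show "\<exists>d. d \<in> smooth_gen \<Omega> H \<and> (\<forall>x\<in>\<Omega>. has_pd i f x (d x))"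
  proof induction
    case (base f)
    then show ?case
      by (meson smooth_gen.base smooth_on_has_pd1 smooth_on_pd)
  next
    case (gen f)
    then show ?case using der by blast
  next
    case (add f g)
    then obtain d e where "d \<in> smooth_gen \<Omega> H" "\<forall>x\<in>\<Omega>. has_pd i f x (d x)"
      "e \<in> smooth_gen \<Omega> H" "\<forall>x\<in>\<Omega>. has_pd i g x (e x)" by blast
    then show ?case
      by (intro exI[of _ "\<lambda>x. d x + e x"] conjI ballI smooth_gen.add has_pd_add) simp_all
  next
    case (mult f g)
    then obtain d e where "d \<in> smooth_gen \<Omega> H" "\<forall>x\<in>\<Omega>. has_pd i f x (d x)"
      "e \<in> smooth_gen \<Omega> H" "\<forall>x\<in>\<Omega>. has_pd i g x (e x)" by blast
    then show ?case using mult.hyps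
      by (intro exI[of _ "\<lambda>x. d x * g x + f x * e x"] conjI ballI smooth_gen.add smooth_gen.mult has_pd_mult)
        simp_all
  qed
qed

lemma smooth_on_add:
  "open \<Omega> \<Longrightarrow> smooth_on \<Omega> f \<Longrightarrow> smooth_on \<Omega> g \<Longrightarrow> smooth_on \<Omega> (\<lambda>x. f x + g x)"
  by (rule smooth_gen_smooth[where H = "{}"]) (simp_all add: smooth_gen.base smooth_gen.add)

lemma smooth_on_mult:
  "open \<Omega> \<Longrightarrow> smooth_on \<Omega> f \<Longrightarrow> smooth_on \<Omega> g \<Longrightarrow> smooth_on \<Omega> (\<lambda>x. f x * g x)"
  by (rule smooth_gen_smooth[where H = "{}"]) (simp_all add: smooth_gen.base smooth_gen.mult)

lemma smooth_on_sum:
  "open \<Omega> \<Longrightarrow> (\<And>a. a \<in> A \<Longrightarrow> smooth_on \<Omega> (f a)) \<Longrightarrow> smooth_on \<Omega> (\<lambda>x. \<Sum>a\<in>A. f a x)"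
proof (induction A rule: infinite_finite_induct)
  case (insert a A)
  then show ?case by (simp add: smooth_on_add)
qed auto

lemma has_pd_inverse:
  assumes "has_pd i f x a" "f x \<noteq> 0"
  shows "has_pd i (\<lambda>x. inverse (f x)) x (- (a * (inverse (f x) * inverse (f x))))"
  using DERIV_inverse_fun[of "\<lambda>t. f (x + t *\<^sub>R axis i 1)" a 0] assms
  unfolding has_pd_def by (simp add: power2_eq_square)

text \<open>The single generator \<open>1 / f\<close> suffices: its derivative is minus
  \<open>f'\<close> times its own square, hence stays in the generated algebra.\<close>

lemma smooth_on_inverse:
  assumes op: "open \<Omega>" and f: "smooth_on \<Omega> f" and nz: "\<And>x. x \<in> \<Omega> \<Longrightarrow> f x \<noteq> 0"
  shows "smooth_on \<Omega> (\<lambda>x. inverse (f x))"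
proof (rule smooth_gen_smooth[OF op, where H = "{\<lambda>x. inverse (f x)}"])
  let ?H = "{\<lambda>x. inverse (f x)}"
  fix h assume h: "h \<in> ?H"
  show "continuous_on \<Omega> h" using h nz smooth_on_continuous0[OF f]
    by (auto intro!: continuous_intros)
  fix i
  have m: "(\<lambda>x. (-1) * (pd [i] f x * (inverse (f x) * inverse (f x)))) \<in> smooth_gen \<Omega> ?H"
    by (intro smooth_gen.mult smooth_gen.base[OF smooth_on_const[OF op]] smooth_gen.base[OF smooth_on_pd[OF f]] smooth_gen.gen) simp_all
  show "\<exists>d\<in>smooth_gen \<Omega> ?H. \<forall>x\<in>\<Omega>. has_pd i h x (d x)"
    using h nz by (intro bexI[OF _ m]) (auto intro!: has_pd_inverse smooth_on_has_pd1[OF f])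
qed (rule smooth_gen.gen, simp)

lemma pd_add:
  assumes "open \<Omega>" "smooth_on \<Omega> f" "smooth_on \<Omega> g" "x \<in> \<Omega>"
  shows "pd ks (\<lambda>x. f x + g x) x = pd ks f x + pd ks g x"
  using assms(4)
proof (induction ks arbitrary: x)
  case (Cons i ks)
  have "has_pd i (\<lambda>x. pd ks f x + pd ks g x) x (pd (i#ks) f x + pd (i#ks) g x)"
    by (intro has_pd_add smooth_on_has_pd[OF assms(2) Cons.prems] smooth_on_has_pd[OF assms(3) Cons.prems])
  then have "has_pd i (pd ks (\<lambda>x. f x + g x)) x (pd (i#ks) f x + pd (i#ks) g x)"
    by (rule has_pd_transform[OF assms(1) Cons.prems, rotated]) (simp add: Cons.IH)
  then show ?case using has_pd_imp_pd
    by (metis append_Cons append_Nil pd_append)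
qed simp

lemma pd_const: "pd ks (\<lambda>x. c) x = (if ks = [] then c else 0)"
proof (induction ks arbitrary: x)
  case (Cons i ks)
  show ?case
  proof (cases "ks = []")
    case True
    then show ?thesis using has_pd_imp_pd[OF has_pd_const] by simp
  next
    case False
    then have "pd ks (\<lambda>x. c) = (\<lambda>x. 0)" using Cons.IH by auto
    then show ?thesis using has_pd_imp_pd[OF has_pd_const, of i 0 x] by (simp add: pd.simps(2))
  qed
qed simp

lemma pd1_mult:
  assumes "smooth_on \<Omega> f" "smooth_on \<Omega> g" "x \<in> \<Omega>"
  shows "pd [i] (\<lambda>x. f x * g x) x = pd [i] f x * g x + f x * pd [i] g x"
  by (intro has_pd_imp_pd has_pd_mult smooth_on_has_pd1[OF assms(1,3)] smooth_on_has_pd1[OF assms(2,3)])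

lemma pd_sum:
  assumes "open \<Omega>" "\<And>a. a \<in> A \<Longrightarrow> smooth_on \<Omega> (f a)" "x \<in> \<Omega>"
  shows "pd ks (\<lambda>x. \<Sum>a\<in>A. f a x) x = (\<Sum>a\<in>A. pd ks (f a) x)"
  using assms(2)
proof (induction A rule: infinite_finite_induct)
  case (insert a A)
  then show ?case using assms
    by (simp add: pd_add[OF assms(1)] smooth_on_sum)
qed (use pd_const[of ks 0] in auto)

definition proj_on :: "'n::finite set \<Rightarrow> real^'n \<Rightarrow> real^'n" where
  "proj_on S v = (\<chi> i. if i \<in> S then v $ i else 0)"

lemma proj_on_nth [simp]: "proj_on S v $ i = (if i \<in> S then v $ i else 0)"
  by (simp add: proj_on_def)

lemma norm_proj_on: "norm (proj_on S v) \<le> norm v"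
  by (rule norm_le_componentwise_cart) simp

lemma linear_proj_on: "linear (proj_on S)"
  by (rule linearI) (simp_all add: vec_eq_iff)

text \<open>Continuous partial derivatives give differentiability: move one coordinate at a time.\<close>

lemma smooth_on_has_derivative:
  fixes f :: "real^'n::finite \<Rightarrow> real"
  assumes op: "open \<Omega>" and f: "smooth_on \<Omega> f" and x: "x \<in> \<Omega>"
  shows "(f has_derivative (\<lambda>v. \<Sum>i\<in>UNIV. v $ i * pd [i] f x)) (at x)"
proof -
  \<comment> \<open>The increment is built up one coordinate at a time; halving \<open>e\<close> at
    each insertion leaves room for the error made in the new coordinate.\<close>
  have step: "\<exists>d>0. \<forall>v. norm v < d \<longrightarrow>
      \<bar>f (x + proj_on A v) - f x - (\<Sum>i\<in>A. v $ i * pd [i] f x)\<bar> \<le> e * norm v"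
    if "e > 0" for e :: real and A :: "'n set"
  proof -
    have "finite A" by simp
    then show ?thesis using \<open>e > 0\<close>
    proof (induction A arbitrary: e rule: finite_induct)
      case empty
      have "proj_on {} v = 0" for v :: "real^'n" by (simp add: vec_eq_iff)
      then show ?case using empty by (auto intro!: exI[of _ 1])
    next
      case (insert i A)
      obtain d1 where d1: "d1 > 0" "\<And>v. norm v < d1 \<Longrightarrow>
        \<bar>f (x + proj_on A v) - f x - (\<Sum>i\<in>A. v $ i * pd [i] f x)\<bar> \<le> e/2 * norm v"
        using insert.IH[of "e/2"] \<open>e > 0\<close> by auto
      obtain d0 where d0: "d0 > 0" "ball x d0 \<subseteq> \<Omega>" using op x open_contains_ball by blast
      have "continuous (at x) (pd [i] f)"
        using smooth_on_continuous[OF f] op x continuous_on_eq_continuous_at by blast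
      then obtain d2 where d2: "d2 > 0" "\<And>y. dist y x < d2 \<Longrightarrow> \<bar>pd [i] f y - pd [i] f x\<bar> < e/2"
        unfolding continuous_at_eps_delta using \<open>e > 0\<close>
        by (auto simp: dist_real_def elim!: allE[of _ "e/2"])
      \<comment> \<open>Points met on the way lie within \<open>2 * norm v\<close> of
        \<open>x\<close>, hence the halves of \<open>d0\<close> and \<open>d2\<close>;
        \<open>d1\<close> is applied to \<open>v\<close> itself.\<close>
      define d where "d = Min {d0 / 2, d1, d2 / 2}"
      have d: "d > 0" "d \<le> d0/2" "d \<le> d1" "d \<le> d2/2" using d0 d1 d2 by (auto simp: d_def)
      show ?case
      proof (intro exI[of _ d] conjI d allI impI)
        fix v :: "real^'n" assume v: "norm v < d"
        define y where "y = x + proj_on A v"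
        have pr: "proj_on (insert i A) v = proj_on A v + (v $ i) *\<^sub>R axis i 1"
          using insert.hyps by (auto simp: vec_eq_iff axis_def)
        have near: "dist (y + t *\<^sub>R axis i 1) x < min d0 d2" if "\<bar>t\<bar> \<le> \<bar>v $ i\<bar>" for t
        proof -
          have "dist (y + t *\<^sub>R axis i 1) x \<le> norm (proj_on A v) + norm (t *\<^sub>R axis i (1::real) :: real^'n)"
            unfolding y_def dist_norm by (metis add.assoc add_diff_cancel_left' norm_triangle_ineq)
          also have "\<dots> \<le> norm v + \<bar>t\<bar>" using norm_proj_on[of A v] by simp
          also have "\<dots> \<le> norm v + norm v" using that component_le_norm_cart[of v i] by linarith
          finally show ?thesis using v d by linarith
        qed
        \<comment> \<open>With the linear term subtracted, the derivative of \<open>h\<close> is the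
          oscillation of the partial derivative, which is at most \<open>e/2\<close>.\<close>
        define h where "h t = f (y + t *\<^sub>R axis i 1) - t * pd [i] f x" for t
        let ?I = "{-\<bar>v $ i\<bar>..\<bar>v $ i\<bar>}"
        have "norm (h (v $ i) - h 0) \<le> e/2 * norm (v $ i - 0)"
        proof (rule field_differentiable_bound[where S = ?I and f' = "\<lambda>t. pd [i] f (y + t *\<^sub>R axis i 1) - pd [i] f x"])
          fix t assume t: "t \<in> ?I"
          have t': "\<bar>t\<bar> \<le> \<bar>v $ i\<bar>" using t by auto
          let ?y = "y + t *\<^sub>R axis i 1"
          have "?y \<in> \<Omega>" using near[OF t'] d0 by (auto simp: dist_commute subset_iff)
          then have "((\<lambda>s. f (?y + s *\<^sub>R axis i 1)) has_real_derivative pd [i] f ?y) (at 0)"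
            using smooth_on_has_pd1[OF f] unfolding has_pd_def by blast
          then have "((\<lambda>s. f (y + s *\<^sub>R axis i 1)) has_real_derivative pd [i] f ?y) (at t)"
            using DERIV_shift[of "\<lambda>s. f (y + s *\<^sub>R axis i 1)" "pd [i] f ?y" 0 t] by (simp add: algebra_simps)
          then have "(h has_real_derivative (pd [i] f ?y - pd [i] f x)) (at t)"
            unfolding h_def by (auto intro!: derivative_eq_intros)
          then show "(h has_field_derivative (pd [i] f ?y - pd [i] f x)) (at t within ?I)"
            by (rule has_field_derivative_at_within)
          show "norm (pd [i] f ?y - pd [i] f x) \<le> e/2"
            using d2(2)[of ?y] near[OF t'] by simp
        qed auto
        then have a: "\<bar>f (y + (v $ i) *\<^sub>R axis i 1) - f y - v $ i * pd [i] f x\<bar> \<le> e/2 * \<bar>v $ i\<bar>"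
          by (simp add: h_def algebra_simps)
        also have "\<dots> \<le> e/2 * norm v"
          using component_le_norm_cart[of v i] \<open>e > 0\<close> by (intro mult_left_mono) auto
        finally have a: "\<bar>f (y + (v $ i) *\<^sub>R axis i 1) - f y - v $ i * pd [i] f x\<bar> \<le> e/2 * norm v" .
        have b: "\<bar>f y - f x - (\<Sum>i\<in>A. v $ i * pd [i] f x)\<bar> \<le> e/2 * norm v"
          unfolding y_def using v d by (intro d1) auto
        have "f (x + proj_on (insert i A) v) = f (y + (v $ i) *\<^sub>R axis i 1)"
          by (simp add: pr y_def add.assoc)
        moreover have "(\<Sum>i\<in>insert i A. v $ i * pd [i] f x) = v $ i * pd [i] f x + (\<Sum>i\<in>A. v $ i * pd [i] f x)"
          using insert.hyps by simp
        moreover have "e * norm v = e/2 * norm v + e/2 * norm v" by simp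
        ultimately show "\<bar>f (x + proj_on (insert i A) v) - f x - (\<Sum>i\<in>insert i A. v $ i * pd [i] f x)\<bar> \<le> e * norm v"
          using a b by linarith
      qed
    qed
  qed
  have pu: "proj_on UNIV v = v" for v :: "real^'n" by (simp add: vec_eq_iff)
  show ?thesis
    unfolding has_derivative_at_alt
  proof (intro conjI allI impI)
    show "bounded_linear (\<lambda>v. \<Sum>i\<in>UNIV. v $ i * pd [i] f x)"
      by (intro linear_conv_bounded_linear[THEN iffD1] linearI)
        (simp_all add: algebra_simps sum.distrib sum_distrib_left)
    fix e :: real assume "0 < e"
    from step[OF this, of UNIV] obtain d where d: "d > 0"
      "\<And>v. norm v < d \<Longrightarrow> \<bar>f (x + v) - f x - (\<Sum>i\<in>UNIV. v $ i * pd [i] f x)\<bar> \<le> e * norm v"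
      by (auto simp: pu)
    show "\<exists>d>0. \<forall>y. norm (y - x) < d \<longrightarrow>
       norm (f y - f x - (\<Sum>i\<in>UNIV. (y - x) $ i * pd [i] f x)) \<le> e * norm (y - x)"
      using d(1) d(2)[of "y - x" for y] by (auto intro!: exI[of _ d])
  qed
qed

section \<open>Products, reciprocals and iterated Lie derivatives in the class\<close>

text \<open>The Leibniz rule for majorants that depend only on the order of differentiation.\<close>

definition binconv :: "(nat \<Rightarrow> real) \<Rightarrow> (nat \<Rightarrow> real) \<Rightarrow> nat \<Rightarrow> real" where
  "binconv r s n = (\<Sum>j\<le>n. real (n choose j) * r j * s (n - j))"

lemma binconv_0 [simp]: "binconv r s 0 = r 0 * s 0"
  by (simp add: binconv_def)

text \<open>Pascal's rule; the index shift plays the role of a derivation, so the recursion mirrors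
  the first derivative of a product.\<close>

lemma binconv_Suc:
  "binconv r s (Suc n) = binconv (\<lambda>k. r (Suc k)) s n + binconv r (\<lambda>k. s (Suc k)) n"
proof -
  have "binconv r s (Suc n) = r 0 * s (Suc n) +
      (\<Sum>j\<le>n. (real (n choose j) + real (n choose Suc j)) * r (Suc j) * s (n - j))"
    unfolding binconv_def by (subst sum.atMost_Suc_shift) simp
  also have "\<dots> = r 0 * s (Suc n) + binconv (\<lambda>k. r (Suc k)) s n
      + (\<Sum>j\<le>n. real (n choose Suc j) * r (Suc j) * s (n - j))"
    unfolding binconv_def by (simp add: algebra_simps sum.distrib)
  finally have 1: "binconv r s (Suc n) = r 0 * s (Suc n) + binconv (\<lambda>k. r (Suc k)) s n
      + (\<Sum>j\<le>n. real (n choose Suc j) * r (Suc j) * s (n - j))" .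
  have "(\<Sum>j\<le>n. real (n choose Suc j) * r (Suc j) * s (n - j)) + r 0 * s (Suc n)
     = (\<Sum>j\<le>Suc n. real (n choose j) * r j * s (Suc n - j))"
    by (subst sum.atMost_Suc_shift) simp
  also have "\<dots> = binconv r (\<lambda>k. s (Suc k)) n"
    unfolding binconv_def by (simp add: Suc_diff_le)
  finally show ?thesis using 1 by linarith
qed

text \<open>The cutoff \<open>N\<close> allows inductions on the order, as for reciprocals, where
  the bound at each order is obtained from those below it.\<close>

definition pd_bound :: "nat \<Rightarrow> real^'n::finite \<Rightarrow> (real^'n \<Rightarrow> real) \<Rightarrow> (nat \<Rightarrow> real) \<Rightarrow> bool" where
  "pd_bound N x f r \<longleftrightarrow> (\<forall>ks. length ks \<le> N \<longrightarrow> \<bar>pd ks f x\<bar> \<le> r (length ks))"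

lemma pd_bound_pd1: "pd_bound (Suc N) x f r \<Longrightarrow> pd_bound N x (pd [i] f) (\<lambda>k. r (Suc k))"
  unfolding pd_bound_def
  by (metis Suc_le_mono append.right_neutral length_append_singleton pd_append)

lemma pd_bound_mono: "pd_bound N x f r \<Longrightarrow> N' \<le> N \<Longrightarrow> (\<And>k. k \<le> N' \<Longrightarrow> r k \<le> r' k) \<Longrightarrow> pd_bound N' x f r'"
  unfolding pd_bound_def by (meson order_trans)

lemma pd_bound_cong:
  assumes "open \<Omega>" "x \<in> \<Omega>" "\<And>y. y \<in> \<Omega> \<Longrightarrow> f y = g y"
  shows "pd_bound N x f r \<longleftrightarrow> pd_bound N x g r"
  unfolding pd_bound_def using pd_cong[OF assms(1,3,2)] by simp

lemma pd_bound_add: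
  assumes "open \<Omega>" "smooth_on \<Omega> f" "smooth_on \<Omega> g" "x \<in> \<Omega>" "pd_bound N x f r" "pd_bound N x g s"
  shows "pd_bound N x (\<lambda>x. f x + g x) (\<lambda>k. r k + s k)"
  using assms(5,6) unfolding pd_bound_def
  by (auto simp: pd_add[OF assms(1-4)] intro!: order_trans[OF abs_triangle_ineq] add_mono)

lemma pd_bound_sum:
  assumes "open \<Omega>" "\<And>a. a \<in> A \<Longrightarrow> smooth_on \<Omega> (f a)" "x \<in> \<Omega>"
    "\<And>a. a \<in> A \<Longrightarrow> pd_bound N x (f a) (r a)"
  shows "pd_bound N x (\<lambda>x. \<Sum>a\<in>A. f a x) (\<lambda>k. \<Sum>a\<in>A. r a k)"
  using assms(4) unfolding pd_bound_def
  by (auto simp: pd_sum[OF assms(1-3)] intro!: order_trans[OF sum_abs] sum_mono)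

text \<open>Peeling off the innermost derivative leaves shorter lists applied to two products, to
  which the induction hypothesis applies with shifted majorants.\<close>

lemma pd_bound_mult:
  assumes "open \<Omega>" "smooth_on \<Omega> f" "smooth_on \<Omega> g" "x \<in> \<Omega>" "pd_bound N x f r" "pd_bound N x g s"
  shows "pd_bound N x (\<lambda>x. f x * g x) (binconv r s)"
  using assms(2,3,5,6)
proof (induction N arbitrary: f g r s)
  case 0
  then show ?case unfolding pd_bound_def
    by (auto simp: abs_mult intro!: mult_mono order_trans[OF abs_ge_zero])
next
  case (Suc N)
  have sm: "smooth_on \<Omega> (pd [i] f)" "smooth_on \<Omega> (pd [i] g)" for i
    using Suc.prems smooth_on_pd by auto
  have le: "pd_bound N x f r" "pd_bound N x g s"
    using Suc.prems pd_bound_mono by (metis le_SucI order_refl)+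
  show ?case
    unfolding pd_bound_def
  proof (intro allI impI)
    fix ks :: "'a list" assume len: "length ks \<le> Suc N"
    show "\<bar>pd ks (\<lambda>x. f x * g x) x\<bar> \<le> binconv r s (length ks)"
    proof (cases ks rule: rev_cases)
      case Nil
      then show ?thesis using Suc.prems(3,4) unfolding pd_bound_def
        by (auto simp: abs_mult elim!: allE[of _ "[]"] intro!: mult_mono order_trans[OF abs_ge_zero])
    next
      case (snoc ls i)
      have "pd ks (\<lambda>x. f x * g x) x = pd ls (\<lambda>x. pd [i] f x * g x + f x * pd [i] g x) x"
        unfolding snoc pd_append
        by (rule pd_cong[OF assms(1) _ assms(4)]) (rule pd1_mult[OF Suc.prems(1,2)])
      moreover have "pd_bound N x (\<lambda>x. pd [i] f x * g x + f x * pd [i] g x)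
         (\<lambda>k. binconv (\<lambda>k. r (Suc k)) s k + binconv r (\<lambda>k. s (Suc k)) k)"
        by (intro pd_bound_add[OF assms(1) _ _ assms(4)] smooth_on_mult[OF assms(1)] Suc.IH sm Suc.prems(1,2)
          pd_bound_pd1 le Suc.prems(3,4))
      ultimately show ?thesis using len snoc unfolding pd_bound_def
        by (simp add: binconv_Suc)
    qed
  qed
qed

text \<open>The identity \<open>(1/f)' = - f' * (1/f)^2\<close> turns the bounds into a recursion:
  any \<open>r\<close> that dominates the resulting convolution at each order is a majorant of the
  reciprocal.\<close>

lemma pd_bound_inverse:
  assumes "open \<Omega>" "smooth_on \<Omega> f" "x \<in> \<Omega>" "\<And>y. y \<in> \<Omega> \<Longrightarrow> f y \<noteq> 0" "pd_bound N x f s"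
    and r0: "\<bar>inverse (f x)\<bar> \<le> r 0"
    and r: "\<And>k. k < N \<Longrightarrow> binconv (\<lambda>k. s (Suc k)) (binconv r r) k \<le> r (Suc k)"
  shows "pd_bound N x (\<lambda>x. inverse (f x)) r"
  using assms(5) r
proof (induction N)
  case 0
  then show ?case using r0 by (auto simp: pd_bound_def)
next
  case (Suc N)
  let ?v = "\<lambda>x. inverse (f x)"
  have v: "smooth_on \<Omega> ?v" by (intro smooth_on_inverse assms)
  have IH: "pd_bound N x ?v r"
    using Suc by (meson less_SucI pd_bound_mono le_SucI order_refl)
  have b: "pd_bound N x (\<lambda>x. pd [i] f x * (?v x * ?v x)) (binconv (\<lambda>k. s (Suc k)) (binconv r r))" for i
    by (intro pd_bound_mult[OF assms(1) _ _ assms(3)] smooth_on_mult[OF assms(1)] v smooth_on_pd assms(2) IH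
       pd_bound_pd1 Suc.prems(1))
  show ?case
    unfolding pd_bound_def
  proof (intro allI impI)
    fix ks :: "'a list" assume len: "length ks \<le> Suc N"
    show "\<bar>pd ks ?v x\<bar> \<le> r (length ks)"
    proof (cases ks rule: rev_cases)
      case Nil
      then show ?thesis using r0 by simp
    next
      case (snoc ls i)
      let ?w = "\<lambda>x. pd [i] f x * (?v x * ?v x)"
      have w: "smooth_on \<Omega> ?w"
        by (intro smooth_on_mult[OF assms(1)] v smooth_on_pd assms(2))
      have "pd ks ?v x = pd ls (\<lambda>x. - ?w x) x"
        unfolding snoc pd_append
        by (rule pd_cong[OF assms(1) _ assms(3)])
          (intro has_pd_imp_pd has_pd_inverse smooth_on_has_pd1[OF assms(2)] assms(4))
      also have "\<dots> = - pd ls ?w x"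
      proof -
        have nw: "smooth_on \<Omega> (\<lambda>x. - ?w x)"
          using smooth_on_mult[OF assms(1) smooth_on_const[OF assms(1), of "-1"] w] by simp
        show ?thesis
          using pd_add[OF assms(1) w nw assms(3), of ls] pd_const[of ls 0 x] by simp
      qed
      finally have "\<bar>pd ks ?v x\<bar> \<le> binconv (\<lambda>k. s (Suc k)) (binconv r r) (length ls)"
        using b len snoc unfolding pd_bound_def by simp
      also have "\<dots> \<le> r (Suc (length ls))" using len snoc by (intro Suc.prems(2)) simp
      finally show ?thesis using snoc by simp
    qed
  qed
qed

text \<open>A factor \<open>h\<^sup>k\<close> is absorbed into \<open>\<mu>\<close> below, so that the only property of the weight that matters is
  \<open>\<mu> j * \<mu> k \<le> \<mu> (j + k)\<close>.\<close>

definition supermult :: "(nat \<Rightarrow> real) \<Rightarrow> bool" where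
  "supermult \<mu> \<longleftrightarrow> (\<forall>j. 0 < \<mu> j) \<and> (\<forall>j k. \<mu> j * \<mu> k \<le> \<mu> (j + k))"

lemma supermult_pos: "supermult \<mu> \<Longrightarrow> 0 < \<mu> j"
  and supermult_le: "supermult \<mu> \<Longrightarrow> \<mu> j * \<mu> k \<le> \<mu> (j + k)"
  unfolding supermult_def by auto

lemma supermult_geometric:
  assumes "supermult \<mu>" "h > 0" shows "supermult (\<lambda>k. h ^ k * \<mu> k)"
proof -
  have "(h ^ j * \<mu> j) * (h ^ k * \<mu> k) \<le> h ^ (j + k) * \<mu> (j + k)" for j k
  proof -
    have "(h ^ j * \<mu> j) * (h ^ k * \<mu> k) = h ^ (j + k) * (\<mu> j * \<mu> k)"
      by (simp add: power_add)
    also have "\<dots> \<le> h ^ (j + k) * \<mu> (j + k)"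
      using assms by (intro mult_left_mono supermult_le) auto
    finally show ?thesis .
  qed
  then show ?thesis using assms unfolding supermult_def by simp
qed

lemma choose_fact_le: "j \<le> n \<Longrightarrow> real (n choose j) * fact j * fact (n - j) = fact n"
  using binomial_fact_lemma[of j n] by (metis (mono_tags) mult.assoc mult.commute of_nat_fact of_nat_mult)

text \<open>The binomial coefficient cancels the factorials, so all \<open>n + 1\<close> terms obey
  the same bound; their number turns \<open>fact n\<close> into \<open>fact (Suc n)\<close>.\<close>

lemma binconv_factorial:
  assumes \<mu>: "supermult \<mu>" and "C \<ge> 0" "D \<ge> 0"
  shows "binconv (\<lambda>k. C * fact k * \<mu> k) (\<lambda>k. D * fact k * \<mu> k) n \<le> C * D * fact (Suc n) * \<mu> n"
proof -
  have "binconv (\<lambda>k. C * fact k * \<mu> k) (\<lambda>k. D * fact k * \<mu> k) n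
     = (\<Sum>j\<le>n. C * D * fact n * (\<mu> j * \<mu> (n - j)))"
    unfolding binconv_def
    by (intro sum.cong refl) (simp add: choose_fact_le[symmetric] algebra_simps)
  also have "\<dots> \<le> (\<Sum>j\<le>n. C * D * fact n * \<mu> n)"
  proof (intro sum_mono mult_left_mono)
    fix j assume "j \<in> {..n}"
    then show "\<mu> j * \<mu> (n - j) \<le> \<mu> n" using supermult_le[OF \<mu>, of j "n - j"] by simp
  qed (use assms in simp)
  also have "\<dots> = C * D * fact (Suc n) * \<mu> n" by (simp add: algebra_simps)
  finally show ?thesis .
qed

lemma Suc_le_power2: "real (Suc n) \<le> 2 ^ n"
proof -
  have "Suc n \<le> 2 ^ n" by (induction n) auto
  then show ?thesis by (metis of_nat_le_iff of_nat_numeral of_nat_power)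
qed

text \<open>The ansatz \<open>C * fact k * H ^ k * \<mu> k\<close> reproduces itself in the
  recursion for reciprocals. The condition \<open>4 \<le> H\<close> absorbs the factor
  \<open>j + 1\<close> and leaves a geometric series of ratio 1/2 with sum at most 2;
  \<open>2 * A * C \<le> H\<close> absorbs the remaining constants.\<close>

lemma binconv_inverse_bound:
  assumes \<mu>: "supermult \<mu>" and "A > 0" "C > 0" and H: "H \<ge> 4" "H \<ge> 2 * A * C"
  shows "binconv (\<lambda>k. A * fact (Suc k) * \<mu> (Suc k))
     (binconv (\<lambda>k. C * fact k * (H ^ k * \<mu> k)) (\<lambda>k. C * fact k * (H ^ k * \<mu> k))) n
     \<le> C * fact (Suc n) * (H ^ Suc n * \<mu> (Suc n))"
proof -
  let ?K = "A * C\<^sup>2 * fact (Suc n) * \<mu> (Suc n)"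
  have pos: "0 < \<mu> k" for k using \<mu> by (rule supermult_pos)
  have K: "?K > 0" using assms pos by simp
  have "binconv (\<lambda>k. A * fact (Suc k) * \<mu> (Suc k))
     (binconv (\<lambda>k. C * fact k * (H ^ k * \<mu> k)) (\<lambda>k. C * fact k * (H ^ k * \<mu> k))) n
    \<le> (\<Sum>j\<le>n. real (n choose j) * (A * fact (Suc j) * \<mu> (Suc j)) *
        (C * C * fact (Suc (n - j)) * (H ^ (n - j) * \<mu> (n - j))))"
    unfolding binconv_def[of "\<lambda>k. A * fact (Suc k) * \<mu> (Suc k)"] using assms pos
    by (intro sum_mono mult_left_mono binconv_factorial supermult_geometric)
      (auto intro!: mult_nonneg_nonneg less_imp_le[OF pos])
  also have "\<dots> \<le> (\<Sum>j\<le>n. ?K * (H ^ n * (1/2) ^ j))"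
  proof (rule sum_mono)
    fix j assume "j \<in> {..n}"
    then have j: "j \<le> n" by simp
    have "real (n choose j) * (A * fact (Suc j) * \<mu> (Suc j)) *
        (C * C * fact (Suc (n - j)) * (H ^ (n - j) * \<mu> (n - j)))
       = A * C\<^sup>2 * (real (n choose j) * fact j * fact (n - j)) * (real (Suc j) * real (Suc (n - j)))
          * H ^ (n - j) * (\<mu> (Suc j) * \<mu> (n - j))"
      by (simp add: power2_eq_square algebra_simps)
    also have "\<dots> = A * C\<^sup>2 * fact n * (real (Suc j) * real (Suc (n - j)))
          * H ^ (n - j) * (\<mu> (Suc j) * \<mu> (n - j))"
      by (simp only: choose_fact_le[OF j])
    also have "\<dots> \<le> A * C\<^sup>2 * fact n * (real (Suc j) * real (Suc n)) * H ^ (n - j) * \<mu> (Suc n)"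
      using assms pos supermult_le[OF \<mu>, of "Suc j" "n - j"] j
      by (intro mult_mono mult_nonneg_nonneg) (auto simp: less_imp_le)
    also have "\<dots> = ?K * (real (Suc j) * H ^ (n - j))" by (simp add: algebra_simps)
    also have "\<dots> \<le> ?K * (H ^ n * (1/2) ^ j)"
    proof (rule mult_left_mono)
      have "real (Suc j) * 2 ^ j \<le> 2 ^ j * 2 ^ j"
        by (intro mult_right_mono Suc_le_power2) simp
      also have "\<dots> = 4 ^ j" by (simp add: power_mult_distrib[symmetric])
      also have "\<dots> \<le> H ^ j" using H by (intro power_mono) auto
      finally have "real (Suc j) * 2 ^ j * H ^ (n - j) \<le> H ^ j * H ^ (n - j)"
        using H by (intro mult_right_mono) auto
      also have "\<dots> = H ^ n" using j by (simp add: power_add[symmetric])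
      finally show "real (Suc j) * H ^ (n - j) \<le> H ^ n * (1/2) ^ j"
        by (simp add: field_simps power_one_over)
    qed (use K in simp)
    finally show "real (n choose j) * (A * fact (Suc j) * \<mu> (Suc j)) *
        (C * C * fact (Suc (n - j)) * (H ^ (n - j) * \<mu> (n - j))) \<le> ?K * (H ^ n * (1/2) ^ j)" .
  qed
  also have "\<dots> = ?K * H ^ n * (\<Sum>j\<le>n. (1/2) ^ j)"
    by (simp only: sum_distrib_left mult.assoc)
  also have "\<dots> \<le> ?K * H ^ n * 2"
  proof (rule mult_left_mono)
    have "(\<Sum>j\<le>n. (1/2::real) ^ j) = 2 - (1/2) ^ n" by (induction n) auto
    then show "(\<Sum>j\<le>n. (1/2::real) ^ j) \<le> 2" by simp
  qed (use K H in simp)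
  also have "\<dots> = (2 * A * C) * (C * fact (Suc n) * \<mu> (Suc n) * H ^ n)"
    by (simp add: power2_eq_square algebra_simps)
  also have "\<dots> \<le> H * (C * fact (Suc n) * \<mu> (Suc n) * H ^ n)"
    using assms pos[of "Suc n"] H by (intro mult_right_mono) auto
  finally show ?thesis by (simp add: algebra_simps)
qed

section \<open>Bounds for iterated Lie derivatives\<close>

definition lie :: "(real^'n::finite \<Rightarrow> real^'n) \<Rightarrow> (real^'n \<Rightarrow> real) \<Rightarrow> real^'n \<Rightarrow> real" where
  "lie X u x = (\<Sum>j\<in>UNIV. X x $ j * pd [j] u x)"

text \<open>The head of the word acts last, matching the order of \<open>pd\<close>, so that partial
  derivatives along a list become Lie derivatives along the same list.\<close>

fun lies :: "('i \<Rightarrow> real^'n::finite \<Rightarrow> real^'n) \<Rightarrow> 'i list \<Rightarrow> (real^'n \<Rightarrow> real) \<Rightarrow> real^'n \<Rightarrow> real" where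
  "lies X [] u = u"
| "lies X (i # w) u = lie (X i) (lies X w u)"

lemma smooth_on_lie:
  assumes "open \<Omega>" "\<And>j. smooth_on \<Omega> (\<lambda>x. X x $ j)" "smooth_on \<Omega> u"
  shows "smooth_on \<Omega> (lie X u)"
  unfolding lie_def[abs_def] by (intro smooth_on_sum smooth_on_mult smooth_on_pd assms)

lemma smooth_on_lies:
  assumes "open \<Omega>" "\<And>i j. smooth_on \<Omega> (\<lambda>x. X i x $ j)" "smooth_on \<Omega> u"
  shows "smooth_on \<Omega> (lies X w u)"
  by (induction w) (auto intro!: smooth_on_lie assms)

text \<open>The weight \<open>2 ^ b\<close> makes the Leibniz sum geometric at the cost of a
  constant factor 4; counting its terms would cost \<open>b + 1\<close>, which iteration would turn
  into a factorial. Replacing \<open>b choose j\<close> by \<open>(b + Suc k) choose j\<close> lets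
  the factorials collapse to the total order.\<close>

lemma binconv_lie_bound:
  assumes \<mu>: "supermult \<mu>" and "A \<ge> 0" "R \<ge> 0"
  shows "binconv (\<lambda>b. A * fact b * \<mu> b) (\<lambda>b. R * 2 ^ Suc b * fact (Suc b + k) * \<mu> (Suc b + k)) b
    \<le> 4 * A * R * 2 ^ b * fact (b + Suc k) * \<mu> (b + Suc k)"
proof -
  have pos: "0 \<le> \<mu> k" for k using supermult_pos[OF \<mu>, of k] by simp
  let ?K = "A * R * fact (b + Suc k) * \<mu> (b + Suc k)"
  have "binconv (\<lambda>b. A * fact b * \<mu> b) (\<lambda>b. R * 2 ^ Suc b * fact (Suc b + k) * \<mu> (Suc b + k)) b
      \<le> (\<Sum>j\<le>b. ?K * 2 ^ Suc (b - j))"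
    unfolding binconv_def
  proof (rule sum_mono)
    fix j assume "j \<in> {..b}"
    then have j: "j \<le> b" by simp
    have eq: "Suc (b - j) + k = b + Suc k - j" using j by simp
    have "real (b choose j) * (A * fact j * \<mu> j) * (R * 2 ^ Suc (b - j) * fact (Suc (b - j) + k) * \<mu> (Suc (b - j) + k))
      = A * R * (real (b choose j) * fact j * fact (b + Suc k - j)) * (\<mu> j * \<mu> (b + Suc k - j)) * 2 ^ Suc (b - j)"
      unfolding eq by (simp only: ac_simps)
    also have "\<dots> \<le> A * R * (real ((b + Suc k) choose j) * fact j * fact (b + Suc k - j)) * \<mu> (b + Suc k) * 2 ^ Suc (b - j)"
      using assms pos supermult_le[OF \<mu>, of j "b + Suc k - j"] j
      by (intro mult_mono mult_nonneg_nonneg) (auto intro!: binomial_right_mono)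
    also have "\<dots> = ?K * 2 ^ Suc (b - j)"
      using j by (subst choose_fact_le) auto
    finally show "real (b choose j) * (A * fact j * \<mu> j) * (R * 2 ^ Suc (b - j) * fact (Suc (b - j) + k) * \<mu> (Suc (b - j) + k))
      \<le> ?K * 2 ^ Suc (b - j)" .
  qed
  also have "\<dots> = ?K * (\<Sum>j\<le>b. 2 ^ Suc (b - j))" by (simp add: sum_distrib_left)
  also have "\<dots> \<le> ?K * (4 * 2 ^ b)"
  proof (rule mult_left_mono)
    have "(\<Sum>j\<le>b. 2 ^ Suc (b - j)) = (\<Sum>j\<le>b. (2::real) ^ Suc j)"
      by (rule sum.reindex_bij_witness[where i = "\<lambda>j. b - j" and j = "\<lambda>j. b - j"]) auto
    also have "\<dots> = 4 * 2 ^ b - 2" by (induction b) auto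
    finally show "(\<Sum>j\<le>b. 2 ^ Suc (b - j)) \<le> (4 * 2 ^ b :: real)" by simp
  qed (use assms pos in simp)
  finally show ?thesis by (simp add: algebra_simps)
qed

text \<open>Estimates for all further orders \<open>b\<close> are carried along, since each Lie
  derivative consumes one derivative of the preceding one; the factorial and \<open>\<mu>\<close>
  see only the total order.\<close>

lemma pd_bound_lies:
  fixes X :: "'i \<Rightarrow> real^'n::finite \<Rightarrow> real^'n"
  assumes \<mu>: "supermult \<mu>" and "A \<ge> 0" "C \<ge> 0" and op: "open \<Omega>" and x: "x \<in> \<Omega>"
    and X: "\<And>i j. smooth_on \<Omega> (\<lambda>x. X i x $ j)" and f: "smooth_on \<Omega> f"
    and bX: "\<And>N i j. pd_bound N x (\<lambda>x. X i x $ j) (\<lambda>b. A * fact b * \<mu> b)"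
    and bf: "\<And>N. pd_bound N x f (\<lambda>b. C * fact b * \<mu> b)"
  shows "pd_bound N x (lies X w f)
    (\<lambda>b. C * (4 * real CARD('n) * A) ^ length w * 2 ^ b * fact (b + length w) * \<mu> (b + length w))"
proof (induction w arbitrary: N)
  case Nil
  have le: "C * fact b * \<mu> b \<le> C * 2 ^ b * fact b * \<mu> b" for b
  proof -
    have "(C * fact b * \<mu> b) * 1 \<le> (C * fact b * \<mu> b) * 2 ^ b"
      using assms supermult_pos[OF \<mu>, of b] by (intro mult_left_mono) auto
    then show ?thesis by (simp add: algebra_simps)
  qed
  show ?case using pd_bound_mono[OF bf[of N] order_refl le] by simp
next
  case (Cons i w)
  let ?k = "length w"
  let ?R = "C * (4 * real CARD('n) * A) ^ ?k"
  let ?r = "\<lambda>b. ?R * 2 ^ b * fact (b + ?k) * \<mu> (b + ?k)"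
  have R: "?R \<ge> 0" using assms by simp
  have sm: "smooth_on \<Omega> (lies X w f)" by (intro smooth_on_lies op X f)
  have "pd_bound N x (lie (X i) (lies X w f)) (\<lambda>b. \<Sum>j\<in>(UNIV::'n set).
     binconv (\<lambda>b. A * fact b * \<mu> b) (\<lambda>b. ?R * 2 ^ Suc b * fact (Suc b + ?k) * \<mu> (Suc b + ?k)) b)"
    unfolding lie_def[abs_def]
    by (intro pd_bound_sum[OF op _ x] smooth_on_mult[OF op] pd_bound_mult[OF op _ _ x] X smooth_on_pd sm bX
      pd_bound_pd1[OF Cons.IH])
  then have "pd_bound N x (lie (X i) (lies X w f))
     (\<lambda>b. real CARD('n) * (4 * A * ?R * 2 ^ b * fact (b + Suc ?k) * \<mu> (b + Suc ?k)))"
  proof (rule pd_bound_mono)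
    fix b
    show "(\<Sum>j\<in>(UNIV::'n set). binconv (\<lambda>b. A * fact b * \<mu> b)
        (\<lambda>b. ?R * 2 ^ Suc b * fact (Suc b + ?k) * \<mu> (Suc b + ?k)) b)
      \<le> real CARD('n) * (4 * A * ?R * 2 ^ b * fact (b + Suc ?k) * \<mu> (b + Suc ?k))"
      unfolding sum_constant by (rule mult_left_mono[OF binconv_lie_bound[OF \<mu> assms(2) R]]) simp
  qed simp
  moreover have "(\<lambda>b. real CARD('n) * (4 * A * ?R * 2 ^ b * fact (b + Suc ?k) * \<mu> (b + Suc ?k)))
    = (\<lambda>b. C * (4 * real CARD('n) * A) ^ Suc ?k * 2 ^ b * fact (b + Suc ?k) * \<mu> (b + Suc ?k))"
    by (simp only: power_Suc ac_simps)
  ultimately show ?case by (simp only: lies.simps list.size(4) add_Suc_right add_0_right)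
qed

text \<open>With \<open>small_m M\<close> for \<open>\<mu>\<close> the product of the factorial and
  \<open>\<mu> k\<close> is \<open>M k\<close>; the factorial is displayed separately to cancel
  binomial coefficients.\<close>

definition class_bound :: "(nat \<Rightarrow> real) \<Rightarrow> (real^'n::finite) set \<Rightarrow> (real^'n \<Rightarrow> real) \<Rightarrow> bool" where
  "class_bound \<mu> K f \<longleftrightarrow> (\<exists>C>0. \<exists>h>0. \<forall>x\<in>K. \<forall>N. pd_bound N x f (\<lambda>k. C * fact k * (h ^ k * \<mu> k)))"

lemma class_boundI:
  assumes "C > 0" "h > 0" "\<And>x N. x \<in> K \<Longrightarrow> pd_bound N x f (\<lambda>k. C * fact k * (h ^ k * \<mu> k))"
  shows "class_bound \<mu> K f"
  unfolding class_bound_def using assms by blast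

lemma pd_bound_class_mono:
  assumes "supermult \<mu>" "pd_bound N x f (\<lambda>k. C * fact k * (h ^ k * \<mu> k))" "C \<le> C'" "h \<le> h'" "0 < C" "0 < h"
  shows "pd_bound N x f (\<lambda>k. C' * fact k * (h' ^ k * \<mu> k))"
  using assms(2)
proof (rule pd_bound_mono)
  fix k
  show "C * fact k * (h ^ k * \<mu> k) \<le> C' * fact k * (h' ^ k * \<mu> k)"
    using assms supermult_pos[OF assms(1), of k]
    by (intro mult_mono power_mono mult_nonneg_nonneg) auto
qed simp

lemma class_bound_finite:
  assumes \<mu>: "supermult \<mu>" and "finite I" "\<And>a. a \<in> I \<Longrightarrow> class_bound \<mu> K (f a)"
  shows "\<exists>C>0. \<exists>h>0. \<forall>a\<in>I. \<forall>x\<in>K. \<forall>N. pd_bound N x (f a) (\<lambda>k. C * fact k * (h ^ k * \<mu> k))"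
  using assms(2,3)
proof (induction I rule: finite_induct)
  case empty
  then show ?case by (auto intro!: exI[of _ 1])
next
  case (insert a I)
  then obtain C h where C: "C > 0" "h > 0"
    "\<And>a x N. a\<in>I \<Longrightarrow> x\<in>K \<Longrightarrow> pd_bound N x (f a) (\<lambda>k. C * fact k * (h ^ k * \<mu> k))"
    by auto
  have "class_bound \<mu> K (f a)" using insert.prems by simp
  then obtain C' h' where C': "C' > 0" "h' > 0"
    "\<And>x N. x\<in>K \<Longrightarrow> pd_bound N x (f a) (\<lambda>k. C' * fact k * (h' ^ k * \<mu> k))"
    unfolding class_bound_def by auto
  show ?case
  proof (rule exI, rule conjI, rule_tac [2] exI, rule_tac [2] conjI, rule_tac [3] ballI, rule_tac [3] ballI, rule_tac [3] allI)
    show "max C C' > 0" "max h h' > 0" using C C' by auto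
    fix b x N assume b: "b \<in> insert a I" and x: "x \<in> K"
    show "pd_bound N x (f b) (\<lambda>k. max C C' * fact k * (max h h' ^ k * \<mu> k))"
    proof (cases "b = a")
      case True
      show ?thesis unfolding True
        by (rule pd_bound_class_mono[OF \<mu> C'(3)[OF x]]) (use C' in auto)
    next
      case False
      then have "b \<in> I" using b by simp
      show ?thesis by (rule pd_bound_class_mono[OF \<mu> C(3)[OF \<open>b \<in> I\<close> x]]) (use C in auto)
    qed
  qed
qed

lemma class_bound_subset: "class_bound \<mu> K f \<Longrightarrow> K' \<subseteq> K \<Longrightarrow> class_bound \<mu> K' f"
  unfolding class_bound_def by (meson subsetD)

lemma class_bound_cong:
  assumes "open \<Omega>" "K \<subseteq> \<Omega>" "\<And>y. y \<in> \<Omega> \<Longrightarrow> f y = g y" "class_bound \<mu> K f"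
  shows "class_bound \<mu> K g"
proof -
  have "pd_bound N x f r = pd_bound N x g r" if "x \<in> K" for N x r
    using that assms(2) by (intro pd_bound_cong[OF assms(1) _ assms(3)]) auto
  then show ?thesis using assms(4) unfolding class_bound_def by simp
qed

lemma class_bound_pair:
  assumes \<mu>: "supermult \<mu>" and "class_bound \<mu> K f" "class_bound \<mu> K g"
  obtains C h where "C > 0" "h > 0"
    "\<And>x N. x \<in> K \<Longrightarrow> pd_bound N x f (\<lambda>k. C * fact k * (h ^ k * \<mu> k))"
    "\<And>x N. x \<in> K \<Longrightarrow> pd_bound N x g (\<lambda>k. C * fact k * (h ^ k * \<mu> k))"
proof -
  have "\<exists>C>0. \<exists>h>0. \<forall>a\<in>{f, g}. \<forall>x\<in>K. \<forall>N. pd_bound N x a (\<lambda>k. C * fact k * (h ^ k * \<mu> k))"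
    using assms by (intro class_bound_finite) auto
  then obtain C h where "C > 0" "h > 0"
    "\<And>a x N. a \<in> {f, g} \<Longrightarrow> x \<in> K \<Longrightarrow> pd_bound N x a (\<lambda>k. C * fact k * (h ^ k * \<mu> k))"
    by blast
  then show ?thesis using that by blast
qed

lemma class_bound_add:
  assumes \<mu>: "supermult \<mu>" and \<Omega>: "open \<Omega>" "K \<subseteq> \<Omega>"
    and f: "smooth_on \<Omega> f" "class_bound \<mu> K f" and g: "smooth_on \<Omega> g" "class_bound \<mu> K g"
  shows "class_bound \<mu> K (\<lambda>x. f x + g x)"
proof -
  obtain C h where *: "C > 0" "h > 0"
    "\<And>x N. x \<in> K \<Longrightarrow> pd_bound N x f (\<lambda>k. C * fact k * (h ^ k * \<mu> k))"
    "\<And>x N. x \<in> K \<Longrightarrow> pd_bound N x g (\<lambda>k. C * fact k * (h ^ k * \<mu> k))"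
    using class_bound_pair[OF \<mu> f(2) g(2)] by blast
  have "pd_bound N x (\<lambda>x. f x + g x) (\<lambda>k. (2 * C) * fact k * (h ^ k * \<mu> k))" if "x \<in> K" for x N
    by (rule pd_bound_mono[OF pd_bound_add[OF \<Omega>(1) f(1) g(1) _ *(3,4)] order_refl])
      (use that \<Omega> in auto)
  then show ?thesis using * by (intro class_boundI[of "2 * C" "h"]) auto
qed

lemma class_bound_mult:
  assumes \<mu>: "supermult \<mu>" and \<Omega>: "open \<Omega>" "K \<subseteq> \<Omega>"
    and f: "smooth_on \<Omega> f" "class_bound \<mu> K f" and g: "smooth_on \<Omega> g" "class_bound \<mu> K g"
  shows "class_bound \<mu> K (\<lambda>x. f x * g x)"
proof -
  obtain C h where *: "C > 0" "h > 0"
    "\<And>x N. x \<in> K \<Longrightarrow> pd_bound N x f (\<lambda>k. C * fact k * (h ^ k * \<mu> k))"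
    "\<And>x N. x \<in> K \<Longrightarrow> pd_bound N x g (\<lambda>k. C * fact k * (h ^ k * \<mu> k))"
    using class_bound_pair[OF \<mu> f(2) g(2)] by blast
  have le: "binconv (\<lambda>k. C * fact k * (h ^ k * \<mu> k)) (\<lambda>k. C * fact k * (h ^ k * \<mu> k)) n
     \<le> (C * C) * fact n * ((2 * h) ^ n * \<mu> n)" for n
  proof -
    have "binconv (\<lambda>k. C * fact k * (h ^ k * \<mu> k)) (\<lambda>k. C * fact k * (h ^ k * \<mu> k)) n
      \<le> C * C * fact (Suc n) * (h ^ n * \<mu> n)"
      using * by (intro binconv_factorial supermult_geometric \<mu>) auto
    also have "\<dots> = real (Suc n) * (C * C * fact n * (h ^ n * \<mu> n))" by simp
    also have "\<dots> \<le> 2 ^ n * (C * C * fact n * (h ^ n * \<mu> n))"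
      using * supermult_pos[OF \<mu>, of n] by (intro mult_right_mono Suc_le_power2) auto
    finally show ?thesis by (simp add: algebra_simps power_mult_distrib)
  qed
  have "pd_bound N x (\<lambda>x. f x * g x) (\<lambda>k. (C * C) * fact k * ((2 * h) ^ k * \<mu> k))" if "x \<in> K" for x N
    by (rule pd_bound_mono[OF pd_bound_mult[OF \<Omega>(1) f(1) g(1) _ *(3,4)] order_refl le])
      (use that \<Omega> in auto)
  then show ?thesis using * by (intro class_boundI[of "C * C" "2 * h"]) auto
qed

lemma class_bound_const:
  assumes \<mu>: "supermult \<mu>" shows "class_bound \<mu> K (\<lambda>x. c)"
proof -
  have "\<bar>c\<bar> \<le> (\<bar>c\<bar> + 1) / \<mu> 0 * \<mu> 0" using supermult_pos[OF \<mu>, of 0] by simp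
  then show ?thesis
    unfolding class_bound_def pd_bound_def using supermult_pos[OF \<mu>]
    by (intro exI[of _ "(\<bar>c\<bar> + 1) / \<mu> 0"] exI[of _ 1] conjI allI impI ballI)
      (auto simp: pd_const intro!: divide_nonneg_nonneg mult_nonneg_nonneg less_imp_le divide_pos_pos add_nonneg_pos)
qed

lemma class_bound_sum:
  assumes \<mu>: "supermult \<mu>" and \<Omega>: "open \<Omega>" "K \<subseteq> \<Omega>"
    and f: "\<And>a. a \<in> I \<Longrightarrow> smooth_on \<Omega> (f a)" "\<And>a. a \<in> I \<Longrightarrow> class_bound \<mu> K (f a)"
  shows "class_bound \<mu> K (\<lambda>x. \<Sum>a\<in>I. f a x)"
  using f
proof (induction I rule: infinite_finite_induct)
  case (insert a I)
  then show ?case using \<Omega> by (simp add: class_bound_add[OF \<mu> \<Omega>] smooth_on_sum)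
qed (simp_all add: class_bound_const[OF \<mu>])

lemma class_bound_inverse:
  assumes \<mu>: "supermult \<mu>" and \<Omega>: "open \<Omega>" "K \<subseteq> \<Omega>"
    and f: "smooth_on \<Omega> f" "class_bound \<mu> K f" and nz: "\<And>x. x \<in> \<Omega> \<Longrightarrow> f x \<noteq> 0"
    and \<epsilon>: "\<epsilon> > 0" "\<And>x. x \<in> K \<Longrightarrow> \<bar>f x\<bar> \<ge> \<epsilon>"
  shows "class_bound \<mu> K (\<lambda>x. inverse (f x))"
proof -
  obtain A h where A: "A > 0" "h > 0"
    "\<And>x N. x \<in> K \<Longrightarrow> pd_bound N x f (\<lambda>k. A * fact k * (h ^ k * \<mu> k))"
    using f(2) unfolding class_bound_def by blast
  define \<nu> where "\<nu> k = h ^ k * \<mu> k" for k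
  have \<nu>: "supermult \<nu>" unfolding \<nu>_def[abs_def] using \<mu> A by (intro supermult_geometric)
  have \<nu>pos: "\<nu> k > 0" for k using \<nu> by (rule supermult_pos)
  \<comment> \<open>Determined by order zero, where the reciprocal is at most
    \<open>inverse \<epsilon> = C * \<nu> 0\<close>.\<close>
  define C where "C = inverse \<epsilon> / \<nu> 0"
  have C: "C > 0" using \<epsilon> \<nu>pos by (simp add: C_def)
  define H where "H = 4 + 2 * A * C"
  have H: "H \<ge> 4" "H \<ge> 2 * A * C" using A C by (auto simp: H_def)
  have "pd_bound N x (\<lambda>x. inverse (f x)) (\<lambda>k. C * fact k * ((H * h) ^ k * \<mu> k))" if x: "x \<in> K" for x N
  proof -
    have "pd_bound N x (\<lambda>x. inverse (f x)) (\<lambda>k. C * fact k * (H ^ k * \<nu> k))"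
    proof (rule pd_bound_inverse[OF \<Omega>(1) f(1) _ nz])
      show "pd_bound N x f (\<lambda>k. A * fact k * \<nu> k)" using A(3)[OF x] by (simp add: \<nu>_def)
      show "\<bar>inverse (f x)\<bar> \<le> C * fact 0 * (H ^ 0 * \<nu> 0)"
        using \<epsilon>(2)[OF x] \<epsilon>(1) \<nu>pos[of 0] by (simp add: C_def field_simps abs_mult)
      show "binconv (\<lambda>k. A * fact (Suc k) * \<nu> (Suc k))
          (binconv (\<lambda>k. C * fact k * (H ^ k * \<nu> k)) (\<lambda>k. C * fact k * (H ^ k * \<nu> k))) k
        \<le> C * fact (Suc k) * (H ^ Suc k * \<nu> (Suc k))" for k
        by (rule binconv_inverse_bound[OF \<nu> A(1) C H])
    qed (use x \<Omega> in auto)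
    then show ?thesis by (simp add: \<nu>_def power_mult_distrib mult.assoc)
  qed
  then show ?thesis using C H A by (intro class_boundI[of "C" "H * h"]) auto
qed

text \<open>Shifting the order by one costs \<open>(k + 1) * \<mu> (Suc k) / \<mu> k\<close>, which
  is at most geometric in \<open>k\<close> by the growth hypothesis and goes into
  \<open>h\<close>.\<close>

lemma class_bound_pd1:
  assumes \<mu>: "supermult \<mu>" and B: "B > 0" "\<And>k. \<mu> (Suc k) \<le> B ^ k * \<mu> k"
    and f: "class_bound \<mu> K f"
  shows "class_bound \<mu> K (pd [i] f)"
proof -
  obtain C h where *: "C > 0" "h > 0"
    "\<And>x N. x \<in> K \<Longrightarrow> pd_bound N x f (\<lambda>k. C * fact k * (h ^ k * \<mu> k))"
    using f unfolding class_bound_def by blast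
  have le: "C * fact (Suc n) * (h ^ Suc n * \<mu> (Suc n)) \<le> (C * h) * fact n * ((2 * h * B) ^ n * \<mu> n)" for n
  proof -
    have "C * fact (Suc n) * (h ^ Suc n * \<mu> (Suc n)) = (C * h * fact n * h ^ n) * (real (Suc n) * \<mu> (Suc n))"
      by simp
    also have "\<dots> \<le> (C * h * fact n * h ^ n) * (2 ^ n * (B ^ n * \<mu> n))"
      using * supermult_pos[OF \<mu>, of "Suc n"]
      by (intro mult_left_mono mult_mono Suc_le_power2 B) auto
    finally show ?thesis by (simp add: algebra_simps power_mult_distrib)
  qed
  have "pd_bound N x (pd [i] f) (\<lambda>k. (C * h) * fact k * ((2 * h * B) ^ k * \<mu> k))" if "x \<in> K" for x N
    by (rule pd_bound_mono[OF pd_bound_pd1[OF *(3)[OF that]] order_refl le])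
  then show ?thesis using * B by (intro class_boundI[of "C * h" "2 * h * B"]) auto
qed

lemma class_bound_coord:
  assumes \<mu>: "supermult \<mu>" and K: "bounded K"
  shows "class_bound \<mu> K (\<lambda>x. x $ j)"
proof -
  obtain R where R: "\<And>x. x \<in> K \<Longrightarrow> norm x \<le> R" using K bounded_iff by blast
  \<comment> \<open>Derivatives of a coordinate vanish beyond order one; the two summands take care
    of orders zero and one.\<close>
  define C where "C = max 1 R / \<mu> 0 + 1 / \<mu> 1"
  have p: "\<mu> k > 0" for k using \<mu> by (rule supermult_pos)
  have C: "C > 0" "C * \<mu> 0 \<ge> R" "C * \<mu> 1 \<ge> 1"
    using p[of 0] p[of 1] by (auto simp: C_def distrib_right intro!: add_pos_pos add_increasing2 divide_pos_pos)
  have pd1: "pd [i] (\<lambda>x. x $ j) = (\<lambda>x. if i = j then 1 else 0)" for i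
    by (rule ext, rule has_pd_imp_pd, rule has_pd_coord)
  have "\<bar>pd ks (\<lambda>x. x $ j) x\<bar> \<le> C * fact (length ks) * (1 ^ length ks * \<mu> (length ks))" if "x \<in> K" for ks x
  proof (cases ks rule: rev_cases)
    case Nil
    then show ?thesis using C R[OF that] component_le_norm_cart[of x j] by simp
  next
    case (snoc ls i)
    then show ?thesis using C(1,3) p[of "Suc (length ls)"] by (auto simp: pd_append pd1 pd_const)
  qed
  then show ?thesis using C by (intro class_boundI[of C 1]) (auto simp: pd_bound_def)
qed

text \<open>Only order zero of the pointwise estimate is kept, but for every word at once: this
  covers powers of one field along a curve as well as mixed words in the \<open>X i\<close>.\<close>

lemma class_bound_lies:
  fixes X :: "'i::finite \<Rightarrow> real^'n::finite \<Rightarrow> real^'n"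
  assumes \<mu>: "supermult \<mu>" and \<Omega>: "open \<Omega>" "K \<subseteq> \<Omega>"
    and X: "\<And>i j. smooth_on \<Omega> (\<lambda>x. X i x $ j)" "\<And>i j. class_bound \<mu> K (\<lambda>x. X i x $ j)"
    and f: "smooth_on \<Omega> f" "class_bound \<mu> K f"
  shows "\<exists>C>0. \<exists>h>0. \<forall>w. \<forall>x\<in>K. \<bar>lies X w f x\<bar> \<le> C * fact (length w) * (h ^ length w * \<mu> (length w))"
proof -
  let ?F = "insert f (range (\<lambda>(i, j). \<lambda>x. X i x $ j))"
  have "\<exists>C>0. \<exists>h>0. \<forall>a\<in>?F. \<forall>x\<in>K. \<forall>N. pd_bound N x a (\<lambda>k. C * fact k * (h ^ k * \<mu> k))"
    using X f by (intro class_bound_finite \<mu>) auto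
  then obtain C h where bd: "C > 0" "h > 0" "\<And>a x N. a \<in> ?F \<Longrightarrow> x \<in> K \<Longrightarrow> pd_bound N x a (\<lambda>k. C * fact k * (h ^ k * \<mu> k))"
    by blast
  have "(\<lambda>x. X i x $ j) \<in> ?F" for i j
    by (intro insertI2 image_eqI[of _ _ "(i, j)"]) auto
  then have *: "C > 0" "h > 0" "\<And>x N. x \<in> K \<Longrightarrow> pd_bound N x f (\<lambda>k. C * fact k * (h ^ k * \<mu> k))"
    "\<And>i j x N. x \<in> K \<Longrightarrow> pd_bound N x (\<lambda>x. X i x $ j) (\<lambda>k. C * fact k * (h ^ k * \<mu> k))"
    using bd by blast+
  have "\<bar>lies X w f x\<bar> \<le> C * fact (length w) * ((4 * real CARD('n) * C * h) ^ length w * \<mu> (length w))"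
    if x: "x \<in> K" for w x
  proof -
    have "pd_bound 0 x (lies X w f) (\<lambda>b. C * (4 * real CARD('n) * C) ^ length w * 2 ^ b * fact (b + length w) *
        (h ^ (b + length w) * \<mu> (b + length w)))"
      by (rule pd_bound_lies[OF supermult_geometric[OF \<mu> *(2)] _ _ \<Omega>(1) _ X(1) f(1)]) (use * x \<Omega> in auto)
    then have "\<bar>pd [] (lies X w f) x\<bar> \<le> C * (4 * real CARD('n) * C) ^ length w * fact (length w) *
        (h ^ length w * \<mu> (length w))"
      unfolding pd_bound_def by (drule_tac spec[of _ "[]"]) simp
    then show ?thesis by (simp add: power_mult_distrib algebra_simps)
  qed
  moreover have "4 * real CARD('n) * C * h > 0" using * by simp
  ultimately show ?thesis using * by blast
qed

text \<open>Logarithmic convexity says that the ratios increase; \<open>m (j + k) / m j\<close> is a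
  product of \<open>k\<close> ratios, each at least its counterpart in
  \<open>m k / m 0\<close>.\<close>

lemma ratio_mono_supermult:
  fixes m :: "nat \<Rightarrow> real"
  assumes pos: "\<And>k. m k > 0" and "m 0 = 1"
    and lc: "\<And>k. (m (Suc k))\<^sup>2 \<le> m k * m (Suc (Suc k))"
  shows "mono (\<lambda>k. m (Suc k) / m k)" and "supermult m"
proof -
  show mono: "mono (\<lambda>k. m (Suc k) / m k)"
    unfolding mono_iff_le_Suc using lc pos by (simp add: field_simps power2_eq_square)
  have "m j * m k \<le> m (j + k)" for j k
  proof (induction k)
    case (Suc k)
    have "m j * m (Suc k) = (m j * m k) * (m (Suc k) / m k)" using pos[of k] by simp
    also have "\<dots> \<le> m (j + k) * (m (Suc (j + k)) / m (j + k))"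
      using Suc.IH pos monoD[OF mono, of k "j + k"] by (intro mult_mono) (auto simp: less_imp_le)
    also have "\<dots> = m (j + Suc k)" using pos[of "j + k"] by simp
    finally show ?case .
  qed (simp add: assms)
  then show "supermult m" unfolding supermult_def using pos by auto
qed

lemma regular_ws_supermult:
  assumes "weight_seq M" "regular_ws M" shows "supermult (small_m M)"
proof (rule ratio_mono_supermult(2))
  show "small_m M k > 0" for k using assms(1) by (simp add: weight_seq_def small_m_def)
  show "small_m M 0 = 1" using assms(2) by (simp add: regular_ws_def)
  show "(small_m M (Suc k))\<^sup>2 \<le> small_m M k * small_m M (Suc (Suc k))" for k
    using assms(2) unfolding regular_ws_def by (metis Suc_eq_plus1 diff_Suc_1 le_add2)
qed

lemma regular_ws_shift:
  assumes "weight_seq M" "regular_ws M"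
  obtains B where "B > 0" "\<And>k. small_m M (Suc k) \<le> B ^ k * small_m M k"
proof -
  obtain B where B: "\<And>k. k \<ge> 1 \<Longrightarrow> root k (small_m M (Suc k) / small_m M k) \<le> B"
    using assms(2) unfolding regular_ws_def by blast
  have pos: "small_m M k > 0" for k using assms(1) by (simp add: weight_seq_def small_m_def)
  \<comment> \<open>The root condition starts at \<open>k = 1\<close>; for \<open>k = 0\<close> the
    normalisation of \<open>small_m M\<close> at 0 and 1 is used instead.\<close>
  have "small_m M (Suc k) \<le> (max 1 B) ^ k * small_m M k" for k
  proof (cases "k = 0")
    case True
    then show ?thesis using assms(2) by (simp add: regular_ws_def)
  next
    case False
    have p: "small_m M (Suc k) / small_m M k > 0" using pos by simp
    have "small_m M (Suc k) / small_m M k = root k (small_m M (Suc k) / small_m M k) ^ k"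
      using False p by simp
    also have "\<dots> \<le> (max 1 B) ^ k"
      using B[of k] False p by (intro power_mono) auto
    finally show ?thesis using pos[of k] by (simp add: field_simps)
  qed
  then show ?thesis using that[of "max 1 B"] by auto
qed

section \<open>The Denjoy-Carleman theorem\<close>

text \<open>Bang's argument: the largest \<open>n\<close> with \<open>\<bar>F j x\<bar> \<le> exp (j - n) * M j\<close> for all \<open>j\<close> is infinite at
  a flat point and drops by at most one when \<open>x\<close> moves by \<open>M (n-1) / (e * M n)\<close>.\<close>

lemma bang_step:
  fixes F :: "nat \<Rightarrow> real \<Rightarrow> real"
  assumes pos: "\<And>k. M k > 0" and mono: "mono (\<lambda>k. M (Suc k) / M k)"
    and der: "\<And>k s. 0 < s \<Longrightarrow> s < 1 \<Longrightarrow> (F k has_real_derivative F (Suc k) s) (at s)"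
    and cont: "\<And>k. continuous_on {0..1} (F k)"
    and bnd: "\<And>k s. s \<in> {0..1} \<Longrightarrow> \<bar>F k s\<bar> \<le> M k"
    and P: "\<And>j. \<bar>F j a\<bar> \<le> exp (real j - real (Suc n)) * M j"
    and a: "0 \<le> a" "a \<le> x" "x \<le> 1" and xa: "x - a \<le> M n / (exp 1 * M (Suc n))"
  shows "\<bar>F j x\<bar> \<le> exp (real j - real n) * M j"
proof (cases "j \<le> n")
  case False
  have "\<bar>F j x\<bar> \<le> 1 * M j" using bnd[of x j] a by simp
  also have "\<dots> \<le> exp (real j - real n) * M j"
    using False pos[of j] by (intro mult_right_mono) auto
  finally show ?thesis .
next
  case True
  define q where "q = M (Suc n) / M n"
  have q: "q > 0" using pos by (simp add: q_def)
  have Mq: "M (Suc i) / q \<le> M i" if "i \<le> n" for i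
    using monoD[OF mono that] pos_divide_le_eq[OF pos[of i], of "M (Suc i)" q] pos_divide_le_eq[OF q, of "M (Suc i)" "M i"]
    by (simp add: q_def mult.commute)
  let ?E = "\<lambda>y. exp (exp 1 * q * (y - a))"
  \<comment> \<open>Downward induction on the order, started by the global bound at order
    \<open>n + 1\<close> and integrating from \<open>a\<close>. Differentiating \<open>?E\<close>
    yields \<open>exp 1 * q\<close>: the first factor raises the exponent to that of order
    \<open>i + 1\<close>, and \<open>q\<close> exchanges \<open>M (Suc i)\<close> for
    \<open>M i\<close> by monotone ratios.\<close>
  have "\<forall>y. a \<le> y \<and> y \<le> 1 \<longrightarrow> \<bar>F j y\<bar> \<le> exp (real j - real (Suc n)) * M j * ?E y"
    using True[THEN le_SucI]
  proof (induction j rule: inc_induct)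
    case base
    show ?case
    proof (intro allI impI)
      fix y assume y: "a \<le> y \<and> y \<le> 1"
      have "\<bar>F (Suc n) y\<bar> \<le> M (Suc n) * 1" using bnd[of y "Suc n"] a y by simp
      also have "\<dots> \<le> M (Suc n) * ?E y"
        using y q pos[of "Suc n"] by (intro mult_left_mono) auto
      finally show "\<bar>F (Suc n) y\<bar> \<le> exp (real (Suc n) - real (Suc n)) * M (Suc n) * ?E y" by simp
    qed
  next
    case (step i)
    show ?case
    proof (intro allI impI)
      fix y assume y: "a \<le> y \<and> y \<le> 1"
      let ?\<Phi> = "\<lambda>s. exp (real i - real (Suc n)) * (M (Suc i) / q) * ?E s"
      have "\<bar>F i y - F i a\<bar> \<le> ?\<Phi> y - ?\<Phi> a"
      proof (cases "a = y")
        case False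
        then have "a < y" using y by simp
        then have "norm (F i y - F i a) \<le> ?\<Phi> y - ?\<Phi> a"
        proof (rule differentiable_bound_general)
          show "continuous_on {a..y} (F i)" using a y by (intro continuous_on_subset[OF cont]) auto
          show "continuous_on {a..y} ?\<Phi>" by (intro continuous_intros)
          fix s assume s: "a < s" "s < y"
          show "(F i has_vector_derivative F (Suc i) s) (at s)"
            using der[of s i] s a y by (simp add: has_real_derivative_iff_has_vector_derivative)
          have e: "exp (real i - real (Suc n)) * exp 1 = exp (real (Suc i) - real (Suc n))"
            by (simp add: exp_add[symmetric])
          have "(?\<Phi> has_real_derivative exp (real i - real (Suc n)) * (M (Suc i) / q) * (?E s * (exp 1 * q))) (at s)"
            by (auto intro!: derivative_eq_intros)
          also have "exp (real i - real (Suc n)) * (M (Suc i) / q) * (?E s * (exp 1 * q))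
              = exp (real (Suc i) - real (Suc n)) * M (Suc i) * ?E s"
            unfolding e[symmetric] using q by simp
          finally show "(?\<Phi> has_vector_derivative exp (real (Suc i) - real (Suc n)) * M (Suc i) * ?E s) (at s)"
            by (simp add: has_real_derivative_iff_has_vector_derivative)
          show "norm (F (Suc i) s) \<le> exp (real (Suc i) - real (Suc n)) * M (Suc i) * ?E s"
            using step.IH s y by simp
        qed
        then show ?thesis by simp
      qed simp
      also have "\<dots> = exp (real i - real (Suc n)) * (M (Suc i) / q) * (?E y - 1)"
        by (simp add: algebra_simps)
      also have "\<dots> \<le> exp (real i - real (Suc n)) * M i * (?E y - 1)"
        using Mq[of i] step.hyps y q by (intro mult_right_mono mult_left_mono) auto
      finally show "\<bar>F i y\<bar> \<le> exp (real i - real (Suc n)) * M i * ?E y"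
        using P[of i] by (simp add: algebra_simps)
    qed
  qed
  then have "\<bar>F j x\<bar> \<le> exp (real j - real (Suc n)) * M j * ?E x" using a by simp
  also have "\<dots> \<le> exp (real j - real (Suc n)) * M j * exp 1"
  proof (intro mult_left_mono)
    \<comment> \<open>The length of the step is chosen for \<open>?E x \<le> exp 1\<close>: exactly
      one unit of the exponent is lost.\<close>
    have "exp 1 * q * (x - a) \<le> exp 1 * q * (M n / (exp 1 * M (Suc n)))"
      using q xa by (intro mult_left_mono) auto
    also have "\<dots> = 1" using pos[of n] pos[of "Suc n"] by (simp add: q_def)
    finally show "?E x \<le> exp 1" by simp
  qed (use pos[of j] in auto)
  also have "\<dots> = exp (real j - real n) * M j"
    by (simp add: exp_diff exp_add)
  finally show ?thesis .
qed

text \<open>Formulated for a chain of functions, each the derivative of its predecessor inside the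
  interval, so that Lie derivatives along an integral curve can be inserted.\<close>

theorem denjoy_carleman_flat:
  fixes F :: "nat \<Rightarrow> real \<Rightarrow> real"
  assumes pos: "\<And>k. M k > 0" and mono: "mono (\<lambda>k. M (Suc k) / M k)"
    and div: "\<not> summable (\<lambda>k. M k / M (Suc k))"
    and der: "\<And>k s. 0 < s \<Longrightarrow> s < 1 \<Longrightarrow> (F k has_real_derivative F (Suc k) s) (at s)"
    and cont: "\<And>k. continuous_on {0..1} (F k)"
    and bnd: "\<And>k s. s \<in> {0..1} \<Longrightarrow> \<bar>F k s\<bar> \<le> M k"
    and flat: "\<And>k. F k 0 = 0" and x: "x \<in> {0..1}"
  shows "F 0 x = 0"
proof -
  let ?\<tau> = "\<lambda>n. M n / (exp 1 * M (Suc n))"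
  have \<tau>: "?\<tau> n > 0" for n using pos by simp
  \<comment> \<open>At 0 flatness gives the estimate for every index. Starting there with index
    \<open>k + d\<close>, each admissible step lowers the index by one, and the step lengths add up
    to the sum.\<close>
  have P: "\<bar>F j y\<bar> \<le> exp (real j - real k) * M j"
    if "0 \<le> y" "y \<le> 1" "y \<le> (\<Sum>n\<in>{k..<k+d}. ?\<tau> n)" for d k j y
    using that
  proof (induction d arbitrary: k y j)
    case 0
    then have "y = 0" by simp
    then show ?case using flat[of j] pos[of j] by simp
  next
    case (Suc d)
    let ?a = "max 0 (y - ?\<tau> k)"
    have "(\<Sum>n\<in>{k..<k + Suc d}. ?\<tau> n) = ?\<tau> k + (\<Sum>n\<in>{Suc k..<Suc k + d}. ?\<tau> n)"
      by (subst sum.atLeast_Suc_lessThan) auto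
    moreover have "0 \<le> (\<Sum>n\<in>{Suc k..<Suc k + d}. ?\<tau> n)"
      by (intro sum_nonneg less_imp_le \<tau>)
    ultimately have a: "?a \<le> (\<Sum>n\<in>{Suc k..<Suc k + d}. ?\<tau> n)" using Suc.prems by simp
    show ?case
    proof (rule bang_step[OF pos mono der cont bnd])
      show "\<bar>F j ?a\<bar> \<le> exp (real j - real (Suc k)) * M j" for j
        by (rule Suc.IH) (use a Suc.prems \<tau>[of k] in auto)
    qed (use Suc.prems \<tau>[of k] in auto)
  qed
  have *: "\<bar>F 0 x\<bar> * exp (real k) \<le> M 0" for k
  proof -
    \<comment> \<open>Every tail of the divergent series exceeds \<open>x\<close>, so
      \<open>x\<close> is reached with an arbitrarily large remaining index
      \<open>k\<close>.\<close>
    have "\<exists>d. x \<le> (\<Sum>n\<in>{k..<k+d}. ?\<tau> n)"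
    proof (rule ccontr)
      assume "\<nexists>d. x \<le> (\<Sum>n\<in>{k..<k+d}. ?\<tau> n)"
      then have "(\<Sum>n<d. ?\<tau> (n + k)) \<le> x" for d
        using sum.shift_bounds_nat_ivl[of ?\<tau> 0 k d]
        by (metis add.commute add.right_neutral atLeast0LessThan linorder_linear)
      then have "summable (\<lambda>n. ?\<tau> (n + k))"
        by (intro summableI_nonneg_bounded[of _ x]) (auto intro: less_imp_le[OF \<tau>])
      then have "summable ?\<tau>" by (simp only: summable_iff_shift[of ?\<tau> k])
      from summable_mult[OF this, of "exp 1"] show False using div by simp
    qed
    then obtain d where "x \<le> (\<Sum>n\<in>{k..<k+d}. ?\<tau> n)" by blast
    from P[OF _ _ this, of 0] show ?thesis
      using x by (simp add: exp_minus field_simps)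
  qed
  show ?thesis
  proof (rule ccontr)
    assume "F 0 x \<noteq> 0"
    then obtain k :: nat where "M 0 < real k * \<bar>F 0 x\<bar>"
      using reals_Archimedean3[of "\<bar>F 0 x\<bar>"] by auto
    also have "\<dots> \<le> exp (real k) * \<bar>F 0 x\<bar>"
      using exp_ge_add_one_self[of "real k"] by (intro mult_right_mono) (linarith, simp)
    finally show False using *[of k] by (simp add: mult.commute)
  qed
qed

lemma weight_seq_mono: "weight_seq M \<Longrightarrow> mono (\<lambda>k. M (Suc k) / M k)"
  by (rule ratio_mono_supermult(1)) (auto simp: weight_seq_def dest: spec[of _ "Suc _"])

section \<open>Functions of class \<open>M\<close> with uniform bounds\<close>

text \<open>Unlike in \<open>E_M\<close>, one pair of constants serves the whole open set. On a ball
  whose closure lies in \<open>U\<close> this gives estimates along entire curves.\<close>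

definition unif_M :: "(nat \<Rightarrow> real) \<Rightarrow> (real^'n::finite) set \<Rightarrow> (real^'n \<Rightarrow> real) \<Rightarrow> bool" where
  "unif_M M B f \<longleftrightarrow> smooth_on B f \<and> class_bound (small_m M) B f"

lemma class_bound_small_m:
  "class_bound (small_m M) K f \<longleftrightarrow>
    (\<exists>C h. C > 0 \<and> h > 0 \<and> (\<forall>ks. \<forall>x\<in>K. \<bar>pd ks f x\<bar> \<le> C * h ^ length ks * M (length ks)))"
proof -
  have "C * fact k * (h ^ k * small_m M k) = C * h ^ k * M k" for C h k by (simp add: small_m_def)
  then show ?thesis unfolding class_bound_def pd_bound_def by (simp only:) blast
qed

lemma E_M_iff:
  "E_M M \<Omega> f \<longleftrightarrow> smooth_on \<Omega> f \<and> (\<forall>K. compact K \<and> K \<subseteq> \<Omega> \<longrightarrow> class_bound (small_m M) K f)"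
  unfolding E_M_def class_bound_small_m ..

lemma E_M_imp_unif_M:
  assumes "E_M M \<Omega> f" "compact K" "K \<subseteq> \<Omega>" "B \<subseteq> K"
  shows "unif_M M B f"
  unfolding unif_M_def
proof
  show "smooth_on B f" using assms smooth_on_subset[of \<Omega> f B] unfolding E_M_iff by blast
  show "class_bound (small_m M) B f"
    using assms class_bound_subset[of "small_m M" K f B] unfolding E_M_iff by blast
qed

lemma unif_M_imp_E_M: "unif_M M B f \<Longrightarrow> E_M M B f"
  unfolding unif_M_def E_M_iff using class_bound_subset by blast

lemma E_M_subset: "E_M M \<Omega> f \<Longrightarrow> \<Omega>' \<subseteq> \<Omega> \<Longrightarrow> E_M M \<Omega>' f"
  unfolding E_M_iff using smooth_on_subset by (metis order_trans)

locale regular_weight =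
  fixes M :: "nat \<Rightarrow> real"
  assumes weight_seq: "weight_seq M" and regular: "regular_ws M"
begin

lemma smult: "supermult (small_m M)"
  using regular_ws_supermult[OF weight_seq regular] .

lemma class_bound_pd: "class_bound (small_m M) K f \<Longrightarrow> class_bound (small_m M) K (pd [i] f)"
  by (rule regular_ws_shift[OF weight_seq regular]) (rule class_bound_pd1[OF smult])

lemma E_M_const: "open \<Omega> \<Longrightarrow> E_M M \<Omega> (\<lambda>x. c)"
  unfolding E_M_iff by (simp add: class_bound_const smult)

lemma E_M_coord: "open \<Omega> \<Longrightarrow> E_M M \<Omega> (\<lambda>x. x $ j)"
  unfolding E_M_iff by (simp add: class_bound_coord smult smooth_on_coord compact_imp_bounded)

lemma E_M_add: "open \<Omega> \<Longrightarrow> E_M M \<Omega> f \<Longrightarrow> E_M M \<Omega> g \<Longrightarrow> E_M M \<Omega> (\<lambda>x. f x + g x)"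
  unfolding E_M_iff by (simp add: class_bound_add[OF smult] smooth_on_add)

lemma E_M_mult: "open \<Omega> \<Longrightarrow> E_M M \<Omega> f \<Longrightarrow> E_M M \<Omega> g \<Longrightarrow> E_M M \<Omega> (\<lambda>x. f x * g x)"
  unfolding E_M_iff by (simp add: class_bound_mult[OF smult] smooth_on_mult)

lemma E_M_uminus: "open \<Omega> \<Longrightarrow> E_M M \<Omega> f \<Longrightarrow> E_M M \<Omega> (\<lambda>x. - f x)"
  using E_M_mult[OF _ E_M_const[of \<Omega> "-1"], of f] by simp

lemma E_M_diff: "open \<Omega> \<Longrightarrow> E_M M \<Omega> f \<Longrightarrow> E_M M \<Omega> g \<Longrightarrow> E_M M \<Omega> (\<lambda>x. f x - g x)"
  using E_M_add[OF _ _ E_M_uminus, of \<Omega> f g] by simp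

lemma E_M_sum: "open \<Omega> \<Longrightarrow> (\<And>a. a \<in> I \<Longrightarrow> E_M M \<Omega> (f a)) \<Longrightarrow> E_M M \<Omega> (\<lambda>x. \<Sum>a\<in>I. f a x)"
  unfolding E_M_iff by (simp add: class_bound_sum[OF smult] smooth_on_sum)

lemma E_M_pd1: "E_M M \<Omega> f \<Longrightarrow> E_M M \<Omega> (pd [i] f)"
  unfolding E_M_iff by (simp add: class_bound_pd smooth_on_pd)

lemma unif_M_const: "open \<Omega> \<Longrightarrow> unif_M M \<Omega> (\<lambda>x. c)"
  unfolding unif_M_def by (simp add: class_bound_const smult)

lemma unif_M_add: "open \<Omega> \<Longrightarrow> unif_M M \<Omega> f \<Longrightarrow> unif_M M \<Omega> g \<Longrightarrow> unif_M M \<Omega> (\<lambda>x. f x + g x)"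
  unfolding unif_M_def by (simp add: class_bound_add[OF smult _ order_refl] smooth_on_add)

lemma unif_M_mult: "open \<Omega> \<Longrightarrow> unif_M M \<Omega> f \<Longrightarrow> unif_M M \<Omega> g \<Longrightarrow> unif_M M \<Omega> (\<lambda>x. f x * g x)"
  unfolding unif_M_def by (simp add: class_bound_mult[OF smult _ order_refl] smooth_on_mult)

lemma unif_M_sum: "open \<Omega> \<Longrightarrow> (\<And>a. a \<in> I \<Longrightarrow> unif_M M \<Omega> (f a)) \<Longrightarrow> unif_M M \<Omega> (\<lambda>x. \<Sum>a\<in>I. f a x)"
  unfolding unif_M_def by (simp add: class_bound_sum[OF smult _ order_refl] smooth_on_sum)

lemma unif_M_pd1: "unif_M M \<Omega> f \<Longrightarrow> unif_M M \<Omega> (pd [i] f)"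
  unfolding unif_M_def by (simp add: class_bound_pd smooth_on_pd)

lemma unif_M_coord: "open \<Omega> \<Longrightarrow> bounded \<Omega> \<Longrightarrow> unif_M M \<Omega> (\<lambda>x. x $ j)"
  unfolding unif_M_def by (simp add: class_bound_coord smult smooth_on_coord)

lemma unif_M_inverse:
  assumes "open \<Omega>" "unif_M M \<Omega> f" "\<epsilon> > 0" "\<And>x. x \<in> \<Omega> \<Longrightarrow> \<bar>f x\<bar> \<ge> \<epsilon>"
  shows "unif_M M \<Omega> (\<lambda>x. inverse (f x))"
proof -
  have "f x \<noteq> 0" if "x \<in> \<Omega>" for x using assms(4)[OF that] assms(3) by auto
  then show ?thesis using assms unfolding unif_M_def
    by (simp add: class_bound_inverse[OF smult _ order_refl _ _ _ assms(3,4)] smooth_on_inverse)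
qed

end

section \<open>Frames and the ideal of vertical coefficients\<close>

lemma lie_cong:
  assumes "open \<Omega>" "x \<in> \<Omega>" "\<And>y. y \<in> \<Omega> \<Longrightarrow> u y = v y"
  shows "lie X u x = lie X v x"
  unfolding lie_def using pd_cong[OF assms(1,3,2)] by simp

lemma lie_const [simp]: "lie X (\<lambda>x. c) x = 0"
  unfolding lie_def by (simp add: pd_const)

lemma lie_add:
  assumes "open \<Omega>" "smooth_on \<Omega> u" "smooth_on \<Omega> v" "x \<in> \<Omega>"
  shows "lie X (\<lambda>x. u x + v x) x = lie X u x + lie X v x"
  unfolding lie_def pd_add[OF assms] by (simp add: algebra_simps sum.distrib)

lemma lie_mult:
  assumes "smooth_on \<Omega> u" "smooth_on \<Omega> v" "x \<in> \<Omega>"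
  shows "lie X (\<lambda>x. u x * v x) x = lie X u x * v x + u x * lie X v x"
  unfolding lie_def pd1_mult[OF assms] by (simp add: algebra_simps sum.distrib sum_distrib_left sum_distrib_right)

lemma lie_scaleR_field: "lie (\<lambda>x. f x *\<^sub>R X x) u x = f x * lie X u x"
  unfolding lie_def by (simp add: sum_distrib_left mult.assoc)

lemma lie_zero_field: "X x = 0 \<Longrightarrow> lie X u x = 0"
  unfolding lie_def by simp

lemma lie_bracket_nth:
  "x \<in> U \<Longrightarrow> lie_bracket U X Y x $ j = lie X (\<lambda>y. Y y $ j) x - lie Y (\<lambda>y. X y $ j) x"
  unfolding lie_bracket_def lie_def by (simp add: sum_subtractf)

section \<open>Maximal triangular frames in the Lie algebra\<close>

locale nagano = regular_weight M for M :: "nat \<Rightarrow> real" +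
  fixes U :: "(real^'n::finite) set" and p0 :: "real^'n" and g :: "(real^'n \<Rightarrow> real^'n) set"
  assumes quasi: "quasianalytic M" and U: "open U" "p0 \<in> U"
    and lie_alg: "lie_subalgebra M U g" and EM_mod: "EM_module M U g"
begin

lemma g_E_M: "X \<in> g \<Longrightarrow> E_M M U (\<lambda>x. X x $ j)"
  using lie_alg unfolding lie_subalgebra_def VF_M_def map_M_def by blast

lemma g_zero: "(\<lambda>x. 0) \<in> g" using lie_alg unfolding lie_subalgebra_def by blast

lemma g_add: "X \<in> g \<Longrightarrow> Y \<in> g \<Longrightarrow> (\<lambda>x. X x + Y x) \<in> g"
  using lie_alg unfolding lie_subalgebra_def by blast

lemma g_scale: "X \<in> g \<Longrightarrow> E_M M U f \<Longrightarrow> (\<lambda>x. f x *\<^sub>R X x) \<in> g"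
  using EM_mod unfolding EM_module_def by blast

lemma g_cscale: "X \<in> g \<Longrightarrow> (\<lambda>x. c *\<^sub>R X x) \<in> g"
  using lie_alg unfolding lie_subalgebra_def by blast

lemma g_diff: "X \<in> g \<Longrightarrow> Y \<in> g \<Longrightarrow> (\<lambda>x. X x - Y x) \<in> g"
  using g_add[OF _ g_cscale[of Y "-1"], of X] by simp

lemma g_sum: "(\<And>a. a \<in> I \<Longrightarrow> X a \<in> g) \<Longrightarrow> (\<lambda>x. \<Sum>a\<in>I. X a x) \<in> g"
  by (induction I rule: infinite_finite_induct) (auto intro!: g_zero g_add)

lemma g_bracket: "X \<in> g \<Longrightarrow> Y \<in> g \<Longrightarrow> lie_bracket U X Y \<in> g"
  using lie_alg unfolding lie_subalgebra_def by blast

text \<open>A frame is triangular over the coordinates \<open>S\<close> up to the common factor \<open>\<delta>\<close>; working with \<open>\<delta>\<close>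
  instead of dividing by it keeps the fields in \<open>g\<close>.\<close>

definition frame :: "'n set \<Rightarrow> (real^'n \<Rightarrow> real) \<Rightarrow> ('n \<Rightarrow> real^'n \<Rightarrow> real^'n) \<Rightarrow> bool" where
  "frame S \<delta> Y \<longleftrightarrow> E_M M U \<delta> \<and> \<delta> p0 \<noteq> 0 \<and> (\<forall>i\<in>S. Y i \<in> g) \<and>
     (\<forall>i\<in>S. \<forall>l\<in>S. \<forall>x\<in>U. Y i x $ l = (if i = l then \<delta> x else 0))"

definition g_vert :: "'n set \<Rightarrow> (real^'n \<Rightarrow> real^'n) set" where
  "g_vert S = {Z \<in> g. \<forall>x\<in>U. \<forall>l\<in>S. Z x $ l = 0}"

text \<open>One step of fraction-free Gaussian elimination: \<open>\<delta>\<close> times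
  \<open>Z\<close> becomes the new row, the old rows are cleared of component \<open>l\<close>, and
  all pivots become \<open>Z x $ l * \<delta> x\<close>.\<close>

lemma frame_insert:
  assumes fr: "frame S \<delta> Y" and Z: "Z \<in> g_vert S" "Z p0 $ l \<noteq> 0"
  shows "frame (insert l S) (\<lambda>x. Z x $ l * \<delta> x)
    (\<lambda>i. if i = l then (\<lambda>x. \<delta> x *\<^sub>R Z x) else (\<lambda>x. (Z x $ l) *\<^sub>R Y i x - (Y i x $ l) *\<^sub>R Z x))"
proof -
  have Zg: "Z \<in> g" and Z0: "\<And>x k. x \<in> U \<Longrightarrow> k \<in> S \<Longrightarrow> Z x $ k = 0"
    using Z by (auto simp: g_vert_def)
  have lS: "l \<notin> S" using Z0[of p0 l] U Z by auto
  have Y: "\<And>i. i \<in> S \<Longrightarrow> Y i \<in> g" and \<delta>: "E_M M U \<delta>" "\<delta> p0 \<noteq> 0"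
    and Yc: "\<And>i k x. i \<in> S \<Longrightarrow> k \<in> S \<Longrightarrow> x \<in> U \<Longrightarrow> Y i x $ k = (if i = k then \<delta> x else 0)"
    using fr by (auto simp: frame_def)
  have 1: "(\<lambda>x. \<delta> x *\<^sub>R Z x) \<in> g" by (intro g_scale Zg \<delta>)
  have 2: "(\<lambda>x. (Z x $ l) *\<^sub>R Y i x - (Y i x $ l) *\<^sub>R Z x) \<in> g" if "i \<in> S" for i
    by (intro g_diff g_scale g_E_M Zg Y that)
  show ?thesis
    unfolding frame_def using 1 2 Z(2) \<delta> lS Yc Z0
    by (auto intro!: E_M_mult U g_E_M Zg)
qed

lemma exists_maximal_frame:
  obtains S \<delta> Y where "frame S \<delta> Y" "\<And>Z. Z \<in> g_vert S \<Longrightarrow> Z p0 = 0"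
proof -
  let ?F = "{S. \<exists>\<delta> Y. frame S \<delta> Y}"
  have "frame {} (\<lambda>x. 1) undefined" unfolding frame_def using E_M_const U by simp
  then have "{} \<in> ?F" by blast
  then obtain S where S: "S \<in> ?F" "\<And>T. T \<in> ?F \<Longrightarrow> S \<subseteq> T \<Longrightarrow> S = T"
    using finite_has_maximal2[of ?F "{}"] by auto
  then obtain \<delta> Y where fr: "frame S \<delta> Y" by blast
  have "Z p0 = 0" if Z: "Z \<in> g_vert S" for Z
  proof (rule ccontr)
    assume "Z p0 \<noteq> 0"
    then obtain l where l: "Z p0 $ l \<noteq> 0" by (auto simp: vec_eq_iff)
    have "insert l S \<in> ?F" using frame_insert[OF fr Z l] by blast
    then have "l \<in> S" using S(2) by blast
    then show False using Z l U by (auto simp: g_vert_def)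
  qed
  then show ?thesis using that fr by blast
qed

end

lemma unif_M_cong:
  assumes "open B" "unif_M M B f" "\<And>x. x \<in> B \<Longrightarrow> f x = h x"
  shows "unif_M M B h"
  using assms(2) class_bound_cong[OF assms(1) order_refl, of f h] smooth_on_cong[OF assms(1), of f h] assms(3)
  unfolding unif_M_def by simp

text \<open>On the ball the constants of the class are uniform and \<open>\<delta>\<close> stays
  away from zero, so division by \<open>\<delta>\<close> is possible there, while
  \<open>\<delta>\<close> may vanish elsewhere in \<open>U\<close>.\<close>

locale nagano_frame = nagano M U p0 g
  for M :: "nat \<Rightarrow> real" and U :: "(real^'n::finite) set" and p0 :: "real^'n" and g +
  fixes S :: "'n set" and \<delta> :: "real^'n \<Rightarrow> real" and Y :: "'n \<Rightarrow> real^'n \<Rightarrow> real^'n" and R \<epsilon> :: real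
  assumes fr: "frame S \<delta> Y" and max: "\<And>Z. Z \<in> g_vert S \<Longrightarrow> Z p0 = 0"
    and R: "R > 0" "cball p0 R \<subseteq> U" and \<epsilon>: "\<epsilon> > 0" "\<And>x. x \<in> ball p0 R \<Longrightarrow> \<epsilon> \<le> \<bar>\<delta> x\<bar>"
begin

abbreviation "B \<equiv> ball p0 R"

text \<open>Set to zero outside \<open>S\<close> so that sums and words can range over all
  coordinates.\<close>

definition X :: "'n \<Rightarrow> real^'n \<Rightarrow> real^'n" where
  "X i x = (if i \<in> S then inverse (\<delta> x) *\<^sub>R Y i x else 0)"

lemma BU: "B \<subseteq> U" using R(2) ball_subset_cball by blast

lemma p0B: "p0 \<in> B" using R by simp

lemma Y_g: "i \<in> S \<Longrightarrow> Y i \<in> g"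
  and \<delta>_E: "E_M M U \<delta>"
  and Y_nth: "i \<in> S \<Longrightarrow> l \<in> S \<Longrightarrow> x \<in> U \<Longrightarrow> Y i x $ l = (if i = l then \<delta> x else 0)"
  using fr unfolding frame_def by auto

lemma E_unif: "E_M M U f \<Longrightarrow> unif_M M B f"
  by (rule E_M_imp_unif_M[OF _ compact_cball R(2) ball_subset_cball])

lemma unif_smooth: "unif_M M B f \<Longrightarrow> smooth_on B f"
  unfolding unif_M_def by blast

lemma \<delta>_nz: "x \<in> B \<Longrightarrow> \<delta> x \<noteq> 0"
  using \<epsilon>(2)[of x] \<epsilon>(1) by auto

lemma inv_unif: "unif_M M B (\<lambda>x. inverse (\<delta> x))"
  by (rule unif_M_inverse[OF open_ball E_unif[OF \<delta>_E] \<epsilon>])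

lemma X_unif: "unif_M M B (\<lambda>x. X i x $ j)"
proof (cases "i \<in> S")
  case True
  then have "(\<lambda>x. X i x $ j) = (\<lambda>x. inverse (\<delta> x) * Y i x $ j)" by (simp add: X_def)
  then show ?thesis using True by (simp only:) (intro unif_M_mult open_ball inv_unif E_unif g_E_M Y_g)
next
  case False
  then show ?thesis by (simp add: X_def unif_M_const)
qed

lemma X_smooth: "smooth_on B (\<lambda>x. X i x $ j)"
  using X_unif unif_smooth by blast

lemma X_nth:
  assumes "l \<in> S" "x \<in> B" shows "X i x $ l = (if i = l then 1 else 0)"
  using assms Y_nth[of i l x] \<delta>_nz[of x] BU by (auto simp: X_def)

text \<open>This ideal is stable under the \<open>X i\<close> and consists of functions vanishing at \<open>p0\<close>, so all its members
  are flat at \<open>p0\<close> along the \<open>X i\<close>.\<close>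

inductive_set J :: "(real^'n \<Rightarrow> real) set" where
  J_gen: "Z \<in> g_vert S \<Longrightarrow> (\<lambda>x. Z x $ j) \<in> J"
| J_mult: "u \<in> J \<Longrightarrow> unif_M M B c \<Longrightarrow> (\<lambda>x. c x * u x) \<in> J"
| J_add: "u \<in> J \<Longrightarrow> v \<in> J \<Longrightarrow> (\<lambda>x. u x + v x) \<in> J"
| J_cong: "u \<in> J \<Longrightarrow> (\<And>x. x \<in> B \<Longrightarrow> u x = v x) \<Longrightarrow> v \<in> J"

lemma J_zero: "(\<lambda>x. 0) \<in> J"
proof -
  have "(\<lambda>x. 0) \<in> g_vert S" using g_zero by (auto simp: g_vert_def)
  from J_gen[OF this] show ?thesis by simp
qed

lemma J_sum: "(\<And>a. a \<in> I \<Longrightarrow> u a \<in> J) \<Longrightarrow> (\<lambda>x. \<Sum>a\<in>I. u a x) \<in> J"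
  by (induction I rule: infinite_finite_induct) (auto intro: J_zero J_add)

lemma J_unif: "u \<in> J \<Longrightarrow> unif_M M B u"
proof (induction rule: J.induct)
  case (J_gen Z j)
  then show ?case by (auto intro!: E_unif g_E_M simp: g_vert_def)
next
  case (J_mult u c)
  then show ?case by (intro unif_M_mult open_ball)
next
  case (J_add u v)
  then show ?case by (intro unif_M_add open_ball)
next
  case (J_cong u v)
  then show ?case by (blast intro: unif_M_cong[OF open_ball])
qed

lemma J_p0: "u \<in> J \<Longrightarrow> u p0 = 0"
proof (induction rule: J.induct)
  case (J_cong u v)
  then show ?case using p0B by metis
qed (auto simp: max)

text \<open>The only \<open>S\<close>-component of the bracket of \<open>Y i\<close> and
  \<open>Z\<close> that can survive is number \<open>i\<close>, equal to
  \<open>- lie Z \<delta>\<close>. Multiplying by \<open>\<delta>\<close> and adding a multiple of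
  \<open>Y i\<close> cancels it inside the module.\<close>

lemma vert_bracket:
  assumes Z: "Z \<in> g_vert S" and i: "i \<in> S"
  shows "(\<lambda>x. \<delta> x *\<^sub>R lie_bracket U (Y i) Z x + lie Z \<delta> x *\<^sub>R Y i x) \<in> g_vert S"
proof -
  have Zg: "Z \<in> g" and Z0: "\<And>x k. x \<in> U \<Longrightarrow> k \<in> S \<Longrightarrow> Z x $ k = 0"
    using Z by (auto simp: g_vert_def)
  have "E_M M U (lie Z \<delta>)"
    unfolding lie_def[abs_def] by (intro E_M_sum E_M_mult U g_E_M Zg E_M_pd1 \<delta>_E)
  then have 1: "(\<lambda>x. \<delta> x *\<^sub>R lie_bracket U (Y i) Z x + lie Z \<delta> x *\<^sub>R Y i x) \<in> g"
    by (intro g_add g_scale g_bracket Y_g i Zg \<delta>_E)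
  have "(\<delta> x *\<^sub>R lie_bracket U (Y i) Z x + lie Z \<delta> x *\<^sub>R Y i x) $ l = 0" if x: "x \<in> U" and l: "l \<in> S" for x l
  proof -
    have a: "lie (Y i) (\<lambda>y. Z y $ l) x = 0"
      using lie_cong[OF U(1) x, of "\<lambda>y. Z y $ l" "\<lambda>y. 0"] Z0 l by simp
    have b: "lie Z (\<lambda>y. Y i y $ l) x = (if i = l then lie Z \<delta> x else 0)"
      using lie_cong[OF U(1) x, of "\<lambda>y. Y i y $ l" "\<lambda>y. if i = l then \<delta> y else 0"] Y_nth[OF i l] by auto
    show ?thesis using x by (simp add: lie_bracket_nth a b Y_nth[OF i l])
  qed
  then show ?thesis using 1 by (simp add: g_vert_def)
qed

lemma lie_X_vert:
  assumes Z: "Z \<in> g_vert S" shows "lie (X i) (\<lambda>x. Z x $ j) \<in> J"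
proof (cases "i \<in> S")
  case False
  then show ?thesis using lie_zero_field[of "X i"] J_zero by (auto simp: X_def fun_eq_iff intro: J_cong)
next
  case i: True
  let ?Z = "\<lambda>x. \<delta> x *\<^sub>R lie_bracket U (Y i) Z x + lie Z \<delta> x *\<^sub>R Y i x"
  let ?i = "\<lambda>x. inverse (\<delta> x)"
  \<comment> \<open>Dividing the corrected bracket by the square of \<open>\<delta>\<close> gives
    the Lie derivative of \<open>Z x $ j\<close> along \<open>X i\<close>, up to terms in which
    \<open>Z\<close> differentiates \<open>Y i\<close> and \<open>\<delta>\<close>. These are linear
    in the components of \<open>Z\<close>, with coefficients \<open>?c k\<close>.\<close>
  let ?c = "\<lambda>k x. ?i x * pd [k] (\<lambda>y. Y i y $ j) x + (-1) * (?i x * (?i x * (Y i x $ j * pd [k] \<delta> x)))"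
  have c: "unif_M M B (?c k)" for k
    by (intro unif_M_add unif_M_mult open_ball inv_unif unif_M_const E_unif E_M_pd1 g_E_M Y_g i \<delta>_E)
  have J: "(\<lambda>x. (?i x * ?i x) * ?Z x $ j + (\<Sum>k\<in>UNIV. ?c k x * Z x $ k)) \<in> J"
    by (intro J_add J_sum J_mult J_gen c Z vert_bracket i unif_M_mult open_ball inv_unif)
  show ?thesis
  proof (rule J_cong[OF J])
    fix x assume x: "x \<in> B"
    have xU: "x \<in> U" using x BU by blast
    have nz: "\<delta> x \<noteq> 0" using x by (rule \<delta>_nz)
    have X: "X i = (\<lambda>x. ?i x *\<^sub>R Y i x)" using i by (auto simp: X_def fun_eq_iff)
    have "(\<Sum>k\<in>UNIV. ?c k x * Z x $ k) = ?i x * lie Z (\<lambda>y. Y i y $ j) x - ?i x * ?i x * Y i x $ j * lie Z \<delta> x"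
      unfolding lie_def by (simp add: sum_distrib_left algebra_simps sum_subtractf)
    moreover have "?Z x $ j = \<delta> x * (lie (Y i) (\<lambda>x. Z x $ j) x - lie Z (\<lambda>x. Y i x $ j) x) + lie Z \<delta> x * Y i x $ j"
      using xU by (simp add: lie_bracket_nth)
    ultimately show "(?i x * ?i x) * ?Z x $ j + (\<Sum>k\<in>UNIV. ?c k x * Z x $ k) = lie (X i) (\<lambda>x. Z x $ j) x"
      unfolding X lie_scaleR_field using nz by (simp only:) (simp add: field_simps)
  qed
qed

lemma lie_unif: "unif_M M B u \<Longrightarrow> unif_M M B (lie (X i) u)"
  unfolding lie_def[abs_def] by (intro unif_M_sum unif_M_mult open_ball X_unif unif_M_pd1)

lemma lie_J: "u \<in> J \<Longrightarrow> lie (X i) u \<in> J"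
proof (induction rule: J.induct)
  case (J_gen Z j)
  then show ?case by (rule lie_X_vert)
next
  case (J_mult u c)
  have "(\<lambda>x. lie (X i) c x * u x + c x * lie (X i) u x) \<in> J"
    by (intro J_add J.J_mult J_mult lie_unif)
  then show ?case
    by (rule J_cong) (use J_mult in \<open>auto intro!: lie_mult[symmetric] unif_smooth J_unif\<close>)
next
  case (J_add u v)
  have "(\<lambda>x. lie (X i) u x + lie (X i) v x) \<in> J"
    by (intro J.J_add J_add)
  then show ?case
    by (rule J_cong) (use J_add in \<open>auto intro!: lie_add[OF open_ball, symmetric] unif_smooth J_unif\<close>)
next
  case (J_cong u v)
  from J_cong(3) show ?case by (rule J.J_cong) (rule lie_cong[OF open_ball _ J_cong(2)])
qed

text \<open>Only the zero set of the ideal, not claimed to be a manifold; the manifold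
  \<open>W\<close> will be found inside it.\<close>

definition leaf :: "(real^'n) set" where
  "leaf = {x \<in> B. \<forall>u\<in>J. u x = 0}"

lemma leaf_zero: "p \<in> leaf \<Longrightarrow> u \<in> J \<Longrightarrow> u p = 0"
  by (simp add: leaf_def)

text \<open>Subtracting its \<open>S\<close>-part from \<open>\<delta>\<close> times
  \<open>Q\<close> leaves a vertical field, whose components generate \<open>J\<close> and hence
  vanish here. Thus the \<open>X k\<close> span all values of \<open>g\<close> on the zero
  set.\<close>

lemma g_at_leaf:
  assumes "Q \<in> g" and p: "p \<in> leaf"
  shows "Q p = (\<Sum>k\<in>S. Q p $ k *\<^sub>R X k p)"
proof -
  have pB: "p \<in> B" using p by (simp add: leaf_def)
  define Z where "Z x = \<delta> x *\<^sub>R Q x - (\<Sum>k\<in>S. Q x $ k *\<^sub>R Y k x)" for x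
  have "Z \<in> g"
    unfolding Z_def[abs_def] by (intro g_diff g_scale g_sum g_E_M assms Y_g \<delta>_E)
  moreover have "Z x $ l = 0" if x: "x \<in> U" and l: "l \<in> S" for x l
  proof -
    have "(\<Sum>k\<in>S. Q x $ k *\<^sub>R Y k x) $ l = (\<Sum>k\<in>S. if k = l then Q x $ k * \<delta> x else 0)"
      unfolding sum_component by (intro sum.cong refl) (simp add: Y_nth[OF _ l x])
    also have "\<dots> = Q x $ l * \<delta> x" using l by simp
    finally show ?thesis by (simp add: Z_def)
  qed
  ultimately have "Z \<in> g_vert S" by (simp add: g_vert_def)
  then have "Z p $ j = 0" for j
    using leaf_zero[OF p J_gen[of Z j]] by simp
  then have "Z p = 0" by (simp add: vec_eq_iff)
  then have "\<delta> p *\<^sub>R Q p - (\<Sum>k\<in>S. Q p $ k *\<^sub>R Y k p) = 0" by (simp only: Z_def)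
  then have eq: "\<delta> p *\<^sub>R Q p = (\<Sum>k\<in>S. Q p $ k *\<^sub>R Y k p)"
    by (rule eq_iff_diff_eq_0[THEN iffD2])
  have "Q p = inverse (\<delta> p) *\<^sub>R (\<delta> p *\<^sub>R Q p)" using \<delta>_nz[OF pB] by simp
  also have "\<dots> = inverse (\<delta> p) *\<^sub>R (\<Sum>k\<in>S. Q p $ k *\<^sub>R Y k p)" by (simp only: eq)
  also have "\<dots> = (\<Sum>k\<in>S. Q p $ k *\<^sub>R X k p)"
    by (auto simp: scaleR_sum_right X_def mult.commute intro!: sum.cong)
  finally show ?thesis .
qed

text \<open>The \<open>S\<close>-components of the \<open>X i\<close> are constant on the ball, so
  the commutator \<open>d\<close> has none. Expanding it through the \<open>Y i\<close> writes
  \<open>d\<close> as a combination of values at \<open>p\<close> of members of \<open>g\<close>;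
  such a vector is determined by its \<open>S\<close>-components, hence
  \<open>d = 0\<close>.\<close>

lemma X_commute:
  assumes p: "p \<in> leaf"
  shows "lie (X i) (\<lambda>x. X j x $ l) p = lie (X j) (\<lambda>x. X i x $ l) p"
proof (cases "i \<in> S \<and> j \<in> S")
  case False
  then have "X i = (\<lambda>x. 0) \<or> X j = (\<lambda>x. 0)" by (auto simp: X_def fun_eq_iff)
  then show ?thesis by (auto simp: lie_zero_field)
next
  case True
  then have i: "i \<in> S" and j: "j \<in> S" by auto
  have pB: "p \<in> B" using p by (simp add: leaf_def)
  then have pU: "p \<in> U" using BU by blast
  let ?i = "\<lambda>x. inverse (\<delta> x)"
  have X: "X k = (\<lambda>x. ?i x *\<^sub>R Y k x)" if "k \<in> S" for k using that by (auto simp: X_def fun_eq_iff)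
  let ?Q = "lie_bracket U (Y i) (Y j)"
  define A where "A v = (\<Sum>k\<in>S. v $ k *\<^sub>R X k p)" for v
  have A_add: "A (v + w) = A v + A w" and A_scale: "A (c *\<^sub>R v) = c *\<^sub>R A v" for v w c
    by (simp_all add: A_def algebra_simps sum.distrib scaleR_sum_right)
  have Ag: "A (Q p) = Q p" if "Q \<in> g" for Q using g_at_leaf[OF that p] by (simp add: A_def)
  define d where "d = (\<chi> l. lie (X i) (\<lambda>x. X j x $ l) p - lie (X j) (\<lambda>x. X i x $ l) p)"
  have "lie (X a) (\<lambda>x. X b x $ l) p = lie (X a) ?i p * Y b p $ l + ?i p * ?i p * lie (Y a) (\<lambda>x. Y b x $ l) p"
    if "a \<in> S" "b \<in> S" for a b l
  proof -
    have "lie (X a) (\<lambda>x. X b x $ l) p = lie (X a) (\<lambda>x. ?i x * Y b x $ l) p" using that by (simp add: X)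
    also have "\<dots> = lie (X a) ?i p * Y b p $ l + ?i p * lie (X a) (\<lambda>x. Y b x $ l) p"
      by (intro lie_mult[OF _ _ pB] unif_smooth inv_unif E_unif g_E_M Y_g that)
    finally show ?thesis using that by (simp add: X lie_scaleR_field)
  qed
  then have d: "d = (?i p * ?i p) *\<^sub>R ?Q p + (lie (X i) ?i p *\<^sub>R Y j p + (- lie (X j) ?i p) *\<^sub>R Y i p)"
    using i j pU by (simp add: d_def vec_eq_iff lie_bracket_nth algebra_simps)
  have "A d = d" unfolding d A_add A_scale by (simp only: Ag g_bracket Y_g i j)
  moreover have "d $ k = 0" if k: "k \<in> S" for k
  proof -
    have "lie V (\<lambda>x. X a x $ k) p = 0" for V a
      using lie_cong[OF open_ball pB, of "\<lambda>x. X a x $ k" "\<lambda>x. if a = k then 1 else 0" V] X_nth[OF k] by simp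
    then show ?thesis by (simp add: d_def)
  qed
  then have "A d = 0" by (simp add: A_def)
  ultimately have "d $ l = 0" by simp
  then show ?thesis by (simp add: d_def)
qed

end

section \<open>Ordinary differential equations on the unit interval\<close>

text \<open>On an interval of unit length the maximum \<open>m\<close> of the norm satisfies
  \<open>m \<le> m / 2 + e\<close>, and the first term is absorbed. With \<open>e = 0\<close> this
  serves as a uniqueness statement.\<close>

lemma half_gronwall:
  fixes z :: "real \<Rightarrow> 'a::euclidean_space"
  assumes cont: "continuous_on {0..1} z" and z0: "z 0 = 0"
    and der: "\<And>s. 0 < s \<Longrightarrow> s < 1 \<Longrightarrow> (z has_vector_derivative z' s) (at s)"
    and bnd: "\<And>s. 0 < s \<Longrightarrow> s < 1 \<Longrightarrow> norm (z' s) \<le> 1/2 * norm (z s) + e"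
    and s: "s \<in> {0..1}" and e: "e \<ge> 0"
  shows "norm (z s) \<le> 2 * e"
proof -
  have "continuous_on {0..1} (\<lambda>s. norm (z s))" using cont by (intro continuous_intros)
  then obtain s0 where s0: "s0 \<in> {0..1}" "\<And>s. s \<in> {0..1} \<Longrightarrow> norm (z s) \<le> norm (z s0)"
    using continuous_attains_sup[of "{0..1::real}" "\<lambda>s. norm (z s)"] by auto
  let ?m = "1/2 * norm (z s0) + e"
  have m: "?m \<ge> 0" using e by simp
  have "norm (z s0) \<le> ?m"
  proof (cases "s0 = 0")
    case False
    then have "0 < s0" using s0 by simp
    then have "norm (z s0 - z 0) \<le> ?m * s0 - ?m * 0"
    proof (rule differentiable_bound_general)
      show "continuous_on {0..s0} z" using s0 by (intro continuous_on_subset[OF cont]) auto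
      show "continuous_on {0..s0} (\<lambda>s. ?m * s)" by (intro continuous_intros)
      fix s assume s: "0 < s" "s < s0"
      show "(z has_vector_derivative z' s) (at s)" using der s s0 by simp
      show "((\<lambda>s. ?m * s) has_vector_derivative ?m) (at s)"
        unfolding has_real_derivative_iff_has_vector_derivative[symmetric] by (auto intro!: derivative_eq_intros)
      show "norm (z' s) \<le> ?m" using bnd[of s] s0(2)[of s] s s0(1) by simp
    qed
    also have "\<dots> \<le> ?m * 1 - ?m * 0" using s0 m by (intro diff_mono mult_left_mono) auto
    finally show ?thesis using z0 by simp
  qed (use z0 e in auto)
  then show ?thesis using s0(2)[OF s] by simp
qed

text \<open>Constant 1/2 and unit length make the integral operator a contraction for the supremum
  distance, without a weighted norm.\<close>

lemma picard_unit_interval: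
  fixes f :: "'a::euclidean_space \<Rightarrow> 'a"
  assumes lip: "\<And>x y. norm (f x - f y) \<le> 1/2 * norm (x - y)"
  shows "\<exists>\<gamma>. \<gamma> 0 = x0 \<and> continuous_on {0..1} \<gamma> \<and>
    (\<forall>s. 0 < s \<and> s < 1 \<longrightarrow> (\<gamma> has_vector_derivative f (\<gamma> s)) (at s))"
proof -
  have cf: "continuous_on UNIV f"
    by (rule lipschitz_on_continuous_on[of "1/2"]) (use lip in \<open>auto simp: lipschitz_on_def dist_norm\<close>)
  have cg: "continuous_on {a..b} (\<lambda>u. f (apply_bcontfun \<gamma> u))" for \<gamma> :: "real \<Rightarrow>\<^sub>C 'a" and a b
    by (rule continuous_on_compose2[OF cf continuous_on_apply_bcontfun]) simp
  \<comment> \<open>Clamping time to the unit interval lets the operator act on bounded continuous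
    functions on the whole line.\<close>
  define c where "c s = max 0 (min 1 s)" for s :: real
  have c: "c s \<in> {0..1}" for s by (simp add: c_def)
  define I where "I \<gamma> s = x0 + integral {0..s} (\<lambda>u. f (apply_bcontfun \<gamma> u))" for \<gamma> :: "real \<Rightarrow>\<^sub>C 'a" and s
  have cI: "continuous_on {0..1} (I \<gamma>)" for \<gamma>
    unfolding I_def by (intro continuous_intros indefinite_integral_continuous_1 integrable_continuous_real cg)
  have Ic: "(\<lambda>s. I \<gamma> (c s)) \<in> bcontfun" for \<gamma>
  proof -
    have "continuous_on UNIV (\<lambda>s. I \<gamma> (c s))"
      by (rule continuous_on_compose2[OF cI[of \<gamma>]]) (use c in \<open>auto simp: c_def intro!: continuous_intros\<close>)
    moreover have "bounded (range (\<lambda>s. I \<gamma> (c s)))"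
      by (rule bounded_subset[OF compact_imp_bounded[OF compact_continuous_image[OF cI[of \<gamma>] compact_Icc]]])
        (use c in auto)
    ultimately show ?thesis by (simp add: bcontfun_def)
  qed
  define T where "T \<gamma> = Bcontfun (\<lambda>s. I \<gamma> (c s))" for \<gamma>
  have T: "apply_bcontfun (T \<gamma>) = (\<lambda>s. I \<gamma> (c s))" for \<gamma>
    unfolding T_def by (rule Bcontfun_inverse[OF Ic])
  have "dist (T \<gamma>) (T \<eta>) \<le> 1/2 * dist \<gamma> \<eta>" for \<gamma> \<eta>
  proof (rule dist_bound)
    fix s
    have "I \<gamma> (c s) - I \<eta> (c s) = integral {0..c s} (\<lambda>u. f (apply_bcontfun \<gamma> u) - f (apply_bcontfun \<eta> u))"
      unfolding I_def by (subst integral_diff) (auto intro!: integrable_continuous_real cg)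
    also have "norm \<dots> \<le> 1/2 * dist \<gamma> \<eta> * (c s - 0)"
    proof (rule integral_bound)
      show "0 \<le> c s" using c by auto
      show "continuous_on {0..c s} (\<lambda>u. f (apply_bcontfun \<gamma> u) - f (apply_bcontfun \<eta> u))"
        by (intro continuous_intros cg)
      fix u
      have "norm (f (apply_bcontfun \<gamma> u) - f (apply_bcontfun \<eta> u)) \<le> 1/2 * dist (apply_bcontfun \<gamma> u) (apply_bcontfun \<eta> u)"
        using lip by (simp add: dist_norm)
      also have "\<dots> \<le> 1/2 * dist \<gamma> \<eta>" using dist_bounded[of \<gamma> u \<eta>] by simp
      finally show "norm (f (apply_bcontfun \<gamma> u) - f (apply_bcontfun \<eta> u)) \<le> 1/2 * dist \<gamma> \<eta>" .
    qed
    also have "\<dots> \<le> 1/2 * dist \<gamma> \<eta> * 1" using c[of s] by (intro mult_left_mono) auto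
    finally show "dist (apply_bcontfun (T \<gamma>) s) (apply_bcontfun (T \<eta>) s) \<le> 1/2 * dist \<gamma> \<eta>"
      by (simp add: T dist_norm)
  qed
  then have "\<exists>!\<gamma>. T \<gamma> = \<gamma>" by (intro banach_fix_type[of "1/2"]) auto
  then obtain \<gamma> where \<gamma>: "T \<gamma> = \<gamma>" by blast
  have fp: "apply_bcontfun \<gamma> s = I \<gamma> (c s)" for s
    by (rule fun_cong[OF T[of \<gamma>, unfolded \<gamma>]])
  show ?thesis
  proof (intro exI[of _ "apply_bcontfun \<gamma>"] conjI allI impI)
    show "apply_bcontfun \<gamma> 0 = x0" unfolding fp[of 0] by (simp add: c_def I_def)
    show "continuous_on {0..1} (apply_bcontfun \<gamma>)" by simp
    fix s :: real assume s: "0 < s \<and> s < 1"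
    have "((\<lambda>s. integral {0..s} (\<lambda>u. f (apply_bcontfun \<gamma> u))) has_vector_derivative f (apply_bcontfun \<gamma> s)) (at s within {0..1})"
      by (rule integral_has_vector_derivative[OF cg]) (use s in auto)
    then have "(I \<gamma> has_vector_derivative f (apply_bcontfun \<gamma> s)) (at s within {0..1})"
      unfolding I_def by (auto intro!: derivative_eq_intros)
    then have "(I \<gamma> has_vector_derivative f (apply_bcontfun \<gamma> s)) (at s within {0<..<1})"
      by (rule has_vector_derivative_within_subset) auto
    then have "(I \<gamma> has_vector_derivative f (apply_bcontfun \<gamma> s)) (at s)"
      using s by (subst (asm) has_vector_derivative_within_open) auto
    then show "(apply_bcontfun \<gamma> has_vector_derivative f (apply_bcontfun \<gamma> s)) (at s)"
    proof (rule has_vector_derivative_transform_within_open[where S = "{0<..<1}"])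
      fix y :: real assume "y \<in> {0<..<1}"
      then have "c y = y" by (simp add: c_def)
      then show "I \<gamma> y = apply_bcontfun \<gamma> y" using fp[of y] by simp
    qed (use s in auto)
  qed
qed

section \<open>First and second order estimates on a ball\<close>

text \<open>The Jacobian applied to a vector; being built from \<open>lie\<close>, it agrees with
  Lie derivatives of the components by unfolding.\<close>

definition deriv_at :: "(real^'n::finite \<Rightarrow> real^'n) \<Rightarrow> real^'n \<Rightarrow> real^'n \<Rightarrow> real^'n" where
  "deriv_at F x v = (\<chi> l. lie (\<lambda>_. v) (\<lambda>y. F y $ l) x)"

lemma lie_eq_deriv_at: "lie X (\<lambda>y. F y $ l) x = deriv_at F x (X x) $ l"
  by (simp add: deriv_at_def lie_def)

lemma smooth_on_chain:
  assumes "open \<Omega>" "smooth_on \<Omega> f" "(\<gamma> has_vector_derivative w) (at s)" "\<gamma> s \<in> \<Omega>"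
  shows "((\<lambda>s. f (\<gamma> s)) has_real_derivative lie (\<lambda>_. w) f (\<gamma> s)) (at s)"
proof -
  have "((\<lambda>s. f (\<gamma> s)) has_derivative (\<lambda>h. \<Sum>i\<in>UNIV. (h *\<^sub>R w) $ i * pd [i] f (\<gamma> s))) (at s)"
    by (rule has_derivative_compose[OF assms(3)[unfolded has_vector_derivative_def],
      where g = f, OF smooth_on_has_derivative[OF assms(1,2,4)]])
  moreover have "(\<lambda>h. \<Sum>i\<in>UNIV. (h *\<^sub>R w) $ i * pd [i] f (\<gamma> s)) = (*) (lie (\<lambda>_. w) f (\<gamma> s))"
    by (simp add: fun_eq_iff lie_def sum_distrib_right sum_distrib_left ac_simps)
  ultimately show ?thesis by (simp add: has_field_derivative_def)
qed

lemma abs_lie_const_le: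
  assumes "\<And>i. \<bar>pd [i] f x\<bar> \<le> K"
  shows "\<bar>lie (\<lambda>_. v) f x\<bar> \<le> real CARD('n) * K * norm (v :: real^'n::finite)"
proof -
  have "\<bar>lie (\<lambda>_. v) f x\<bar> \<le> (\<Sum>i\<in>(UNIV::'n set). norm v * K)"
    unfolding lie_def using component_le_norm_cart[of v] assms
    by (intro order_trans[OF sum_abs] sum_mono) (auto simp: abs_mult intro!: mult_mono)
  then show ?thesis by (simp add: algebra_simps)
qed

lemma norm_le_card_max:
  assumes "\<And>l. \<bar>v $ l\<bar> \<le> c" shows "norm (v :: real^'n::finite) \<le> real CARD('n) * c"
proof -
  have "norm v \<le> (\<Sum>l\<in>UNIV. \<bar>v $ l\<bar>)" by (rule norm_le_l1_cart)
  also have "\<dots> \<le> (\<Sum>l\<in>(UNIV::'n set). c)" by (intro sum_mono assms)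
  finally show ?thesis by simp
qed

lemma smooth_on_mean_value:
  fixes f :: "real^'n::finite \<Rightarrow> real"
  assumes "open \<Omega>" "convex \<Omega>" "smooth_on \<Omega> f"
    and K: "\<And>i x. x \<in> \<Omega> \<Longrightarrow> \<bar>pd [i] f x\<bar> \<le> K" and xy: "x \<in> \<Omega>" "y \<in> \<Omega>"
  shows "\<bar>f x - f y\<bar> \<le> real CARD('n) * K * norm (x - y)"
proof -
  have K0: "K \<ge> 0" using K[OF xy(1)] by (rule order_trans[OF abs_ge_zero])
  have "norm (f x - f y) \<le> real CARD('n) * K * norm (x - y)"
  proof (rule differentiable_bound[OF assms(2) _ _ xy, where f' = "\<lambda>z v. lie (\<lambda>_. v) f z"])
    fix z assume z: "z \<in> \<Omega>"
    show "(f has_derivative (\<lambda>v. lie (\<lambda>_. v) f z)) (at z within \<Omega>)"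
      using has_derivative_at_withinI[OF smooth_on_has_derivative[OF assms(1,3) z]] by (simp only: lie_def)
    show "onorm (\<lambda>v. lie (\<lambda>_. v) f z) \<le> real CARD('n) * K"
    proof (rule onorm_bound)
      show "norm (lie (\<lambda>_. v) f z) \<le> real CARD('n) * K * norm v" for v
        unfolding real_norm_def by (rule abs_lie_const_le[OF K[OF z]])
    qed (use K0 in simp)
  qed
  then show ?thesis by (simp only: real_norm_def)
qed

text \<open>The mean value inequality is used twice: for the first partial derivatives, and for
  \<open>f\<close> with its linear part at \<open>x\<close> removed.\<close>

lemma smooth_on_quadratic:
  fixes f :: "real^'n::finite \<Rightarrow> real"
  assumes op: "open \<Omega>" and cv: "convex \<Omega>" and f: "smooth_on \<Omega> f"
    and K: "\<And>i j x. x \<in> \<Omega> \<Longrightarrow> \<bar>pd [i, j] f x\<bar> \<le> K" and xy: "x \<in> \<Omega>" "y \<in> \<Omega>"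
  shows "\<bar>f y - f x - lie (\<lambda>_. y - x) f x\<bar> \<le> (real CARD('n))\<^sup>2 * K * (norm (y - x))\<^sup>2"
proof -
  have K0: "K \<ge> 0" using K[OF xy(1)] by (rule order_trans[OF abs_ge_zero])
  have lip: "\<bar>pd [i] f z - pd [i] f x\<bar> \<le> real CARD('n) * K * norm (z - x)" if "z \<in> \<Omega>" for i z
    by (rule smooth_on_mean_value[OF op cv smooth_on_pd[OF f] _ that xy(1)])
      (use K in \<open>simp add: pd_append[symmetric]\<close>)
  let ?S = "closed_segment x y"
  have S: "?S \<subseteq> \<Omega>" using cv xy by (simp add: closed_segment_subset)
  define h where "h z = f z - lie (\<lambda>_. z) f x" for z
  have lin: "lie (\<lambda>_. a) f z - lie (\<lambda>_. b) f z = lie (\<lambda>_. a - b) f z" for a b z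
    by (simp add: lie_def algebra_simps sum_subtractf)
  have bl: "bounded_linear (\<lambda>v. lie (\<lambda>_. v) f x)"
    unfolding lie_def by (intro linear_conv_bounded_linear[THEN iffD1] linearI)
        (simp_all add: algebra_simps sum.distrib sum_distrib_left)
  have "norm (h y - h x) \<le> ((real CARD('n))\<^sup>2 * K * norm (y - x)) * norm (y - x)"
  proof (rule differentiable_bound[of ?S])
    fix z assume z: "z \<in> ?S"
    show "(h has_derivative (\<lambda>v. lie (\<lambda>_. v) f z - lie (\<lambda>_. v) f x)) (at z within ?S)"
      unfolding h_def
      using smooth_on_has_derivative[OF op f, of z] z S bounded_linear.has_derivative[OF bl has_derivative_ident]
      by (intro has_derivative_diff) (auto simp: lie_def intro: has_derivative_at_withinI)
    show "onorm (\<lambda>v. lie (\<lambda>_. v) f z - lie (\<lambda>_. v) f x) \<le> (real CARD('n))\<^sup>2 * K * norm (y - x)"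
    proof (rule onorm_bound)
      fix v
      have zx: "norm (z - x) \<le> norm (y - x)" using z by (metis segment_bound1)
      have d: "\<bar>pd [i] f z - pd [i] f x\<bar> \<le> real CARD('n) * K * norm (y - x)" for i
      proof -
        have "\<bar>pd [i] f z - pd [i] f x\<bar> \<le> real CARD('n) * K * norm (z - x)" using lip z S by blast
        also have "\<dots> \<le> real CARD('n) * K * norm (y - x)" by (intro mult_left_mono zx) (use K0 in simp)
        finally show ?thesis .
      qed
      have "\<bar>lie (\<lambda>_. v) f z - lie (\<lambda>_. v) f x\<bar> = \<bar>\<Sum>i\<in>UNIV. v $ i * (pd [i] f z - pd [i] f x)\<bar>"
        by (simp add: lie_def algebra_simps sum_subtractf)
      also have "\<dots> \<le> (\<Sum>i\<in>(UNIV::'n set). norm v * (real CARD('n) * K * norm (y - x)))"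
        using component_le_norm_cart[of v] d
        by (intro order_trans[OF sum_abs] sum_mono) (auto simp: abs_mult intro!: mult_mono)
      finally show "norm (lie (\<lambda>_. v) f z - lie (\<lambda>_. v) f x) \<le> (real CARD('n))\<^sup>2 * K * norm (y - x) * norm v"
        by (simp add: power2_eq_square algebra_simps)
    qed (use K0 in auto)
  qed auto
  moreover have "h y - h x = f y - f x - lie (\<lambda>_. y - x) f x"
    by (simp add: h_def lin[symmetric])
  ultimately show ?thesis by (simp add: power2_eq_square algebra_simps)
qed

lemma class_bound_imp_bounded:
  assumes "class_bound \<mu> K f" shows "\<exists>C. \<forall>x\<in>K. \<bar>pd ks f x\<bar> \<le> C"
proof -
  obtain C h where "\<And>x N. x \<in> K \<Longrightarrow> pd_bound N x f (\<lambda>k. C * fact k * (h ^ k * \<mu> k))"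
    using assms unfolding class_bound_def by auto
  then have "\<bar>pd ks f x\<bar> \<le> C * fact (length ks) * (h ^ length ks * \<mu> (length ks))" if "x \<in> K" for x
    using that unfolding pd_bound_def by auto
  then show ?thesis by auto
qed

section \<open>Linear combinations of the frame fields and their uniform bounds\<close>

context nagano_frame
begin

definition V :: "real^'n \<Rightarrow> real^'n \<Rightarrow> real^'n" where
  "V t x = (\<Sum>i\<in>UNIV. t $ i *\<^sub>R X i x)"

lemma V_nth: "V t x $ l = (\<Sum>i\<in>UNIV. t $ i * X i x $ l)"
  by (simp add: V_def)

lemma V_add: "V (s + t) x = V s x + V t x"
  by (simp add: V_def algebra_simps sum.distrib)

lemma V_unif: "unif_M M B (\<lambda>x. V t x $ l)"
  unfolding V_nth by (intro unif_M_sum unif_M_mult unif_M_const X_unif open_ball)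

lemma lie_V: "lie (V t) u x = (\<Sum>i\<in>UNIV. t $ i * lie (X i) u x)"
proof -
  have "lie (V t) u x = (\<Sum>j\<in>UNIV. \<Sum>i\<in>UNIV. t $ i * (X i x $ j * pd [j] u x))"
    unfolding lie_def V_nth by (simp only: sum_distrib_right mult.assoc)
  also have "\<dots> = (\<Sum>i\<in>UNIV. \<Sum>j\<in>UNIV. t $ i * (X i x $ j * pd [j] u x))" by (rule sum.swap)
  finally show ?thesis by (simp only: lie_def sum_distrib_left)
qed

lemma lie_V_nth:
  assumes "x \<in> B" shows "lie W (\<lambda>y. V t y $ l) x = (\<Sum>i\<in>UNIV. t $ i * lie W (\<lambda>y. X i y $ l) x)"
proof -
  have "pd [k] (\<lambda>y. V t y $ l) x = (\<Sum>i\<in>UNIV. t $ i * pd [k] (\<lambda>y. X i y $ l) x)" for k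
    unfolding V_nth
    by (subst pd_sum[OF open_ball _ assms])
      (auto intro!: smooth_on_mult X_smooth simp: pd1_mult[OF smooth_on_const[OF open_ball] X_smooth assms] pd_const)
  then show ?thesis unfolding lie_def
    by (simp add: sum_distrib_left mult.left_commute) (rule sum.swap)
qed

lemma V_commute:
  assumes "p \<in> leaf" shows "lie (V s) (\<lambda>x. V t x $ l) p = lie (V t) (\<lambda>x. V s x $ l) p"
proof -
  have pB: "p \<in> B" using assms by (simp add: leaf_def)
  show ?thesis
    unfolding lie_V lie_V_nth[OF pB] sum_distrib_left
    by (subst sum.swap) (simp add: X_commute[OF assms] mult.left_commute)
qed

lemma lie_V_J: "u \<in> J \<Longrightarrow> lie (V t) u \<in> J"
  unfolding lie_V[abs_def] by (intro J_sum J_mult lie_J unif_M_const open_ball)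

lemma exists_V_bounds:
  obtains L where "L > 0"
    "\<And>t x. x \<in> B \<Longrightarrow> norm (V t x) \<le> L * norm t"
    "\<And>t x y. x \<in> B \<Longrightarrow> y \<in> B \<Longrightarrow> norm (V t x - V t y) \<le> L * norm t * norm (x - y)"
    "\<And>t x v. x \<in> B \<Longrightarrow> norm (deriv_at (V t) x v) \<le> L * norm t * norm v"
    "\<And>t x y. x \<in> B \<Longrightarrow> y \<in> B \<Longrightarrow> norm (V t y - V t x - deriv_at (V t) x (y - x)) \<le> L * norm t * (norm (y - x))\<^sup>2"
proof -
  have "\<forall>i j ks. \<exists>C. \<forall>x\<in>B. \<bar>pd ks (\<lambda>x. X i x $ j) x\<bar> \<le> C"
    using X_unif unfolding unif_M_def by (blast intro: class_bound_imp_bounded)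
  then obtain C where C: "\<And>i j ks x. x \<in> B \<Longrightarrow> \<bar>pd ks (\<lambda>x. X i x $ j) x\<bar> \<le> C i j ks" by metis
  \<comment> \<open>All derivatives of orders zero, one and two, to be bounded by the single
    constant \<open>K\<close>.\<close>
  define A where "A = insert [] (range (\<lambda>k. [k]) \<union> range (\<lambda>(k, l). [k, l]) :: 'n list set)"
  have finA: "finite A" by (simp add: A_def)
  define K where "K = 1 + (\<Sum>(i, j, ks)\<in>UNIV \<times> UNIV \<times> A. \<bar>C i j ks\<bar>)"
  have K1: "K \<ge> 1" unfolding K_def by (simp add: sum_nonneg split_beta)
  have K: "\<bar>pd ks (\<lambda>x. X i x $ j) x\<bar> \<le> K" if "x \<in> B" "ks \<in> A" for i j ks x
  proof -
    have "\<bar>C i j ks\<bar> \<le> (\<Sum>(i, j, ks)\<in>UNIV \<times> UNIV \<times> A. \<bar>C i j ks\<bar>)"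
      using member_le_sum[of "(i, j, ks)" "UNIV \<times> UNIV \<times> A" "\<lambda>(i, j, ks). \<bar>C i j ks\<bar>"] finA that by auto
    then show ?thesis using C[OF that(1), of ks i j] by (simp add: K_def)
  qed
  have mem: "[] \<in> A" "[k] \<in> A" "[k, l] \<in> A" for k l by (auto simp: A_def)
  let ?n = "real CARD('n)"
  have n1: "?n \<ge> 1" by (simp add: Suc_le_eq)
  have bnd: "norm (\<Sum>i\<in>UNIV. t $ i *\<^sub>R a i) \<le> ?n * (?n * c) * norm t"
    if "\<And>i l. \<bar>a i $ l\<bar> \<le> c" for a :: "'n \<Rightarrow> real^'n" and t :: "real^'n" and c
  proof -
    have "\<bar>(\<Sum>i\<in>UNIV. t $ i *\<^sub>R a i) $ l\<bar> \<le> (\<Sum>i\<in>(UNIV::'n set). norm t * c)" for l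
      unfolding sum_component using component_le_norm_cart[of t] that
      by (intro order_trans[OF sum_abs] sum_mono) (auto simp: abs_mult intro!: mult_mono)
    then have "\<bar>(\<Sum>i\<in>UNIV. t $ i *\<^sub>R a i) $ l\<bar> \<le> ?n * (norm t * c)" for l by simp
    from norm_le_card_max[OF this] show ?thesis by (simp add: algebra_simps)
  qed
  \<comment> \<open>The size needed for the quadratic estimate, which also dominates the constants
    of the other three.\<close>
  define L where "L = ?n * (?n * (?n\<^sup>2 * K))"
  have L0: "L > 0" using n1 K1 by (simp add: L_def)
  have Lge: "?n * (?n * K) \<le> L" "?n * (?n * (?n * K)) \<le> L"
  proof -
    have nn: "1 \<le> ?n * ?n" using mult_mono[OF n1 n1] by simp
    have "(?n * (?n * K)) * 1 \<le> (?n * (?n * K)) * (?n * ?n)"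
      using n1 K1 nn by (intro mult_left_mono) auto
    then show "?n * (?n * K) \<le> L" by (simp add: L_def power2_eq_square mult_ac)
    have "(?n * (?n * (?n * K))) * 1 \<le> (?n * (?n * (?n * K))) * ?n"
      using n1 K1 by (intro mult_left_mono) auto
    then show "?n * (?n * (?n * K)) \<le> L" by (simp add: L_def power2_eq_square mult_ac)
  qed
  show ?thesis
  proof (rule that[OF L0])
    fix t x assume x: "x \<in> B"
    have "norm (V t x) \<le> ?n * (?n * K) * norm t"
      unfolding V_def by (rule bnd) (use K[OF x mem(1)] in simp)
    also have "\<dots> \<le> L * norm t" using Lge by (intro mult_right_mono) auto
    finally show "norm (V t x) \<le> L * norm t" .
    fix v
    have "deriv_at (V t) x v = (\<Sum>i\<in>UNIV. t $ i *\<^sub>R deriv_at (X i) x v)"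
      by (simp add: vec_eq_iff deriv_at_def lie_V_nth[OF x])
    also have "norm \<dots> \<le> ?n * (?n * (?n * K * norm v)) * norm t"
      by (rule bnd) (use abs_lie_const_le[OF K[OF x mem(2)]] in \<open>simp add: deriv_at_def\<close>)
    also have "\<dots> = (?n * (?n * (?n * K))) * (norm t * norm v)" by simp
    also have "\<dots> \<le> L * (norm t * norm v)" using Lge by (intro mult_right_mono) auto
    finally show "norm (deriv_at (V t) x v) \<le> L * norm t * norm v" by (simp add: mult.assoc)
  next
    fix t x y assume x: "x \<in> B" and y: "y \<in> B"
    have "V t x - V t y = (\<Sum>i\<in>UNIV. t $ i *\<^sub>R (X i x - X i y))"
      by (simp add: V_def algebra_simps sum_subtractf)
    also have "norm \<dots> \<le> ?n * (?n * (?n * K * norm (x - y))) * norm t"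
      by (rule bnd) (use smooth_on_mean_value[OF open_ball convex_ball X_smooth K[OF _ mem(2)] x y] in simp)
    also have "\<dots> = (?n * (?n * (?n * K))) * (norm t * norm (x - y))" by simp
    also have "\<dots> \<le> L * (norm t * norm (x - y))" using Lge by (intro mult_right_mono) auto
    finally show "norm (V t x - V t y) \<le> L * norm t * norm (x - y)" by (simp add: mult.assoc)
    have "V t y - V t x - deriv_at (V t) x (y - x)
       = (\<Sum>i\<in>UNIV. t $ i *\<^sub>R (X i y - X i x - deriv_at (X i) x (y - x)))"
      by (simp add: vec_eq_iff deriv_at_def lie_V_nth[OF x]) (simp add: V_nth algebra_simps sum_subtractf sum.distrib)
    also have "norm \<dots> \<le> ?n * (?n * (?n\<^sup>2 * K * (norm (y - x))\<^sup>2)) * norm t"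
      by (rule bnd) (use smooth_on_quadratic[OF open_ball convex_ball X_smooth K[OF _ mem(3)] x y] in \<open>simp add: deriv_at_def\<close>)
    also have "\<dots> = L * norm t * (norm (y - x))\<^sup>2" by (simp add: L_def)
    finally show "norm (V t y - V t x - deriv_at (V t) x (y - x)) \<le> L * norm t * (norm (y - x))\<^sup>2" .
  qed
qed

end

section \<open>The leaf through the base point\<close>

text \<open>Time is fixed to the unit interval and the parameter \<open>t\<close> is small instead:
  \<open>L * r \<le> 1/2\<close> supplies the constant for the contraction and for
  \<open>half_gronwall\<close>, and \<open>L * r \<le> R/2\<close> keeps the curves in half the
  ball.\<close>

locale nagano_flow = nagano_frame M U p0 g S \<delta> Y R \<epsilon>
  for M :: "nat \<Rightarrow> real" and U :: "(real^'n::finite) set" and p0 :: "real^'n" and g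
    and S :: "'n set" and \<delta> :: "real^'n \<Rightarrow> real" and Y :: "'n \<Rightarrow> real^'n \<Rightarrow> real^'n" and R \<epsilon> +
  fixes L r :: real
  assumes L: "L > 0"
    and V_le: "\<And>t x. x \<in> B \<Longrightarrow> norm (V t x) \<le> L * norm t"
    and V_lip: "\<And>t x y. x \<in> B \<Longrightarrow> y \<in> B \<Longrightarrow> norm (V t x - V t y) \<le> L * norm t * norm (x - y)"
    and DV_le: "\<And>t x v. x \<in> B \<Longrightarrow> norm (deriv_at (V t) x v) \<le> L * norm t * norm v"
    and V_quad: "\<And>t x y. x \<in> B \<Longrightarrow> y \<in> B \<Longrightarrow>
      norm (V t y - V t x - deriv_at (V t) x (y - x)) \<le> L * norm t * (norm (y - x))\<^sup>2"
    and r: "r > 0" "L * r \<le> 1/2" "L * r \<le> R/2"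
begin

definition is_flow :: "real^'n \<Rightarrow> (real \<Rightarrow> real^'n) \<Rightarrow> bool" where
  "is_flow t \<gamma> \<longleftrightarrow> \<gamma> 0 = p0 \<and> continuous_on {0..1} \<gamma> \<and> (\<forall>s\<in>{0..1}. \<gamma> s \<in> B) \<and>
     (\<forall>s. 0 < s \<and> s < 1 \<longrightarrow> (\<gamma> has_vector_derivative V t (\<gamma> s)) (at s))"

lemma Lt: "norm t < r \<Longrightarrow> L * norm t \<le> 1/2" "norm t < r \<Longrightarrow> L * norm t \<le> R/2"
proof -
  have "L * norm t \<le> L * r" if "norm t < r" using that L by (intro mult_left_mono) auto
  then show "norm t < r \<Longrightarrow> L * norm t \<le> 1/2" "norm t < r \<Longrightarrow> L * norm t \<le> R/2" using r by linarith+
qed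

text \<open>Composing the field with the nearest-point projection onto the half ball, which is
  nonexpansive, makes it globally Lipschitz. The speed bound then shows that the curve never leaves
  the half ball, where the projection is the identity.\<close>

lemma is_flow_exists:
  assumes t: "norm t < r" shows "\<exists>\<gamma>. is_flow t \<gamma>"
proof -
  let ?C = "cball p0 (R/2)"
  have C: "closed ?C" "convex ?C" "?C \<noteq> {}" "?C \<subseteq> B" using R by auto
  define f where "f x = V t (closest_point ?C x)" for x
  have cB: "closest_point ?C x \<in> B" for x using closest_point_in_set[OF C(1,3)] C(4) by blast
  have "norm (f x - f y) \<le> 1/2 * norm (x - y)" for x y
  proof -
    have "norm (f x - f y) \<le> L * norm t * norm (closest_point ?C x - closest_point ?C y)"
      unfolding f_def by (rule V_lip[OF cB cB])
    also have "\<dots> \<le> 1/2 * norm (x - y)"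
      using closest_point_lipschitz[OF C(2,1,3), of x y] Lt[OF t] L
      by (intro mult_mono) (auto simp: dist_norm)
    finally show ?thesis .
  qed
  from picard_unit_interval[OF this, of p0] obtain \<gamma> where \<gamma>: "\<gamma> 0 = p0" "continuous_on {0..1} \<gamma>"
    "\<And>s. 0 < s \<Longrightarrow> s < 1 \<Longrightarrow> (\<gamma> has_vector_derivative f (\<gamma> s)) (at s)" by metis
  have fle: "norm (f x) \<le> R/2" for x
    unfolding f_def using V_le[OF cB, of t] Lt(2)[OF t] by (rule order_trans)
  have in_C: "\<gamma> s \<in> ?C" if s: "s \<in> {0..1}" for s
  proof (cases "s = 0")
    case False
    then have "0 < s" using s by simp
    then have "norm (\<gamma> s - \<gamma> 0) \<le> R/2 * s - R/2 * 0"
    proof (rule differentiable_bound_general)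
      show "continuous_on {0..s} \<gamma>" using s by (intro continuous_on_subset[OF \<gamma>(2)]) auto
      show "continuous_on {0..s} (\<lambda>s. R/2 * s)" by (intro continuous_intros)
      fix u assume u: "0 < u" "u < s"
      show "(\<gamma> has_vector_derivative f (\<gamma> u)) (at u)" using \<gamma>(3) u s by simp
      show "((\<lambda>s. R/2 * s) has_vector_derivative R/2) (at u)"
        unfolding has_real_derivative_iff_has_vector_derivative[symmetric] by (auto intro!: derivative_eq_intros)
      show "norm (f (\<gamma> u)) \<le> R/2" by (rule fle)
    qed
    also have "\<dots> \<le> R/2 * 1 - R/2 * 0" using s R by (intro diff_mono mult_left_mono) auto
    finally show ?thesis using \<gamma>(1) by (simp add: dist_norm norm_minus_commute)
  qed (use \<gamma>(1) R in simp)
  have "is_flow t \<gamma>"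
    unfolding is_flow_def
  proof (intro conjI ballI allI impI)
    show "\<gamma> s \<in> B" if "s \<in> {0..1}" for s using in_C[OF that] C(4) by blast
    fix s :: real assume s: "0 < s \<and> s < 1"
    have "f (\<gamma> s) = V t (\<gamma> s)" using in_C[of s] s by (simp add: f_def closest_point_self)
    then show "(\<gamma> has_vector_derivative V t (\<gamma> s)) (at s)" using \<gamma>(3)[of s] s by simp
  qed (use \<gamma> in auto)
  then show ?thesis by blast
qed

definition flow :: "real^'n \<Rightarrow> real \<Rightarrow> real^'n" where
  "flow t = (SOME \<gamma>. is_flow t \<gamma>)"

lemma flow:
  assumes "norm t < r"
  shows "flow t 0 = p0" "continuous_on {0..1} (flow t)" "s \<in> {0..1} \<Longrightarrow> flow t s \<in> B"
    "0 < s \<Longrightarrow> s < 1 \<Longrightarrow> (flow t has_vector_derivative V t (flow t s)) (at s)"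
proof -
  have "is_flow t (flow t)" unfolding flow_def using is_flow_exists[OF assms] by (rule someI_ex)
  then show "flow t 0 = p0" "continuous_on {0..1} (flow t)" "s \<in> {0..1} \<Longrightarrow> flow t s \<in> B"
    "0 < s \<Longrightarrow> s < 1 \<Longrightarrow> (flow t has_vector_derivative V t (flow t s)) (at s)"
    unfolding is_flow_def by auto
qed

lemma V_nth_S:
  assumes "l \<in> S" "x \<in> B" shows "V t x $ l = t $ l"
proof -
  have "V t x $ l = (\<Sum>i\<in>UNIV. if i = l then t $ i else 0)"
    unfolding V_nth by (intro sum.cong refl) (simp add: X_nth[OF assms])
  then show ?thesis by simp
qed

text \<open>On these coordinates the field is constant. The end points at time one therefore have
  prescribed \<open>S\<close>-coordinates, which makes them a graph.\<close>

lemma flow_nth_S: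
  assumes t: "norm t < r" and l: "l \<in> S" and s: "s \<in> {0..1}"
  shows "flow t s $ l = p0 $ l + s * t $ l"
proof -
  have "norm (flow t s $ l - p0 $ l - s * t $ l) \<le> 2 * 0"
  proof (rule half_gronwall[where z' = "\<lambda>_. 0", OF _ _ _ _ s])
    show "continuous_on {0..1} (\<lambda>s. flow t s $ l - p0 $ l - s * t $ l)"
      by (intro continuous_intros flow(2)[OF t])
    show "flow t 0 $ l - p0 $ l - 0 * t $ l = 0" by (simp add: flow(1)[OF t])
    fix s :: real assume s: "0 < s" "s < 1"
    have "((\<lambda>s. flow t s $ l) has_vector_derivative V t (flow t s) $ l) (at s)"
      using bounded_linear.has_vector_derivative[OF bounded_linear_vec_nth flow(4)[OF t s]] .
    then have "((\<lambda>s. flow t s $ l) has_real_derivative t $ l) (at s)"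
      using V_nth_S[OF l flow(3)[OF t]] s by (simp add: has_real_derivative_iff_has_vector_derivative)
    then have "((\<lambda>s. flow t s $ l - p0 $ l - s * t $ l) has_real_derivative 0) (at s)"
      by (auto intro!: derivative_eq_intros)
    then show "((\<lambda>s. flow t s $ l - p0 $ l - s * t $ l) has_vector_derivative 0) (at s)"
      by (simp add: has_real_derivative_iff_has_vector_derivative)
  qed auto
  then show ?thesis by simp
qed

text \<open>Members of \<open>J\<close> are flat at \<open>p0\<close> along the flow, and their derivatives along it are iterated Lie
  derivatives, hence bounded by \<open>M\<close>; so quasianalyticity applies.\<close>

lemma flow_leaf:
  assumes t: "norm t < r" and s: "s \<in> {0..1}"
  shows "flow t s \<in> leaf"
  unfolding leaf_def
proof (intro CollectI conjI ballI)
  show "flow t s \<in> B" by (rule flow(3)[OF t s])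
  fix u assume u: "u \<in> J"
  \<comment> \<open>The index type \<open>unit\<close> turns words into powers of the single field
    \<open>V t\<close>.\<close>
  let ?X = "\<lambda>_::unit. V t"
  let ?u = "\<lambda>k. lies ?X (replicate k ()) u"
  have uJ: "?u k \<in> J" for k by (induction k) (simp_all add: u lie_V_J)
  have "\<exists>C>0. \<exists>h>0. \<forall>w. \<forall>x\<in>B. \<bar>lies ?X w u x\<bar> \<le> C * fact (length w) * (h ^ length w * small_m M (length w))"
    using V_unif J_unif[OF u] unfolding unif_M_def
    by (intro class_bound_lies[OF smult open_ball order_refl]) auto
  then obtain C h where Ch: "C > 0" "h > 0"
    "\<And>w x. x \<in> B \<Longrightarrow> \<bar>lies ?X w u x\<bar> \<le> C * fact (length w) * (h ^ length w * small_m M (length w))"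
    by blast
  \<comment> \<open>The constants are absorbed into the sequence; its ratios change by the factor
    \<open>h\<close>, which preserves both monotonicity and divergence.\<close>
  define N where "N k = C * h ^ k * M k" for k
  have Mpos: "M k > 0" for k using weight_seq by (simp add: weight_seq_def)
  have N: "N k = C * fact k * (h ^ k * small_m M k)" for k by (simp add: N_def small_m_def)
  have "?u 0 (flow t s) = 0"
  proof (rule denjoy_carleman_flat[where M = N and F = "\<lambda>k s. ?u k (flow t s)", OF _ _ _ _ _ _ _ s])
    show "N k > 0" for k using Ch Mpos by (simp add: N_def)
    have eq: "N (Suc k) / N k = h * (M (Suc k) / M k)" for k using Ch by (simp add: N_def)
    show "mono (\<lambda>k. N (Suc k) / N k)"
      unfolding mono_def eq using monoD[OF weight_seq_mono[OF weight_seq]] Ch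
      by (auto intro!: mult_left_mono simp del: times_divide_eq_right)
    have "(\<lambda>k. M k / M (Suc k)) = (\<lambda>k. h * (N k / N (Suc k)))" using Ch by (simp add: N_def fun_eq_iff)
    then show "\<not> summable (\<lambda>k. N k / N (Suc k))"
      using quasi summable_mult[of "\<lambda>k. N k / N (Suc k)" h] unfolding quasianalytic_def by auto
  next
    fix k and a :: real assume a: "0 < a" "a < 1"
    have "((\<lambda>s. ?u k (flow t s)) has_real_derivative lie (\<lambda>_. V t (flow t a)) (?u k) (flow t a)) (at a)"
      by (rule smooth_on_chain[OF open_ball unif_smooth[OF J_unif[OF uJ]] flow(4)[OF t a] flow(3)[OF t]])
        (use a in auto)
    then show "((\<lambda>s. ?u k (flow t s)) has_real_derivative ?u (Suc k) (flow t a)) (at a)"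
      by (simp add: lie_def)
  next
    show "continuous_on {0..1} (\<lambda>s. ?u k (flow t s))" for k
      by (rule continuous_on_compose2[OF smooth_on_continuous0[OF unif_smooth[OF J_unif[OF uJ]]] flow(2)[OF t]])
        (use flow(3)[OF t] in auto)
    show "\<bar>?u k (flow t a)\<bar> \<le> N k" if "a \<in> {0..1}" for k a
      using Ch(3)[OF flow(3)[OF t that], of "replicate k ()"] by (simp add: N)
    show "?u k (flow t 0) = 0" for k by (simp add: flow(1)[OF t] J_p0[OF uJ])
  qed
  then show "u (flow t s) = 0" by simp
qed

lemma deriv_at_add: "deriv_at F x (v + w) = deriv_at F x v + deriv_at F x w"
  by (simp add: vec_eq_iff deriv_at_def lie_def algebra_simps sum.distrib)

lemma deriv_at_scaleR: "deriv_at F x (c *\<^sub>R v) = c *\<^sub>R deriv_at F x v"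
  by (simp add: vec_eq_iff deriv_at_def lie_def algebra_simps sum_distrib_left)

lemma deriv_at_V_commute:
  assumes "p \<in> leaf" shows "deriv_at (V t) p (V e p) = deriv_at (V e) p (V t p)"
  using V_commute[OF assms, of t e] by (simp add: vec_eq_iff lie_eq_deriv_at[symmetric])

text \<open>First-order dependence on the parameter, used to make the remainder terms of the next
  estimate quadratic in \<open>e\<close>.\<close>

lemma flow_diff_le:
  assumes t: "norm t < r" and te: "norm (t + e) < r" and s: "s \<in> {0..1}"
  shows "norm (flow (t + e) s - flow t s) \<le> 2 * (L * norm e)"
proof (rule half_gronwall[where z' = "\<lambda>s. V (t + e) (flow (t + e) s) - V t (flow t s)", OF _ _ _ _ s])
  show "continuous_on {0..1} (\<lambda>s. flow (t + e) s - flow t s)"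
    by (intro continuous_intros flow(2) t te)
  fix s :: real assume s: "0 < s" "s < 1"
  show "((\<lambda>s. flow (t + e) s - flow t s) has_vector_derivative
      V (t + e) (flow (t + e) s) - V t (flow t s)) (at s)"
    by (intro has_vector_derivative_diff flow(4) t te s)
  have B: "flow t s \<in> B" "flow (t + e) s \<in> B" using flow(3)[OF t] flow(3)[OF te] s by auto
  have "norm (V (t + e) (flow (t + e) s) - V t (flow t s))
      = norm ((V t (flow (t + e) s) - V t (flow t s)) + V e (flow (t + e) s))"
    by (simp add: V_add algebra_simps)
  also have "\<dots> \<le> L * norm t * norm (flow (t + e) s - flow t s) + L * norm e"
    by (intro order_trans[OF norm_triangle_ineq] add_mono V_lip V_le B)
  also have "\<dots> \<le> 1/2 * norm (flow (t + e) s - flow t s) + L * norm e"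
    using Lt(1)[OF t] by (intro add_mono mult_right_mono) auto
  finally show "norm (V (t + e) (flow (t + e) s) - V t (flow t s))
    \<le> 1/2 * norm (flow (t + e) s - flow t s) + L * norm e" .
qed (use flow(1)[OF t] flow(1)[OF te] L in auto)

text \<open>The vector \<open>s *\<^sub>R V e (flow t s)\<close> is an approximate solution of the variational equation because
  the fields \<open>V t\<close> and \<open>V e\<close> commute on the leaf.\<close>

lemma flow_second_order:
  assumes t: "norm t < r" and te: "norm (t + e) < r"
  shows "norm (flow (t + e) 1 - flow t 1 - V e (flow t 1)) \<le> (8 * L\<^sup>2 * (norm e)\<^sup>2)"
proof -
  let ?a = "flow t" and ?b = "flow (t + e)"
  define z where "z s = ?b s - ?a s - s *\<^sub>R V e (?a s)" for s
  define z' where "z' s = V (t + e) (?b s) - V t (?a s)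
    - (V e (?a s) + s *\<^sub>R deriv_at (V e) (?a s) (V t (?a s)))" for s
  have "norm (z 1) \<le> 2 * (4 * L\<^sup>2 * (norm e)\<^sup>2)"
  proof (rule half_gronwall[where z' = z'])
    have "continuous_on {0..1} (\<lambda>s. V e (?a s) $ l)" for l
      by (rule continuous_on_compose2[OF smooth_on_continuous0[OF unif_smooth[OF V_unif]] flow(2)[OF t]])
        (use flow(3)[OF t] in auto)
    then have "continuous_on {0..1} (\<lambda>s. V e (?a s))"
      by (subst continuous_on_componentwise) (auto simp: Basis_vec_def inner_axis)
    then show "continuous_on {0..1} z"
      unfolding z_def[abs_def] by (intro continuous_intros flow(2) t te)
    show "z 0 = 0" by (simp add: z_def flow(1)[OF t] flow(1)[OF te])
  next
    fix s :: real assume s: "0 < s" "s < 1"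
    have B: "?a s \<in> B" "?b s \<in> B" using flow(3)[OF t] flow(3)[OF te] s by auto
    have leaf: "?a s \<in> leaf" using flow_leaf[OF t] s by simp
    have "((\<lambda>s. V e (?a s) $ l) has_vector_derivative deriv_at (V e) (?a s) (V t (?a s)) $ l) (at s)" for l
      using smooth_on_chain[OF open_ball unif_smooth[OF V_unif] flow(4)[OF t s] B(1), of e l]
      by (simp add: has_real_derivative_iff_has_vector_derivative deriv_at_def)
    then have dV: "((\<lambda>s. V e (?a s)) has_vector_derivative deriv_at (V e) (?a s) (V t (?a s))) (at s)"
      unfolding has_vector_derivative_def
      by (subst has_derivative_componentwise_within) (auto simp: Basis_vec_def inner_axis)
    have "((\<lambda>s. s *\<^sub>R V e (?a s)) has_vector_derivative s *\<^sub>R deriv_at (V e) (?a s) (V t (?a s)) + 1 *\<^sub>R V e (?a s)) (at s)"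
      by (rule has_vector_derivative_scaleR[OF _ dV]) (auto intro!: derivative_eq_intros)
    then show "(z has_vector_derivative z' s) (at s)"
      unfolding z_def[abs_def] z'_def
      by (intro has_vector_derivative_diff flow(4) t te s) (simp add: add.commute)
    define y where "y = ?b s - ?a s"
    have yz: "y = z s + s *\<^sub>R V e (?a s)" by (simp add: y_def z_def)
    have y: "norm y \<le> 2 * (L * norm e)" unfolding y_def using flow_diff_le[OF t te] s by simp
    \<comment> \<open>Commutation on the zero set enters here: differentiating \<open>V t\<close> in
      the direction \<open>V e\<close> cancels the transport of \<open>V e\<close> along the
      curve.\<close>
    have "deriv_at (V t) (?a s) y = deriv_at (V t) (?a s) (z s) + s *\<^sub>R deriv_at (V e) (?a s) (V t (?a s))"
      unfolding yz deriv_at_add deriv_at_scaleR deriv_at_V_commute[OF leaf] ..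
    then have "z' s = (V t (?b s) - V t (?a s) - deriv_at (V t) (?a s) (?b s - ?a s))
       + (deriv_at (V t) (?a s) (z s) + (V e (?b s) - V e (?a s)))"
      unfolding z'_def y_def[symmetric] by (simp add: V_add algebra_simps)
    also have "norm \<dots> \<le> L * norm t * (norm y)\<^sup>2 + (L * norm t * norm (z s) + L * norm e * norm y)"
      unfolding y_def
      by (intro order_trans[OF norm_triangle_ineq] add_mono V_quad DV_le V_lip B order_refl)
    \<comment> \<open>The Taylor remainder of \<open>V t\<close> and the variation of
      \<open>V e\<close> contribute 2 each to the constant 4; \<open>half_gronwall\<close> doubles
      it to 8.\<close>
    also have "\<dots> \<le> 1/2 * (2 * (L * norm e))\<^sup>2 + (1/2 * norm (z s) + L * norm e * (2 * (L * norm e)))"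
      using Lt(1)[OF t] y L by (intro add_mono mult_mono power_mono mult_nonneg_nonneg) auto
    also have "\<dots> = 1/2 * norm (z s) + 4 * L\<^sup>2 * (norm e)\<^sup>2"
      by (simp add: power2_eq_square)
    finally show "norm (z' s) \<le> 1/2 * norm (z s) + 4 * L\<^sup>2 * (norm e)\<^sup>2" .
  qed auto
  then show ?thesis by (simp add: z_def)
qed

text \<open>An open cylinder of the full space carries \<open>G\<close>, which is constant in the
  directions outside \<open>S\<close>; thus \<open>pd\<close> and \<open>E_M\<close> apply to
  \<open>G\<close> directly.\<close>

definition cyl :: "(real^'n) set" where
  "cyl = {x. norm (proj_on S (x - p0)) < r}"

definition G :: "real^'n \<Rightarrow> real^'n" where
  "G x = flow (proj_on S (x - p0)) 1"

lemma bounded_linear_proj_on: "bounded_linear (proj_on S)"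
  by (simp add: linear_conv_bounded_linear[symmetric] linear_proj_on)

lemma open_cyl: "open cyl"
proof -
  have "continuous_on UNIV (\<lambda>x. norm (proj_on S (x - p0)))"
    by (intro continuous_intros bounded_linear.continuous_on[OF bounded_linear_proj_on])
  from open_Collect_less[OF this continuous_on_const, of r] show ?thesis by (simp add: cyl_def)
qed

lemma V_proj_on: "V (proj_on S t) x = V t x"
  unfolding V_def by (intro sum.cong refl) (simp add: X_def)

lemma G_leaf: "x \<in> cyl \<Longrightarrow> G x \<in> leaf"
  unfolding G_def cyl_def by (intro flow_leaf) auto

lemma leaf_B: "p \<in> leaf \<Longrightarrow> p \<in> B"
  by (simp add: leaf_def)

lemma G_nth_S:
  assumes "x \<in> cyl" "l \<in> S" shows "G x $ l = x $ l"
  using flow_nth_S[of "proj_on S (x - p0)" l 1] assms by (simp add: G_def cyl_def)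

lemma G_cong:
  assumes "\<And>l. l \<in> S \<Longrightarrow> x $ l = y $ l" shows "G x = G y" "x \<in> cyl \<longleftrightarrow> y \<in> cyl"
proof -
  have "proj_on S (x - p0) = proj_on S (y - p0)" using assms by (simp add: vec_eq_iff)
  then show "G x = G y" "x \<in> cyl \<longleftrightarrow> y \<in> cyl" by (simp_all add: G_def cyl_def)
qed

lemma p0_cyl: "p0 \<in> cyl"
proof -
  have "proj_on S 0 = 0" by (simp add: vec_eq_iff)
  then show ?thesis using r by (simp add: cyl_def)
qed

lemma G_p0: "G p0 = p0"
proof -
  have "proj_on S (p0 - p0) = 0" by (simp add: vec_eq_iff)
  moreover have "norm (flow 0 1 - p0) \<le> 2 * 0"
  proof (rule half_gronwall[where z = "\<lambda>s. flow 0 s - p0" and z' = "\<lambda>_. 0"])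
    have 0: "norm (0 :: real^'n) < r" using r by simp
    show "continuous_on {0..1} (\<lambda>s. flow 0 s - p0)" by (intro continuous_intros flow(2)[OF 0])
    show "flow 0 0 - p0 = 0" using flow(1)[OF 0] by simp
    fix s :: real assume s: "0 < s" "s < 1"
    have "((\<lambda>s. flow 0 s - p0) has_vector_derivative V 0 (flow 0 s) - 0) (at s)"
      by (intro has_vector_derivative_diff flow(4)[OF 0] s has_vector_derivative_const)
    then show "((\<lambda>s. flow 0 s - p0) has_vector_derivative 0) (at s)" by (simp add: V_def)
  qed auto
  ultimately show ?thesis by (simp add: G_def)
qed

lemma G_has_derivative:
  assumes x: "x \<in> cyl" shows "(G has_derivative (\<lambda>v. V v (G x))) (at x)"
proof -
  let ?t = "proj_on S (x - p0)"
  have t: "norm ?t < r" using x by (simp add: cyl_def)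
  obtain d where d: "d > 0" "ball x d \<subseteq> cyl" using open_cyl x open_contains_ball by blast
  have bl: "bounded_linear (\<lambda>v. V v (G x))"
    unfolding V_def by (intro linear_conv_bounded_linear[THEN iffD1] linearI)
      (simp_all add: algebra_simps sum.distrib scaleR_sum_right)
  show ?thesis
    unfolding has_derivative_at_alt
  proof (intro conjI allI impI bl)
    fix e :: real assume e: "0 < e"
    let ?c = "8 * L\<^sup>2 + 1"
    have c: "?c > 0" by (simp add: add_nonneg_pos)
    show "\<exists>d>0. \<forall>y. norm (y - x) < d \<longrightarrow> norm (G y - G x - V (y - x) (G x)) \<le> e * norm (y - x)"
    proof (intro exI[of _ "min d (e / ?c)"] conjI allI impI)
      show "0 < min d (e / ?c)" using d e c by simp
      fix y assume y: "norm (y - x) < min d (e / ?c)"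
      let ?e = "proj_on S (y - x)"
      have eq: "?t + ?e = proj_on S (y - p0)" by (simp add: vec_eq_iff)
      have "y \<in> cyl" using y d by (auto simp: dist_norm norm_minus_commute)
      then have te: "norm (?t + ?e) < r" unfolding eq by (simp add: cyl_def)
      have "norm (G y - G x - V (y - x) (G x)) \<le> 8 * L\<^sup>2 * (norm ?e)\<^sup>2"
        using flow_second_order[OF t te] unfolding eq V_proj_on G_def[symmetric] .
      also have "\<dots> \<le> ?c * (norm (y - x))\<^sup>2"
        using norm_proj_on[of S "y - x"] by (intro mult_mono power_mono) auto
      also have "\<dots> = (?c * norm (y - x)) * norm (y - x)" by (simp add: power2_eq_square)
      also have "\<dots> \<le> e * norm (y - x)"
        using y c by (intro mult_right_mono) (auto simp: field_simps)
      finally show "norm (G y - G x - V (y - x) (G x)) \<le> e * norm (y - x)" .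
    qed
  qed
qed

text \<open>Composition with \<open>G\<close> intertwines the coordinate derivative \<open>i\<close>
  with the Lie derivative along \<open>X i\<close>, also for \<open>i\<close> outside
  \<open>S\<close>, where both vanish.\<close>

lemma has_pd_G:
  assumes u: "smooth_on B u" and x: "x \<in> cyl"
  shows "has_pd i (\<lambda>x. u (G x)) x (lie (X i) u (G x))"
proof -
  have "((\<lambda>t. x + t *\<^sub>R axis i 1) has_vector_derivative axis i 1) (at (0::real))"
    by (auto intro!: derivative_eq_intros)
  then have "((\<lambda>t. G (x + t *\<^sub>R axis i 1)) has_vector_derivative V (axis i 1) (G x)) (at 0)"
    unfolding has_vector_derivative_def
    using has_derivative_compose[of "\<lambda>t. x + t *\<^sub>R axis i 1" "\<lambda>t. t *\<^sub>R axis i 1" 0 UNIV G "\<lambda>v. V v (G x)"] G_has_derivative[OF x]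
    by (simp add: V_def scaleR_sum_right)
  from smooth_on_chain[OF open_ball u this] G_leaf[OF x] leaf_B
  have "((\<lambda>t. u (G (x + t *\<^sub>R axis i 1))) has_real_derivative lie (\<lambda>_. V (axis i 1) (G x)) u (G x)) (at 0)"
    by simp
  moreover have "V (axis i 1) (G x) = X i (G x)"
    unfolding V_def axis_def by (simp add: if_distrib[of "\<lambda>a. a *\<^sub>R _"] cong: if_cong)
  ultimately show ?thesis unfolding has_pd_def by (simp add: lie_def)
qed

lemma continuous_on_G: "continuous_on cyl G"
  using G_has_derivative by (meson continuous_at_imp_continuous_on has_derivative_continuous)

lemma G_smooth:
  assumes u: "smooth_on B u" shows "smooth_on cyl (\<lambda>x. u (G x))"
proof (rule smooth_on_coinduct[OF open_cyl, where P = "\<lambda>f. \<exists>u. smooth_on B u \<and> f = (\<lambda>x. u (G x))"])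
  fix f i assume "\<exists>u. smooth_on B u \<and> f = (\<lambda>x. u (G x))"
  then obtain u where u: "smooth_on B u" "f = (\<lambda>x. u (G x))" by blast
  show "continuous_on cyl f"
    unfolding u(2) by (rule continuous_on_compose2[OF smooth_on_continuous0[OF u(1)] continuous_on_G])
      (use G_leaf leaf_B in auto)
  show "\<exists>d. (\<exists>u. smooth_on B u \<and> d = (\<lambda>x. u (G x))) \<and> (\<forall>x\<in>cyl. has_pd i f x (d x))"
    unfolding u(2) by (intro exI[of _ "\<lambda>x. lie (X i) u (G x)"] conjI ballI exI[of _ "lie (X i) u"] refl
      has_pd_G u(1) smooth_on_lie open_ball X_smooth)
qed (use u in blast)

lemma pd_G:
  assumes u: "smooth_on B u" and x: "x \<in> cyl"
  shows "pd ks (\<lambda>x. u (G x)) x = lies X ks u (G x)"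
  using x
proof (induction ks arbitrary: x)
  case (Cons i ks)
  have "has_pd i (\<lambda>x. lies X ks u (G x)) x (lie (X i) (lies X ks u) (G x))"
    by (intro has_pd_G Cons.prems smooth_on_lies open_ball X_smooth u)
  then have "has_pd i (pd ks (\<lambda>x. u (G x))) x (lie (X i) (lies X ks u) (G x))"
    by (rule has_pd_transform[OF open_cyl Cons.prems, rotated]) (simp add: Cons.IH)
  from has_pd_imp_pd[OF this] show ?case by (simp add: pd_append[of "[i]", simplified, symmetric])
qed simp

text \<open>The bounds for words of Lie derivatives of a coordinate function on the ball pass to the
  cylinder without a chain rule of higher order.\<close>

lemma G_E_M: "E_M M cyl (\<lambda>x. G x $ j)"
proof (rule unif_M_imp_E_M)
  have u: "unif_M M B (\<lambda>x. x $ j)" by (rule unif_M_coord) auto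
  have "\<exists>C>0. \<exists>h>0. \<forall>w. \<forall>x\<in>B. \<bar>lies X w (\<lambda>x. x $ j) x\<bar> \<le> C * fact (length w) * (h ^ length w * small_m M (length w))"
    using X_unif u unfolding unif_M_def
    by (intro class_bound_lies[OF smult open_ball order_refl]) auto
  then obtain C h where Ch: "C > 0" "h > 0"
    "\<And>w x. x \<in> B \<Longrightarrow> \<bar>lies X w (\<lambda>x. x $ j) x\<bar> \<le> C * fact (length w) * (h ^ length w * small_m M (length w))"
    by blast
  have "class_bound (small_m M) cyl (\<lambda>x. G x $ j)"
    by (rule class_boundI[OF Ch(1,2)])
      (auto simp: pd_bound_def pd_G[OF unif_smooth[OF u]] intro!: Ch(3) leaf_B G_leaf)
  then show "unif_M M cyl (\<lambda>x. G x $ j)"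
    using G_smooth[OF unif_smooth[OF u]] by (simp add: unif_M_def)
qed

end

section \<open>Slice charts and tangent spaces\<close>

lemma smooth_has_derivative_deriv_at:
  assumes "open \<Omega>" "\<And>j. smooth_on \<Omega> (\<lambda>x. F x $ j)" "x \<in> \<Omega>"
  shows "(F has_derivative deriv_at F x) (at x)"
proof -
  have "((\<lambda>y. F y $ j) has_derivative (\<lambda>v. deriv_at F x v $ j)) (at x)" for j
    using smooth_on_has_derivative[OF assms(1,2,3)] by (simp add: deriv_at_def lie_def)
  then show ?thesis
    by (subst has_derivative_componentwise_within) (auto simp: Basis_vec_def inner_axis)
qed

lemma map_M_has_derivative:
  "open \<Omega> \<Longrightarrow> map_M M \<Omega> F \<Longrightarrow> x \<in> \<Omega> \<Longrightarrow> (F has_derivative deriv_at F x) (at x)"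
  by (rule smooth_has_derivative_deriv_at) (auto simp: map_M_def E_M_def)

lemma has_derivative_curve:
  assumes "(F has_derivative F') (at (c s))" "(c has_vector_derivative v) (at s)"
  shows "((\<lambda>s. F (c s)) has_vector_derivative F' v) (at s)"
proof -
  have "((\<lambda>s. F (c s)) has_derivative (\<lambda>h. F' (h *\<^sub>R v))) (at s)"
    using has_derivative_compose[OF assms(2)[unfolded has_vector_derivative_def], of F F'] assms(1) by simp
  then show ?thesis
    using linear_scale[OF has_derivative_linear[OF assms(1)]] by (simp add: has_vector_derivative_def)
qed

lemma subspace_coord_subspace: "subspace (coord_subspace S)"
  by (auto simp: coord_subspace_def subspace_def)

lemma dim_coord_subspace: "dim (coord_subspace S :: (real^'n::finite) set) = card S"
proof -
  have "dim {x :: real^'n. \<forall>b\<in>Basis. b \<notin> (\<lambda>i. axis i 1) ` S \<longrightarrow> x \<bullet> b = 0} = card ((\<lambda>i. axis i (1::real)) ` S)"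
    by (rule dim_substandard) (auto simp: Basis_vec_def)
  also have "{x :: real^'n. \<forall>b\<in>Basis. b \<notin> (\<lambda>i. axis i 1) ` S \<longrightarrow> x \<bullet> b = 0} = coord_subspace S"
    by (auto simp: coord_subspace_def Basis_vec_def inner_axis axis_eq_axis)
  also have "card ((\<lambda>i. axis i (1::real) :: real^'n) ` S) = card S"
    by (rule card_image) (simp add: inj_on_def axis_eq_axis)
  finally show ?thesis .
qed

locale chart =
  fixes M :: "nat \<Rightarrow> real" and W V :: "(real^'n::finite) set" and \<Phi> \<Psi> and S :: "'n set"
  assumes chart: "slice_chart M W V \<Phi> \<Psi> S"
begin

lemma V: "open V" "open (\<Phi> ` V)" "x \<in> V \<Longrightarrow> \<Psi> (\<Phi> x) = x"
  "y \<in> \<Phi> ` V \<Longrightarrow> \<Phi> (\<Psi> y) = y" "y \<in> \<Phi> ` V \<Longrightarrow> \<Psi> y \<in> V"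
  using chart unfolding slice_chart_def by auto

lemma E_M_charts: "map_M M V \<Phi>" "map_M M (\<Phi> ` V) \<Psi>"
  using chart unfolding slice_chart_def by auto

lemma slice: "x \<in> V \<Longrightarrow> x \<in> W \<longleftrightarrow> \<Phi> x \<in> coord_subspace S"
proof -
  assume x: "x \<in> V"
  have eq: "\<Phi> ` (W \<inter> V) = \<Phi> ` V \<inter> coord_subspace S" using chart unfolding slice_chart_def by auto
  show ?thesis
  proof
    assume "x \<in> W" then show "\<Phi> x \<in> coord_subspace S" using x eq by blast
  next
    assume "\<Phi> x \<in> coord_subspace S"
    then have "\<Phi> x \<in> \<Phi> ` (W \<inter> V)" using x eq by blast
    then obtain y where "y \<in> W" "y \<in> V" "\<Phi> x = \<Phi> y" by blast
    then show "x \<in> W" using V(3) x by metis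
  qed
qed

lemma der_\<Phi>: "x \<in> V \<Longrightarrow> (\<Phi> has_derivative deriv_at \<Phi> x) (at x)"
  by (rule map_M_has_derivative[OF V(1) E_M_charts(1)])

lemma der_\<Psi>: "y \<in> \<Phi> ` V \<Longrightarrow> (\<Psi> has_derivative deriv_at \<Psi> y) (at y)"
  by (rule map_M_has_derivative[OF V(2) E_M_charts(2)])

lemma continuous_\<Phi>: "continuous_on V \<Phi>"
  by (rule continuous_at_imp_continuous_on, rule ballI, rule has_derivative_continuous, erule der_\<Phi>)

lemma continuous_\<Psi>: "continuous_on (\<Phi> ` V) \<Psi>"
  by (rule continuous_at_imp_continuous_on, rule ballI, rule has_derivative_continuous, erule der_\<Psi>)

lemma deriv_inverse:
  assumes x: "x \<in> V"
  shows "deriv_at \<Psi> (\<Phi> x) (deriv_at \<Phi> x v) = v" "deriv_at \<Phi> x (deriv_at \<Psi> (\<Phi> x) v) = v"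
proof -
  have y: "\<Phi> x \<in> \<Phi> ` V" using x by simp
  have "((\<lambda>x. \<Psi> (\<Phi> x)) has_derivative (\<lambda>v. deriv_at \<Psi> (\<Phi> x) (deriv_at \<Phi> x v))) (at x)"
    by (rule has_derivative_compose[OF der_\<Phi>[OF x] der_\<Psi>[OF y]])
  moreover have "((\<lambda>x. \<Psi> (\<Phi> x)) has_derivative (\<lambda>v. v)) (at x)"
    by (rule has_derivative_transform_within_open[OF has_derivative_ident V(1) x]) (simp add: V)
  ultimately show "deriv_at \<Psi> (\<Phi> x) (deriv_at \<Phi> x v) = v"
    using has_derivative_unique by metis
  have "((\<lambda>y. \<Phi> (\<Psi> y)) has_derivative (\<lambda>v. deriv_at \<Phi> x (deriv_at \<Psi> (\<Phi> x) v))) (at (\<Phi> x))"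
    by (rule has_derivative_compose[OF der_\<Psi>[OF y]]) (simp add: V x der_\<Phi>)
  moreover have "((\<lambda>y. \<Phi> (\<Psi> y)) has_derivative (\<lambda>v. v)) (at (\<Phi> x))"
    by (rule has_derivative_transform_within_open[OF has_derivative_ident V(2) y]) (use V(4) in simp)
  ultimately show "deriv_at \<Phi> x (deriv_at \<Psi> (\<Phi> x) v) = v"
    using has_derivative_unique by metis
qed

text \<open>In the chart the curve has vanishing components outside \<open>S\<close>, hence so has
  its velocity.\<close>

lemma curve_tangent:
  assumes c: "(c has_vector_derivative v) (at 0)" "c 0 \<in> V" and W: "\<forall>\<^sub>F s in nhds 0. c s \<in> W"
  shows "v \<in> deriv_at \<Psi> (\<Phi> (c 0)) ` coord_subspace S"
proof -
  let ?w = "deriv_at \<Phi> (c 0) v"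
  have "isCont c 0" using has_vector_derivative_continuous[OF c(1)] .
  then have "\<forall>\<^sub>F s in nhds 0. c s \<in> V"
    using c(2) V(1) by (auto simp: isCont_def tendsto_def eventually_at_filter elim!: allE[of _ V] eventually_mono)
  then have ev: "\<forall>\<^sub>F s in nhds 0. \<Phi> (c s) \<in> coord_subspace S"
    using W by eventually_elim (simp add: slice)
  have "?w $ i = 0" if i: "i \<notin> S" for i
  proof -
    have "((\<lambda>s. \<Phi> (c s)) has_vector_derivative ?w) (at 0)"
      by (rule has_derivative_curve[OF der_\<Phi>[OF c(2)] c(1)])
    then have "((\<lambda>s. \<Phi> (c s) $ i) has_real_derivative ?w $ i) (at 0)"
      using bounded_linear.has_vector_derivative[OF bounded_linear_vec_nth]
      by (simp add: has_real_derivative_iff_has_vector_derivative)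
    moreover have "\<forall>\<^sub>F s in nhds 0. \<Phi> (c s) $ i = 0"
      using ev by eventually_elim (use i in \<open>simp add: coord_subspace_def\<close>)
    ultimately have "((\<lambda>s. 0) has_real_derivative ?w $ i) (at 0)"
      by (subst (asm) DERIV_cong_ev[OF refl _ refl]) auto
    then show ?thesis using DERIV_unique DERIV_const by blast
  qed
  then have "?w \<in> coord_subspace S" by (simp add: coord_subspace_def)
  moreover have "v = deriv_at \<Psi> (\<Phi> (c 0)) ?w" using deriv_inverse(1)[OF c(2)] by simp
  ultimately show ?thesis by blast
qed

lemma line_in_W:
  assumes p: "p \<in> V" "p \<in> W" and w: "w \<in> coord_subspace S"
  shows "\<forall>\<^sub>F s in nhds 0. \<Psi> (\<Phi> p + s *\<^sub>R w) \<in> W"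
proof -
  have "isCont (\<lambda>s::real. \<Phi> p + s *\<^sub>R w) 0" by simp
  then have "\<forall>\<^sub>F s in nhds 0. \<Phi> p + s *\<^sub>R w \<in> \<Phi> ` V"
    using p V(2) by (auto simp: isCont_def tendsto_def eventually_at_filter elim!: allE[of _ "\<Phi> ` V"] eventually_mono)
  then show ?thesis
  proof eventually_elim
    case (elim s)
    have "\<Phi> p + s *\<^sub>R w \<in> coord_subspace S"
      using slice[OF p(1)] p(2) w subspace_coord_subspace by (auto intro!: subspace_add subspace_scale)
    then show ?case using elim slice[OF V(5)[OF elim]] V(4)[OF elim] by simp
  qed
qed

end

text \<open>The definition collects vectors from all charts at once. A vector from another chart is
  the velocity of the image of a coordinate line, a curve in \<open>W\<close>, so it is tangent in
  the given chart.\<close>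

lemma tangent_space_chart:
  assumes ch: "slice_chart M W V \<Phi> \<Psi> S" and p: "p \<in> V" "p \<in> W"
  shows "tangent_space M W p = deriv_at \<Psi> (\<Phi> p) ` coord_subspace S"
proof
  interpret A: chart M W V \<Phi> \<Psi> S by unfold_locales (rule ch)
  show "deriv_at \<Psi> (\<Phi> p) ` coord_subspace S \<subseteq> tangent_space M W p"
    unfolding tangent_space_def using ch p A.der_\<Psi> by blast
  show "tangent_space M W p \<subseteq> deriv_at \<Psi> (\<Phi> p) ` coord_subspace S"
  proof
    fix v assume "v \<in> tangent_space M W p"
    then obtain V' \<Phi>' \<Psi>' S' D w where ch': "p \<in> V'" "slice_chart M W V' \<Phi>' \<Psi>' S'"
      and D: "(\<Psi>' has_derivative D) (at (\<Phi>' p))" and w: "w \<in> coord_subspace S'" "v = D w"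
      unfolding tangent_space_def by blast
    interpret B: chart M W V' \<Phi>' \<Psi>' S' by unfold_locales (rule ch'(2))
    let ?c = "\<lambda>s. \<Psi>' (\<Phi>' p + s *\<^sub>R w)"
    have c0: "?c 0 = p" using B.V(3)[OF ch'(1)] by simp
    have "((\<lambda>s. \<Phi>' p + s *\<^sub>R w) has_vector_derivative w) (at 0)"
      by (auto intro!: derivative_eq_intros)
    then have "(?c has_vector_derivative v) (at 0)"
      unfolding w(2) by (rule has_derivative_curve[rotated]) (use D in simp)
    from A.curve_tangent[OF this _ B.line_in_W[OF ch'(1) p(2) w(1)]] p(1)
    show "v \<in> deriv_at \<Psi> (\<Phi> p) ` coord_subspace S" unfolding c0 by blast
  qed
qed

lemma linear_deriv_at: "linear (deriv_at F x)"
  by (rule linearI) (simp_all add: vec_eq_iff deriv_at_def lie_def algebra_simps sum.distrib sum_distrib_left)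

lemma tangent_space_dim:
  assumes ch: "slice_chart M W V \<Phi> \<Psi> S" and p: "p \<in> V" "p \<in> W"
  shows "subspace (tangent_space M W p)" "dim (tangent_space M W p) = card S"
proof -
  interpret A: chart M W V \<Phi> \<Psi> S by unfold_locales (rule ch)
  have "inj (deriv_at \<Psi> (\<Phi> p))" using A.deriv_inverse(2)[OF p(1)] by (metis injI)
  then have "inj_on (deriv_at \<Psi> (\<Phi> p)) (span (coord_subspace S))" using inj_on_subset by blast
  then show "dim (tangent_space M W p) = card S"
    unfolding tangent_space_chart[OF assms] dim_coord_subspace[symmetric]
    by (intro dim_image_eq linear_deriv_at)
  show "subspace (tangent_space M W p)"
    unfolding tangent_space_chart[OF assms]
    by (intro linear_subspace_image linear_deriv_at subspace_coord_subspace)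
qed

section \<open>The integral manifold\<close>

context nagano_flow
begin

text \<open>\<open>G\<close> is idempotent on the cylinder, since it depends only on the
  \<open>S\<close>-coordinates and preserves them; its fixed points form its image, the graph over
  these coordinates.\<close>

definition W :: "(real^'n) set" where "W = {x \<in> cyl. G x = x}"

text \<open>A shear that subtracts the graph outside \<open>S\<close>; \<open>lift\<close> undoes it
  exactly, because \<open>G\<close> takes the same value before and after.\<close>

definition flat :: "real^'n \<Rightarrow> real^'n" where
  "flat x = (\<chi> j. if j \<in> S then x $ j else x $ j - G x $ j)"

definition lift :: "real^'n \<Rightarrow> real^'n" where
  "lift y = (\<chi> j. if j \<in> S then y $ j else y $ j + G y $ j)"

lemma flat_nth: "flat x $ j = (if j \<in> S then x $ j else x $ j - G x $ j)"
  and lift_nth: "lift y $ j = (if j \<in> S then y $ j else y $ j + G y $ j)"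
  by (simp_all add: flat_def lift_def)

lemma G_flat: "G (flat x) = G x" "flat x \<in> cyl \<longleftrightarrow> x \<in> cyl"
  by (rule G_cong, simp add: flat_nth)+

lemma G_lift: "G (lift x) = G x" "lift x \<in> cyl \<longleftrightarrow> x \<in> cyl"
  by (rule G_cong, simp add: lift_nth)+

lemma lift_flat: "lift (flat x) = x" and flat_lift: "flat (lift y) = y"
  by (simp_all add: vec_eq_iff flat_nth lift_nth G_flat G_lift)

lemma flat_image: "flat ` (U \<inter> cyl) = {y \<in> cyl. lift y \<in> U}"
proof
  show "flat ` (U \<inter> cyl) \<subseteq> {y \<in> cyl. lift y \<in> U}" by (auto simp: G_flat lift_flat)
  show "{y \<in> cyl. lift y \<in> U} \<subseteq> flat ` (U \<inter> cyl)"
  proof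
    fix y assume "y \<in> {y \<in> cyl. lift y \<in> U}"
    then show "y \<in> flat ` (U \<inter> cyl)"
      by (intro image_eqI[of _ _ "lift y"]) (auto simp: G_lift flat_lift)
  qed
qed

lemma map_M_flat: "map_M M cyl flat" and map_M_lift: "map_M M cyl lift"
proof -
  have "E_M M cyl (\<lambda>x. flat x $ j) \<and> E_M M cyl (\<lambda>x. lift x $ j)" for j
    by (cases "j \<in> S") (simp_all add: flat_nth lift_nth E_M_coord E_M_diff E_M_add G_E_M open_cyl)
  then show "map_M M cyl flat" "map_M M cyl lift" by (simp_all add: map_M_def)
qed

lemma W_leaf: "W \<subseteq> leaf"
proof
  fix x assume "x \<in> W"
  then have "x \<in> cyl" "G x = x" by (simp_all add: W_def)
  then show "x \<in> leaf" using G_leaf[of x] by simp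
qed

lemma W_U: "W \<subseteq> U"
  using W_leaf leaf_B BU by blast

lemma W_cyl: "W \<subseteq> cyl" by (auto simp: W_def)

lemma W_chart: "slice_chart M W (U \<inter> cyl) flat lift S"
  unfolding slice_chart_def
proof (intro conjI)
  have "continuous_on cyl lift"
    by (rule differentiable_imp_continuous_on)
      (use map_M_has_derivative[OF open_cyl map_M_lift] in
        \<open>auto simp: differentiable_on_def intro: has_derivative_at_withinI differentiableI\<close>)
  from continuous_open_preimage[OF this open_cyl U(1)]
  show "open (flat ` (U \<inter> cyl))" unfolding flat_image by (simp add: vimage_def Int_def)
  show "map_M M (U \<inter> cyl) flat"
    using map_M_flat E_M_subset unfolding map_M_def by blast
  show "map_M M (flat ` (U \<inter> cyl)) lift"
    unfolding flat_image using map_M_lift E_M_subset[of M cyl _ "{y \<in> cyl. lift y \<in> U}"]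
    unfolding map_M_def by auto
  have WE: "x \<in> W \<longleftrightarrow> flat x \<in> coord_subspace S" if "x \<in> cyl" for x
  proof -
    have "flat x \<in> coord_subspace S \<longleftrightarrow> (\<forall>j. j \<notin> S \<longrightarrow> G x $ j = x $ j)"
      by (auto simp: coord_subspace_def flat_nth)
    also have "\<dots> \<longleftrightarrow> (\<forall>j. G x $ j = x $ j)" using G_nth_S[OF that] by blast
    finally show ?thesis using that by (simp add: W_def vec_eq_iff)
  qed
  show "flat ` (W \<inter> (U \<inter> cyl)) = flat ` (U \<inter> cyl) \<inter> coord_subspace S"
    using WE by auto
qed (auto simp: U open_cyl lift_flat flat_lift)

lemma W_submanifold: "submanifold_M M U W"
  unfolding submanifold_M_def
proof (intro conjI ballI)
  fix p assume "p \<in> W"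
  then have "p \<in> U \<inter> cyl" using W_U W_cyl by blast
  then show "\<exists>V \<Phi> \<Psi> S. p \<in> V \<and> V \<subseteq> U \<and> slice_chart M W V \<Phi> \<Psi> S"
    using W_chart Int_lower1[of U cyl] by (intro exI conjI)
qed (rule W_U)

lemma p0_W: "p0 \<in> W"
  by (simp add: W_def p0_cyl G_p0)

text \<open>Outside \<open>S\<close> the vector \<open>w\<close> vanishes and the derivative is that
  of \<open>G\<close>; inside \<open>S\<close> both sides have components \<open>w\<close>.\<close>

lemma deriv_at_lift:
  assumes y: "y \<in> cyl" and w: "w \<in> coord_subspace S"
  shows "deriv_at lift y w = V w (G y)"
proof -
  have GB: "G y \<in> B" using G_leaf[OF y] leaf_B by blast
  have "deriv_at lift y w $ j = (if j \<in> S then w $ j else w $ j + V w (G y) $ j)" for j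
  proof -
    have id: "((\<lambda>y :: real^'n. y $ j) has_derivative (\<lambda>v. v $ j)) (at y)"
      by (rule bounded_linear_imp_has_derivative) (rule bounded_linear_vec_nth)
    have "((\<lambda>y. lift y $ j) has_derivative (\<lambda>v. if j \<in> S then v $ j else v $ j + V v (G y) $ j)) (at y)"
    proof (cases "j \<in> S")
      case True
      then show ?thesis using id by (simp add: lift_nth)
    next
      case False
      then show ?thesis
        using has_derivative_add[OF id bounded_linear.has_derivative[OF bounded_linear_vec_nth G_has_derivative[OF y]]]
        by (simp add: lift_nth)
    qed
    from has_derivative_unique[OF bounded_linear.has_derivative[OF bounded_linear_vec_nth
        map_M_has_derivative[OF open_cyl map_M_lift y]] this]
    show ?thesis by (rule fun_cong)
  qed
  then show ?thesis
    using w V_nth_S[OF _ GB] by (simp add: vec_eq_iff coord_subspace_def)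
qed

lemma proj_on_coord_subspace: "proj_on S v \<in> coord_subspace S"
  by (simp add: coord_subspace_def)

lemma V_in_g:
  obtains Q where "Q \<in> g" "Q x = V w x"
proof -
  \<comment> \<open>The reciprocal is frozen at \<open>x\<close>, so the coefficients are constants
    and zeros of \<open>\<delta>\<close> elsewhere in \<open>U\<close> do no harm.\<close>
  let ?Q = "\<lambda>y. \<Sum>i\<in>S. (w $ i * inverse (\<delta> x)) *\<^sub>R Y i y"
  have "?Q \<in> g" by (intro g_sum g_cscale Y_g)
  moreover have "?Q x = V w x"
    unfolding V_def by (rule sum.mono_neutral_cong_left) (auto simp: X_def)
  ultimately show ?thesis using that by blast
qed

lemma V_mem_g: "V w x \<in> {Q x | Q. Q \<in> g}"
proof -
  obtain Q where "Q \<in> g" "Q x = V w x" using V_in_g .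
  then show ?thesis by (metis (mono_tags, lifting) mem_Collect_eq)
qed

lemma g_at_leaf_V:
  assumes "Q \<in> g" "p \<in> leaf" shows "Q p = V (Q p) p"
proof -
  have "Q p = (\<Sum>k\<in>S. Q p $ k *\<^sub>R X k p)" by (rule g_at_leaf[OF assms])
  also have "\<dots> = V (Q p) p"
    unfolding V_def by (rule sum.mono_neutral_cong_left) (auto simp: X_def)
  finally show ?thesis .
qed

lemma g_at_leaf_eq:
  assumes p: "p \<in> leaf"
  shows "{Q p | Q. Q \<in> g} = (\<lambda>w. V w p) ` coord_subspace S"
proof
  show "{Q p | Q. Q \<in> g} \<subseteq> (\<lambda>w. V w p) ` coord_subspace S"
    using g_at_leaf_V[OF _ p] V_proj_on proj_on_coord_subspace by (smt (verit) imageI mem_Collect_eq subsetI)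
  show "(\<lambda>w. V w p) ` coord_subspace S \<subseteq> {Q p | Q. Q \<in> g}"
    using V_mem_g by (rule image_subsetI)
qed

lemma W_tangent:
  assumes p: "p \<in> W" shows "tangent_space M W p = {Q p | Q. Q \<in> g}"
proof -
  have "p \<in> U \<inter> cyl" using p W_U W_cyl by blast
  then have "tangent_space M W p = deriv_at lift (flat p) ` coord_subspace S"
    by (rule tangent_space_chart[OF W_chart _ p])
  also have "\<dots> = (\<lambda>w. V w p) ` coord_subspace S"
  proof (rule image_cong[OF refl])
    fix w assume w: "w \<in> coord_subspace S"
    have "flat p \<in> cyl" "G (flat p) = p" using p by (auto simp: G_flat W_def)
    then show "deriv_at lift (flat p) w = V w p" using deriv_at_lift[OF _ w] by metis
  qed
  finally show ?thesis using g_at_leaf_eq p W_leaf by blast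
qed

lemma linear_V: "linear (\<lambda>w. V w x)"
  unfolding V_def by (rule linearI) (simp_all add: algebra_simps sum.distrib scaleR_sum_right)

lemma V_image_dim:
  assumes x: "x \<in> B" shows "dim ((\<lambda>w. V w x) ` coord_subspace S) = card S"
proof -
  have "inj_on (\<lambda>w. V w x) (coord_subspace S)"
  proof (rule inj_onI)
    fix a b assume ab: "a \<in> coord_subspace S" "b \<in> coord_subspace S" "V a x = V b x"
    have "a $ l = b $ l" for l
      using ab V_nth_S[OF _ x, of l] by (cases "l \<in> S") (metis, simp add: coord_subspace_def)
    then show "a = b" by (simp add: vec_eq_iff)
  qed
  moreover have "span (coord_subspace S) = (coord_subspace S :: (real^'n) set)"
    using subspace_coord_subspace by (simp add: span_eq_iff)
  ultimately have "inj_on (\<lambda>w. V w x) (span (coord_subspace S))" by (simp only:)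
  then show ?thesis
    unfolding dim_coord_subspace[symmetric] by (intro dim_image_eq linear_V)
qed

section \<open>Uniqueness of the germ\<close>

lemma W_unique:
  assumes sub: "submanifold_M M U W'" and p0: "p0 \<in> W'"
    and tan: "\<And>p. p \<in> W' \<Longrightarrow> tangent_space M W' p = {Q p | Q. Q \<in> g}"
  shows "\<exists>N. open N \<and> p0 \<in> N \<and> W \<inter> N = W' \<inter> N"
proof -
  obtain V' \<Phi> \<Psi> S' where p0V: "p0 \<in> V'" and ch: "slice_chart M W' V' \<Phi> \<Psi> S'"
    using sub p0 unfolding submanifold_M_def by blast
  interpret C: chart M W' V' \<Phi> \<Psi> S' by unfold_locales (rule ch)
  have p0l: "p0 \<in> leaf" using p0_W W_leaf by blast
  have card: "card S' = card S"
  proof -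
    have "card S' = dim (tangent_space M W' p0)" by (rule tangent_space_dim(2)[OF ch p0V p0, symmetric])
    also have "\<dots> = dim ((\<lambda>w. V w p0) ` coord_subspace S)"
      unfolding tan[OF p0] g_at_leaf_eq[OF p0l] ..
    also have "\<dots> = card S" by (rule V_image_dim[OF p0B])
    finally show ?thesis .
  qed
  \<comment> \<open>Points of \<open>W'\<close> are not known to lie in the zero set, but the values
    of \<open>V\<close> belong to those of \<open>g\<close> everywhere; equal dimension then forces
    equality with the tangent space.\<close>
  have tanV: "v = V v p" if p: "p \<in> W'" "p \<in> V'" "p \<in> B" and v: "v \<in> tangent_space M W' p" for p v
  proof -
    let ?E = "(\<lambda>w. V w p) ` coord_subspace S"
    have "?E \<subseteq> tangent_space M W' p"
    proof
      fix u assume "u \<in> ?E"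
      then obtain w where "u = V w p" by blast
      then show "u \<in> tangent_space M W' p"
        unfolding tan[OF p(1)] by (simp only: V_mem_g)
    qed
    moreover have "subspace ?E" by (intro linear_subspace_image linear_V subspace_coord_subspace)
    moreover have "dim (tangent_space M W' p) \<le> dim ?E"
      using tangent_space_dim(2)[OF ch p(2,1)] V_image_dim[OF p(3)] card by simp
    ultimately have "?E = tangent_space M W' p"
      using tangent_space_dim(1)[OF ch p(2,1)] by (intro subspace_dim_equal)
    then obtain w where w: "w \<in> coord_subspace S" "v = V w p" using v by blast
    have "proj_on S v = w"
      using w(1) by (simp add: w(2) vec_eq_iff coord_subspace_def V_nth_S[OF _ p(3)])
    then show ?thesis using V_proj_on[of v p] w(2) by simp
  qed
  define y0 where "y0 = \<Phi> p0"
  have y0: "y0 \<in> \<Phi> ` V'" "\<Psi> y0 = p0" "y0 \<in> coord_subspace S'"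
    using p0V C.V(3)[OF p0V] C.slice[OF p0V] p0 by (auto simp: y0_def)
  have "open (\<Phi> ` V' \<inter> \<Psi> -` (B \<inter> cyl))"
    by (rule continuous_open_preimage[OF C.continuous_\<Psi> C.V(2)]) (intro open_Int open_ball open_cyl)
  moreover have "y0 \<in> \<Phi> ` V' \<inter> \<Psi> -` (B \<inter> cyl)" using y0 p0B p0_cyl by simp
  ultimately obtain \<rho>1 where \<rho>1: "\<rho>1 > 0" "cball y0 \<rho>1 \<subseteq> \<Phi> ` V' \<inter> \<Psi> -` (B \<inter> cyl)"
    using open_contains_cball by blast
  have "\<exists>C. \<forall>y\<in>cball y0 \<rho>1. \<bar>pd [i] (\<lambda>y. \<Psi> y $ j) y\<bar> \<le> C" for i j
    using C.E_M_charts(2) \<rho>1(2) unfolding map_M_def E_M_iff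
    by (intro class_bound_imp_bounded[where \<mu> = "small_m M"]) auto
  then obtain A where A: "\<And>i j y. y \<in> cball y0 \<rho>1 \<Longrightarrow> \<bar>pd [i] (\<lambda>y. \<Psi> y $ j) y\<bar> \<le> A i j" by metis
  define A' where "A' = (\<Sum>(i, j)\<in>UNIV. \<bar>A i j\<bar>)"
  have A'0: "A' \<ge> 0" unfolding A'_def by (intro sum_nonneg) auto
  have A': "\<bar>pd [i] (\<lambda>y. \<Psi> y $ j) y\<bar> \<le> A'" if "y \<in> cball y0 \<rho>1" for i j y
  proof -
    have "\<bar>A i j\<bar> \<le> A'"
      unfolding A'_def using member_le_sum[of "(i, j)" UNIV "\<lambda>(i, j). \<bar>A i j\<bar>"] by auto
    then show ?thesis using A[OF that, of i j] by linarith
  qed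
  define K where "K = real CARD('n) * (real CARD('n) * A') + 1"
  have K0: "K > 0" using A'0 by (simp add: K_def add_nonneg_pos)
  have K: "norm (deriv_at \<Psi> y v) \<le> K * norm v" if "y \<in> cball y0 \<rho>1" for y v
  proof -
    have "norm (deriv_at \<Psi> y v) \<le> real CARD('n) * (real CARD('n) * A' * norm v)"
      by (rule norm_le_card_max) (simp add: deriv_at_def abs_lie_const_le[OF A'[OF that]])
    also have "\<dots> \<le> K * norm v" by (simp add: K_def algebra_simps)
    finally show ?thesis .
  qed
  \<comment> \<open>Segments of the chart from \<open>y0\<close> then map to curves of speed at most
    \<open>K * \<rho>\<close>, and \<open>L * (K * \<rho>) \<le> 1/2\<close> fits
    \<open>half_gronwall\<close>.\<close>
  define \<rho> where "\<rho> = min \<rho>1 (1 / (2 * (L * K)))"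
  have \<rho>: "\<rho> > 0" "\<rho> \<le> \<rho>1" "L * (K * \<rho>) \<le> 1/2"
  proof -
    show "\<rho> > 0" "\<rho> \<le> \<rho>1" using \<rho>1 L K0 by (auto simp: \<rho>_def)
    have "L * (K * \<rho>) \<le> L * (K * (1 / (2 * (L * K))))"
      using L K0 by (intro mult_left_mono) (auto simp: \<rho>_def)
    then show "L * (K * \<rho>) \<le> 1/2" using L K0 by simp
  qed
  have ballV: "y \<in> \<Phi> ` V'" "\<Psi> y \<in> B" "\<Psi> y \<in> cyl" "y \<in> cball y0 \<rho>1" if "y \<in> ball y0 \<rho>" for y
    using that \<rho>(2) \<rho>1(2) by (auto simp: subset_iff)
  have in_W': "\<Psi> y \<in> W'" if "y \<in> ball y0 \<rho>" "y \<in> coord_subspace S'" for y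
    using C.slice[OF C.V(5)[OF ballV(1)[OF that(1)]]] C.V(4)[OF ballV(1)[OF that(1)]] that(2) by simp
  have step1: "\<Psi> y \<in> W" if y: "y \<in> ball y0 \<rho>" "y \<in> coord_subspace S'" for y
  proof -
    define \<eta> where "\<eta> s = y0 + s *\<^sub>R (y - y0)" for s
    have \<eta>S: "\<eta> s \<in> coord_subspace S'" for s
      unfolding \<eta>_def using y0(3) y(2) subspace_coord_subspace
      by (intro subspace_add subspace_scale subspace_diff) auto
    have \<eta>: "\<eta> s \<in> ball y0 \<rho>" if "s \<in> {0..1}" for s
    proof -
      have "dist y0 (\<eta> s) = \<bar>s\<bar> * dist y0 y" by (simp add: \<eta>_def dist_norm norm_minus_commute)
      also have "\<dots> \<le> 1 * dist y0 y" using that by (intro mult_right_mono) auto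
      finally show ?thesis using y(1) by simp
    qed
    have d\<eta>: "(\<eta> has_vector_derivative y - y0) (at s)" for s
      unfolding \<eta>_def[abs_def] by (auto intro!: derivative_eq_intros)
    let ?c = "\<lambda>s. \<Psi> (\<eta> s)"
    let ?c' = "\<lambda>s. deriv_at \<Psi> (\<eta> s) (y - y0)"
    \<comment> \<open>The deviation from the graph: the velocities of \<open>?c\<close> and of its
      image under \<open>G\<close> are \<open>V (?c' s)\<close> at the two points, and both curves
      start at \<open>p0\<close>; the Lipschitz estimate forces them to coincide.\<close>
    define z where "z s = ?c s - G (?c s)" for s
    have "norm (z 1) \<le> 2 * 0"
    proof (rule half_gronwall[where z' = "\<lambda>s. ?c' s - V (?c' s) (G (?c s))"])
      have "continuous_on {0..1} \<eta>" unfolding \<eta>_def[abs_def] by (intro continuous_intros)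
      then have "continuous_on {0..1} ?c"
        by (rule continuous_on_compose2[OF C.continuous_\<Psi>]) (use \<eta> ballV in blast)
      moreover from this have "continuous_on {0..1} (\<lambda>s. G (?c s))"
        by (rule continuous_on_compose2[OF continuous_on_G]) (use \<eta> ballV in blast)
      ultimately show "continuous_on {0..1} z" unfolding z_def[abs_def] by (intro continuous_intros)
      show "z 0 = 0" by (simp add: z_def \<eta>_def y0(2) G_p0)
    next
      fix s :: real assume "0 < s" "s < 1"
      then have \<eta>s: "\<eta> s \<in> ball y0 \<rho>" using \<eta> by simp
      have dc: "(?c has_vector_derivative ?c' s) (at s)"
        by (rule has_derivative_curve[OF C.der_\<Psi>[OF ballV(1)[OF \<eta>s]] d\<eta>])
      show "(z has_vector_derivative ?c' s - V (?c' s) (G (?c s))) (at s)"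
        unfolding z_def[abs_def]
        by (intro has_vector_derivative_diff dc has_derivative_curve[OF G_has_derivative dc] ballV(3) \<eta>s)
      have cV: "?c s \<in> V'" by (rule C.V(5)[OF ballV(1)[OF \<eta>s]])
      have yS: "y - y0 \<in> coord_subspace S'" using y(2) y0(3) subspace_coord_subspace by (intro subspace_diff) auto
      have "?c' s \<in> tangent_space M W' (?c s)"
        unfolding tangent_space_chart[OF ch cV in_W'[OF \<eta>s \<eta>S]] C.V(4)[OF ballV(1)[OF \<eta>s]]
        using yS by blast
      then have "?c' s = V (?c' s) (?c s)"
        by (rule tanV[OF in_W'[OF \<eta>s \<eta>S] cV ballV(2)[OF \<eta>s]])
      then have "norm (?c' s - V (?c' s) (G (?c s))) = norm (V (?c' s) (?c s) - V (?c' s) (G (?c s)))" by simp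
      also have "\<dots> \<le> L * norm (?c' s) * norm (z s)"
        unfolding z_def by (intro V_lip ballV(2) \<eta>s leaf_B G_leaf ballV(3))
      also have "\<dots> \<le> 1/2 * norm (z s)"
      proof (rule mult_right_mono)
        have "norm (?c' s) \<le> K * norm (y - y0)" by (rule K[OF ballV(4)[OF \<eta>s]])
        also have "\<dots> \<le> K * \<rho>" using y(1) K0 by (intro mult_left_mono) (auto simp: dist_norm norm_minus_commute)
        finally have "L * norm (?c' s) \<le> L * (K * \<rho>)" using L by (intro mult_left_mono) auto
        then show "L * norm (?c' s) \<le> 1/2" using \<rho>(3) by simp
      qed simp
      finally show "norm (?c' s - V (?c' s) (G (?c s))) \<le> 1/2 * norm (z s) + 0" by simp
    qed auto
    then show ?thesis using ballV(3)[OF y(1)] by (simp add: z_def \<eta>_def W_def)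
  qed
  text \<open>Conversely \<open>W\<close> is a graph over the coordinates \<open>S\<close>, so the projection of \<open>W'\<close> to these coordinates is
    injective near \<open>p0\<close>; the dimensions agree, so by invariance of domain it covers a neighbourhood.\<close>
  let ?D = "coord_subspace S' \<inter> ball y0 \<rho>"
  let ?h = "\<lambda>y. proj_on S (\<Psi> y)"
  have "openin (top_of_set (coord_subspace S)) (?h ` ?D)"
  proof (rule invariance_of_domain_subspaces)
    show "openin (top_of_set (coord_subspace S')) ?D" by (intro openin_open_Int open_ball)
    show "dim (coord_subspace S :: (real^'n) set) \<le> dim (coord_subspace S' :: (real^'n) set)"
      by (simp add: dim_coord_subspace card)
    show "continuous_on ?D ?h"
      by (intro bounded_linear.continuous_on[OF bounded_linear_proj_on] continuous_on_subset[OF C.continuous_\<Psi>])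
        (use ballV(1) in blast)
    show "?h \<in> ?D \<rightarrow> coord_subspace S" using proj_on_coord_subspace by blast
    show "inj_on ?h ?D"
    proof (rule inj_onI)
      fix a b assume ab: "a \<in> ?D" "b \<in> ?D" "?h a = ?h b"
      have "\<Psi> a $ l = \<Psi> b $ l" if "l \<in> S" for l
        using arg_cong[OF ab(3), of "\<lambda>v. v $ l"] that by simp
      from G_cong(1)[OF this] have "\<Psi> a = \<Psi> b"
        using step1[of a] step1[of b] ab(1,2) by (auto simp: W_def)
      then show "a = b" using C.V(4)[OF ballV(1)] ab(1,2) by (metis IntE)
    qed
  qed (rule subspace_coord_subspace)+
  then obtain T where T: "open T" "?h ` ?D = coord_subspace S \<inter> T"
    unfolding openin_open by blast
  \<comment> \<open>A point of \<open>W\<close> in this set has \<open>S\<close>-coordinates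
    attained by a point of \<open>W'\<close> that lies in \<open>W\<close>; as \<open>W\<close> is a
    graph, the two points are equal.\<close>
  define N where "N = (V' \<inter> \<Phi> -` ball y0 \<rho>) \<inter> proj_on S -` T"
  have "open N"
    unfolding N_def
    by (intro open_Int continuous_open_preimage[OF C.continuous_\<Phi> C.V(1)] open_ball
      open_vimage[OF T(1)] bounded_linear.continuous_on[OF bounded_linear_proj_on continuous_on_id])
  moreover have "p0 \<in> N"
  proof -
    have "y0 \<in> ?D" using y0(3) \<rho>(1) by simp
    then have "?h y0 \<in> T" using T(2) by blast
    then show ?thesis using p0V \<rho>(1) by (simp add: N_def y0(2) y0_def[symmetric])
  qed
  moreover have "W \<inter> N = W' \<inter> N"
  proof (intro equalityI subsetI)
    fix x assume x: "x \<in> W' \<inter> N"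
    then have "\<Phi> x \<in> ball y0 \<rho>" "\<Phi> x \<in> coord_subspace S'" "x \<in> V'"
      using C.slice by (auto simp: N_def)
    then show "x \<in> W \<inter> N" using step1[of "\<Phi> x"] C.V(3) x by auto
  next
    fix x assume x: "x \<in> W \<inter> N"
    then have "proj_on S x \<in> ?h ` ?D" unfolding T(2) using proj_on_coord_subspace by (auto simp: N_def)
    then obtain y where y: "y \<in> ?D" "proj_on S x = ?h y" by blast
    have "x $ l = \<Psi> y $ l" if "l \<in> S" for l
      using arg_cong[OF y(2), of "\<lambda>v. v $ l"] that by simp
    from G_cong(1)[OF this] have "x = \<Psi> y"
      using step1[of y] y(1) x by (auto simp: W_def)
    then show "x \<in> W' \<inter> N" using in_W'[of y] y(1) x by auto
  qed
  ultimately show ?thesis by blast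
qed

end

context nagano
begin

lemma exists_leaf:
  "\<exists>W. submanifold_M M U W \<and> p0 \<in> W \<and>
     (\<forall>p\<in>W. tangent_space M W p = {X p | X. X \<in> g}) \<and>
     (\<forall>W'. submanifold_M M U W' \<and> p0 \<in> W' \<and>
           (\<forall>p\<in>W'. tangent_space M W' p = {X p | X. X \<in> g}) \<longrightarrow>
         (\<exists>V. open V \<and> p0 \<in> V \<and> W \<inter> V = W' \<inter> V))"
proof -
  obtain S \<delta> Y where fr: "frame S \<delta> Y" and max: "\<And>Z. Z \<in> g_vert S \<Longrightarrow> Z p0 = 0"
    by (rule exists_maximal_frame) blast
  define \<epsilon> where "\<epsilon> = \<bar>\<delta> p0\<bar> / 2"
  have \<epsilon>: "\<epsilon> > 0" using fr by (simp add: \<epsilon>_def frame_def)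
  have "continuous_on U \<delta>"
    using fr smooth_on_continuous0 unfolding frame_def E_M_def by blast
  then have "isCont \<delta> p0" using U continuous_on_eq_continuous_at by blast
  then obtain R1 where R1: "R1 > 0" "\<And>x. dist x p0 < R1 \<Longrightarrow> \<bar>\<delta> x - \<delta> p0\<bar> < \<epsilon>"
    unfolding continuous_at_eps_delta using \<epsilon> by (auto simp: dist_real_def)
  obtain R2 where R2: "R2 > 0" "cball p0 R2 \<subseteq> U" using U open_contains_cball by blast
  define R where "R = min R1 R2"
  interpret F: nagano_frame M U p0 g S \<delta> Y R \<epsilon>
  proof
    show "R > 0" using R1 R2 by (simp add: R_def)
    show "cball p0 R \<subseteq> U" using R2 by (auto simp: R_def)
    fix x assume "x \<in> ball p0 R"
    then have "\<bar>\<delta> x - \<delta> p0\<bar> < \<epsilon>" by (intro R1) (simp add: R_def dist_commute)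
    then show "\<epsilon> \<le> \<bar>\<delta> x\<bar>" unfolding \<epsilon>_def by linarith
  qed (fact fr max \<epsilon>)+
  obtain L where L: "L > 0"
    "\<And>t x. x \<in> ball p0 R \<Longrightarrow> norm (F.V t x) \<le> L * norm t"
    "\<And>t x y. x \<in> ball p0 R \<Longrightarrow> y \<in> ball p0 R \<Longrightarrow> norm (F.V t x - F.V t y) \<le> L * norm t * norm (x - y)"
    "\<And>t x v. x \<in> ball p0 R \<Longrightarrow> norm (deriv_at (F.V t) x v) \<le> L * norm t * norm v"
    "\<And>t x y. x \<in> ball p0 R \<Longrightarrow> y \<in> ball p0 R \<Longrightarrow>
      norm (F.V t y - F.V t x - deriv_at (F.V t) x (y - x)) \<le> L * norm t * (norm (y - x))\<^sup>2"
    by (rule F.exists_V_bounds) blast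
  define r where "r = min (1/2) (R/2) / L"
  interpret N: nagano_flow M U p0 g S \<delta> Y R \<epsilon> L r
  proof
    show "r > 0" "L * r \<le> 1/2" "L * r \<le> R/2" using L(1) F.R(1) by (auto simp: r_def)
  qed (fact L)+
  show ?thesis
  proof (rule exI[of _ N.W], intro conjI ballI allI impI)
    fix W' assume W': "submanifold_M M U W' \<and> p0 \<in> W' \<and>
      (\<forall>p\<in>W'. tangent_space M W' p = {X p | X. X \<in> g})"
    show "\<exists>V. open V \<and> p0 \<in> V \<and> N.W \<inter> V = W' \<inter> V"
    proof (rule N.W_unique)
      show "submanifold_M M U W'" "p0 \<in> W'" using W' by simp_all
      show "tangent_space M W' p = {X p | X. X \<in> g}" if "p \<in> W'" for p
        using W' that by (elim conjE) (drule (1) bspec)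
    qed
  qed (rule N.W_submanifold N.p0_W N.W_tangent, assumption?)+
qed

end

theorem mainTheorem1:
  fixes M :: "nat \<Rightarrow> real" and U :: "(real^'n::finite) set" and p0 :: "real^'n"
    and g :: "(real^'n \<Rightarrow> real^'n) set"
  assumes "weight_seq M" and "regular_ws M" and "quasianalytic M"
    and "open U" and "p0 \<in> U"
    and "lie_subalgebra M U g" and "EM_module M U g"
  shows "\<exists>W. submanifold_M M U W \<and> p0 \<in> W \<and>
           (\<forall>p\<in>W. tangent_space M W p = {X p | X. X \<in> g}) \<and>
           (\<forall>W'. submanifold_M M U W' \<and> p0 \<in> W' \<and>
                 (\<forall>p\<in>W'. tangent_space M W' p = {X p | X. X \<in> g}) \<longrightarrow>
               (\<exists>V. open V \<and> p0 \<in> V \<and> W \<inter> V = W' \<inter> V))"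
proof -
  interpret nagano M U p0 g using assms by unfold_locales
  show ?thesis by (rule exists_leaf)
qed

end
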